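(* Let $\Lambda\subset M$ be a compact invariant set of the flow $\Phi$ and let $\Phi_r$ be a time reparameterization of $\Phi$ with an associated positive continuous function $r\colon\Lambda\to\mathbb{R}_{>0}$. Then for every continuous function $\xi\colon\Lambda\to\mathbb{R}$ we have $$P_{\rm top}\Big(\Phi_r,\frac{\xi-P_{\rm top}(\Phi,\xi)}{r}\Big)=0 .$$
   Context: Setting. $M$ is a manifold of class $C^m$, $m\ge 2$, with a Riemannian metric of class $C^{m-1}$ and induced distance $\rho$. $f$ is a $C^\ell$ vector field on $M$, $1\le \ell<m$, such that $dx/dt=f(x)$ generates a $C^\ell$ flow $\Phi=\{\varphi^t\}_{t\in\mathbb{R}}$. A $C^\ell$ flow $\Phi_r=\{\varphi^\tau_r\}_{\tau\in\mathbb{R}}$ is a time reparameterization of $\Phi$ with associated function $r$ if the orbits of both flows coincide with the same orientation and the times are related by $d\tau=r(x)\,dt$. That is, $\varphi_r^{\tau(x,t)}(x)=\varphi^t(x)$ with $\tau(x,t)=\int_0^t r(\varphi^s(x))\,ds$, and $\tau\mapsto\varphi_r^\tau(x)$ solves $dx/d\tau=f(x)/r(x)$. Both flows are considered on the compact invariant set $\Lambda$. Topological pressure. A set $E\subset\Lambda$ is $(t,\varepsilon)$-separated (for $\Phi$) if for all $x_1\neq x_2$ in $E$ there is $s\in[0,t]$ with $\rho(\varphi^s(x_1),\varphi^s(x_2))>\varepsilon$. For continuous $\xi\colon\Lambda\to\mathbb{R}$, $$P_{\rm top}(\Phi,\xi)=\lim_{\varepsilon\to0}\limsup_{t\to\infty}\frac1t\log\sup_E\sum_{x\in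 E}\exp\int_0^t\xi(\varphi^s(x))\,ds,$$ the supremum being over all $(t,\varepsilon)$-separated sets $E\subset\Lambda$. $P_{\rm top}(\Phi_r,\cdot)$ is defined in the same way for the flow $\Phi_r$ on $\Lambda$. *)

theory Defs
  imports "HOL-Analysis.Analysis"
begin

section \<open>Manifolds, metrics and vector fields of finite differentiability class\<close>

text \<open>
  \<open>Ck_on k f S\<close> is only meant for open \<open>S\<close>. Since the domain is finite-dimensional, requiring
  every directional derivative to be of class \<open>C\<^sup>k\<close> amounts to the total derivative being of
  class \<open>C\<^sup>k\<close>.
\<close>

primrec Ck_on :: "nat \<Rightarrow> ('b::euclidean_space \<Rightarrow> 'c::real_normed_vector) \<Rightarrow> 'b set \<Rightarrow> bool" where
  "Ck_on 0 f S \<longleftrightarrow> continuous_on S f"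
| "Ck_on (Suc k) f S \<longleftrightarrow>
     (\<exists>D. (\<forall>x\<in>S. (f has_derivative D x) (at x)) \<and> (\<forall>v. Ck_on k (\<lambda>x. D x v) S))"

text \<open>
  The manifold is the whole type \<open>'a\<close> (Hausdorff and second countable through its type classes),
  modelled on the Euclidean space \<open>'b\<close>. A chart is its domain together with its coordinate map;
  the values of the map outside the domain are irrelevant.
\<close>

type_synonym ('a, 'b) chart = "'a set \<times> ('a \<Rightarrow> 'b)"

abbreviation chart_dom :: "('a, 'b) chart \<Rightarrow> 'a set" where
  "chart_dom \<equiv> fst"

abbreviation chart_map :: "('a, 'b) chart \<Rightarrow> 'a \<Rightarrow> 'b" where
  "chart_map \<equiv> snd"

definition chart_inv :: "('a, 'b) chart \<Rightarrow> 'b \<Rightarrow> 'a" where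
  "chart_inv \<kappa> = inv_into (chart_dom \<kappa>) (chart_map \<kappa>)"

definition transition :: "('a, 'b) chart \<Rightarrow> ('a, 'b) chart \<Rightarrow> 'b \<Rightarrow> 'b" where
  "transition \<kappa> \<kappa>' = chart_map \<kappa>' \<circ> chart_inv \<kappa>"

definition Ck_atlas ::
  "nat \<Rightarrow> ('a::{t2_space,second_countable_topology}, 'b::euclidean_space) chart set \<Rightarrow> bool" where
  "Ck_atlas m A \<longleftrightarrow>
     (\<forall>\<kappa>\<in>A. open (chart_dom \<kappa>) \<and> open (chart_map \<kappa> ` chart_dom \<kappa>) \<and>
        homeomorphism (chart_dom \<kappa>) (chart_map \<kappa> ` chart_dom \<kappa>) (chart_map \<kappa>) (chart_inv \<kappa>)) \<and>
     (\<Union>\<kappa>\<in>A. chart_dom \<kappa>) = UNIV \<and>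
     (\<forall>\<kappa>\<in>A. \<forall>\<kappa>'\<in>A. Ck_on m (transition \<kappa> \<kappa>') (chart_map \<kappa> ` (chart_dom \<kappa> \<inter> chart_dom \<kappa>')))"

text \<open>
  Tensor fields are given by their components in each chart, subject to the transformation law
  under the differential of the coordinate change: \<open>f \<kappa> p\<close> is the coordinate vector of \<open>f(p)\<close> in
  the chart \<open>\<kappa>\<close>, and \<open>g \<kappa> p\<close> is the bilinear form on coordinate vectors in \<open>\<kappa>\<close>.
\<close>

definition trans_diff :: "('a, 'b::euclidean_space) chart \<Rightarrow> ('a, 'b) chart \<Rightarrow> 'a \<Rightarrow> 'b \<Rightarrow> 'b" where
  "trans_diff \<kappa> \<kappa>' p = frechet_derivative (transition \<kappa> \<kappa>') (at (chart_map \<kappa> p))"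

definition Ck_vector_field ::
  "nat \<Rightarrow> ('a, 'b::euclidean_space) chart set \<Rightarrow> (('a, 'b) chart \<Rightarrow> 'a \<Rightarrow> 'b) \<Rightarrow> bool" where
  "Ck_vector_field k A f \<longleftrightarrow>
     (\<forall>\<kappa>\<in>A. \<forall>\<kappa>'\<in>A. \<forall>p\<in>chart_dom \<kappa> \<inter> chart_dom \<kappa>'. f \<kappa>' p = trans_diff \<kappa> \<kappa>' p (f \<kappa> p)) \<and>
     (\<forall>\<kappa>\<in>A. Ck_on k (\<lambda>y. f \<kappa> (chart_inv \<kappa> y)) (chart_map \<kappa> ` chart_dom \<kappa>))"

definition Ck_riemannian_metric ::
  "nat \<Rightarrow> ('a, 'b::euclidean_space) chart set \<Rightarrow> (('a, 'b) chart \<Rightarrow> 'a \<Rightarrow> 'b \<Rightarrow> 'b \<Rightarrow> real) \<Rightarrow> bool"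
  where
  "Ck_riemannian_metric k A g \<longleftrightarrow>
     (\<forall>\<kappa>\<in>A. \<forall>p\<in>chart_dom \<kappa>. bilinear (g \<kappa> p) \<and> (\<forall>v w. g \<kappa> p v w = g \<kappa> p w v) \<and>
        (\<forall>v. v \<noteq> 0 \<longrightarrow> 0 < g \<kappa> p v v)) \<and>
     (\<forall>\<kappa>\<in>A. \<forall>\<kappa>'\<in>A. \<forall>p\<in>chart_dom \<kappa> \<inter> chart_dom \<kappa>'. \<forall>v w.
        g \<kappa>' p (trans_diff \<kappa> \<kappa>' p v) (trans_diff \<kappa> \<kappa>' p w) = g \<kappa> p v w) \<and>
     (\<forall>\<kappa>\<in>A. \<forall>v w. Ck_on k (\<lambda>y. g \<kappa> (chart_inv \<kappa> y) v w) (chart_map \<kappa> ` chart_dom \<kappa>))"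

section \<open>The Riemannian distance\<close>

text \<open>
  The derivative is one-sided at \<open>a\<close> and \<open>b\<close>, so that the velocity is continuous up to both ends
  of the closed interval (the library's \<open>piecewise_C1_differentiable_on\<close> would allow an unbounded,
  non-integrable speed near the break points).
\<close>

definition C1_curve ::
  "('a::topological_space, 'b::euclidean_space) chart set \<Rightarrow> (real \<Rightarrow> 'a) \<Rightarrow> real \<Rightarrow> real \<Rightarrow> bool" where
  "C1_curve A \<gamma> a b \<longleftrightarrow> continuous_on {a..b} \<gamma> \<and>
     (\<forall>\<kappa>\<in>A. \<exists>v. continuous_on {t\<in>{a..b}. \<gamma> t \<in> chart_dom \<kappa>} v \<and>
        (\<forall>t\<in>{a..b}. \<gamma> t \<in> chart_dom \<kappa> \<longrightarrow>
           ((\<lambda>s. chart_map \<kappa> (\<gamma> s)) has_vector_derivative v t) (at t within {a..b})))"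

definition piecewise_C1_curve ::
  "('a::topological_space, 'b::euclidean_space) chart set \<Rightarrow> (real \<Rightarrow> 'a) \<Rightarrow> bool" where
  "piecewise_C1_curve A \<gamma> \<longleftrightarrow>
     (\<exists>(n::nat) p. p 0 = 0 \<and> p n = 1 \<and> (\<forall>i<n. p i < p (Suc i) \<and> C1_curve A \<gamma> (p i) (p (Suc i))))"

text \<open>
  By the transformation laws the speed does not depend on the chosen chart. It is unspecified at
  the finitely many break points and end points, which do not affect the length.
\<close>

definition speed ::
  "('a, 'b::euclidean_space) chart set \<Rightarrow> (('a, 'b) chart \<Rightarrow> 'a \<Rightarrow> 'b \<Rightarrow> 'b \<Rightarrow> real) \<Rightarrow>
     (real \<Rightarrow> 'a) \<Rightarrow> real \<Rightarrow> real" where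
  "speed A g \<gamma> t =
     (let \<kappa> = (SOME \<kappa>. \<kappa> \<in> A \<and> \<gamma> t \<in> chart_dom \<kappa>);
          v = vector_derivative (\<lambda>s. chart_map \<kappa> (\<gamma> s)) (at t)
      in sqrt (g \<kappa> (\<gamma> t) v v))"

definition curve_length ::
  "('a, 'b::euclidean_space) chart set \<Rightarrow> (('a, 'b) chart \<Rightarrow> 'a \<Rightarrow> 'b \<Rightarrow> 'b \<Rightarrow> real) \<Rightarrow>
     (real \<Rightarrow> 'a) \<Rightarrow> real" where
  "curve_length A g \<gamma> = integral {0..1} (speed A g \<gamma>)"

text \<open>Points in different components of the manifold have distance \<open>\<infinity>\<close>.\<close>

definition riemannian_dist ::
  "('a::topological_space, 'b::euclidean_space) chart set \<Rightarrow>
     (('a, 'b) chart \<Rightarrow> 'a \<Rightarrow> 'b \<Rightarrow> 'b \<Rightarrow> real) \<Rightarrow> 'a \<Rightarrow> 'a \<Rightarrow> ennreal" where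
  "riemannian_dist A g x y =
     (INF \<gamma> \<in> {\<gamma>. piecewise_C1_curve A \<gamma> \<and> \<gamma> 0 = x \<and> \<gamma> 1 = y}. ennreal (curve_length A g \<gamma>))"

section \<open>Flows and time reparameterizations\<close>

definition is_flow :: "(real \<Rightarrow> 'a \<Rightarrow> 'a) \<Rightarrow> bool" where
  "is_flow \<phi> \<longleftrightarrow> (\<forall>x. \<phi> 0 x = x) \<and> (\<forall>s t x. \<phi> (s + t) x = \<phi> s (\<phi> t x))"

text \<open>Differentiability of a flow is joint in time and space, expressed in charts.\<close>

definition Ck_flow ::
  "nat \<Rightarrow> ('a::topological_space, 'b::euclidean_space) chart set \<Rightarrow> (real \<Rightarrow> 'a \<Rightarrow> 'a) \<Rightarrow> bool" where
  "Ck_flow k A \<phi> \<longleftrightarrow> is_flow \<phi> \<and> continuous_on UNIV (\<lambda>(t, x). \<phi> t x) \<and>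
     (\<forall>\<kappa>\<in>A. \<forall>\<kappa>'\<in>A. Ck_on k (\<lambda>(t, y). chart_map \<kappa>' (\<phi> t (chart_inv \<kappa> y)))
        {(t, y). y \<in> chart_map \<kappa> ` chart_dom \<kappa> \<and> \<phi> t (chart_inv \<kappa> y) \<in> chart_dom \<kappa>'})"

definition solves_ode ::
  "('a, 'b::euclidean_space) chart set \<Rightarrow> (('a, 'b) chart \<Rightarrow> 'a \<Rightarrow> 'b) \<Rightarrow> (real \<Rightarrow> 'a) \<Rightarrow> bool" where
  "solves_ode A f c \<longleftrightarrow>
     (\<forall>\<kappa>\<in>A. \<forall>t. c t \<in> chart_dom \<kappa> \<longrightarrow>
        ((\<lambda>s. chart_map \<kappa> (c s)) has_vector_derivative f \<kappa> (c t)) (at t))"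

definition generates_flow ::
  "('a, 'b::euclidean_space) chart set \<Rightarrow> (('a, 'b) chart \<Rightarrow> 'a \<Rightarrow> 'b) \<Rightarrow> (real \<Rightarrow> 'a \<Rightarrow> 'a) \<Rightarrow> bool"
  where
  "generates_flow A f \<phi> \<longleftrightarrow> is_flow \<phi> \<and> (\<forall>x. solves_ode A f (\<lambda>t. \<phi> t x))"

definition flow_invariant :: "(real \<Rightarrow> 'a \<Rightarrow> 'a) \<Rightarrow> 'a set \<Rightarrow> bool" where
  "flow_invariant \<phi> \<Lambda> \<longleftrightarrow> (\<forall>t. \<phi> t ` \<Lambda> = \<Lambda>)"

text \<open>The interval integral is oriented, as needed for negative \<open>t\<close>.\<close>

definition reparam_time :: "(real \<Rightarrow> 'a \<Rightarrow> 'a) \<Rightarrow> ('a \<Rightarrow> real) \<Rightarrow> 'a \<Rightarrow> real \<Rightarrow> real" where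
  "reparam_time \<phi> r x t = (LBINT s=0..t. r (\<phi> s x))"

text \<open>
  The function \<open>r\<close> is only given on the invariant set \<open>\<Lambda>\<close>, so the relation between the flows
  \<open>\<phi>\<close> and \<open>\<psi>\<close> is imposed on \<open>\<Lambda>\<close>. For \<open>r > 0\<close> the map \<open>reparam_time \<phi> r x\<close> is increasing, so
  the first condition contains the agreement of orientations.
\<close>

definition time_reparam_on ::
  "'a set \<Rightarrow> ('a, 'b::euclidean_space) chart set \<Rightarrow> (('a, 'b) chart \<Rightarrow> 'a \<Rightarrow> 'b) \<Rightarrow>
     (real \<Rightarrow> 'a \<Rightarrow> 'a) \<Rightarrow> (real \<Rightarrow> 'a \<Rightarrow> 'a) \<Rightarrow> ('a \<Rightarrow> real) \<Rightarrow> bool" where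
  "time_reparam_on \<Lambda> A f \<phi> \<psi> r \<longleftrightarrow>
     (\<forall>x\<in>\<Lambda>. (\<forall>t. \<psi> (reparam_time \<phi> r x t) x = \<phi> t x) \<and>
        range (\<lambda>\<tau>. \<psi> \<tau> x) = range (\<lambda>t. \<phi> t x) \<and>
        solves_ode A (\<lambda>\<kappa> p. f \<kappa> p /\<^sub>R r p) (\<lambda>\<tau>. \<psi> \<tau> x))"

section \<open>Topological pressure\<close>

definition separated ::
  "('a \<Rightarrow> 'a \<Rightarrow> ennreal) \<Rightarrow> 'a set \<Rightarrow> (real \<Rightarrow> 'a \<Rightarrow> 'a) \<Rightarrow> real \<Rightarrow> real \<Rightarrow> 'a set \<Rightarrow> bool" where
  "separated \<rho> \<Lambda> \<phi> t \<epsilon> E \<longleftrightarrow> E \<subseteq> \<Lambda> \<and>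
     (\<forall>x\<in>E. \<forall>y\<in>E. x \<noteq> y \<longrightarrow> (\<exists>s\<in>{0..t}. ennreal \<epsilon> < \<rho> (\<phi> s x) (\<phi> s y)))"

definition log_ennreal :: "ennreal \<Rightarrow> ereal" where
  "log_ennreal a = (if a = 0 then -\<infinity> else if a = \<infinity> then \<infinity> else ereal (ln (enn2real a)))"

definition partition_sum ::
  "('a \<Rightarrow> 'a \<Rightarrow> ennreal) \<Rightarrow> 'a set \<Rightarrow> (real \<Rightarrow> 'a \<Rightarrow> 'a) \<Rightarrow> ('a \<Rightarrow> real) \<Rightarrow> real \<Rightarrow> real \<Rightarrow> ennreal"
  where
  "partition_sum \<rho> \<Lambda> \<phi> \<xi> \<epsilon> t =
     (SUP E \<in> {E. separated \<rho> \<Lambda> \<phi> t \<epsilon> E}.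
        \<Sum>\<^sub>\<infinity>x\<in>E. ennreal (exp (LBINT s=0..t. \<xi> (\<phi> s x))))"

definition top_pressure ::
  "('a \<Rightarrow> 'a \<Rightarrow> ennreal) \<Rightarrow> 'a set \<Rightarrow> (real \<Rightarrow> 'a \<Rightarrow> 'a) \<Rightarrow> ('a \<Rightarrow> real) \<Rightarrow> ereal" where
  "top_pressure \<rho> \<Lambda> \<phi> \<xi> =
     Lim (at_right 0)
       (\<lambda>\<epsilon>::real. Limsup at_top
          (\<lambda>t::real. ereal (1 / t) * log_ennreal (partition_sum \<rho> \<Lambda> \<phi> \<xi> \<epsilon> t)))"

end

theory Submission
  imports Defs "HOL-Real_Asymp.Real_Asymp"
begin

text \<open>
  Write \<open>\<zeta> = \<xi> - c\<close>. An orbit segment of \<open>\<phi>\<close> of length \<open>t\<close> is an orbit segment of \<open>\<psi>\<close> of length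
  \<open>\<tau>(x, t)\<close>, and the integral of \<open>\<zeta> / r\<close> along the second equals the integral of \<open>\<zeta>\<close> along the first.
  So the two partition sums have the same weights; what differs is the time at which the orbits are
  cut off, and the notion of separation, since points are compared at equal \<open>\<psi>\<close>-times instead of equal
  \<open>\<phi>\<close>-times. The key is that these two differences do not affect the sign of the pressure:
  if \<open>\<zeta>\<close> has negative pressure for \<open>\<phi>\<close>, then \<open>\<zeta> / r\<close> has pressure at most \<open>0\<close> for \<open>\<psi>\<close>
  (\<open>pressure_time_change_nonpos\<close>). Negativity makes the statement insensitive to the cut-off: the
  possible values of \<open>t\<close> for a given \<open>\<tau>\<close> fill an interval of length \<open>O(\<tau>)\<close>, and for each of them the
  partition sum of \<open>\<phi>\<close> is bounded.

  The comparison of separation is the heart of the matter (\<open>separated_sum_bound\<close>). If the \<open>\<phi>\<close>-orbits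
  of \<open>y\<close> and \<open>y'\<close> stay close to that of \<open>z\<close> up to time \<open>n\<close>, their clocks \<open>\<tau>(y, \<cdot>)\<close> and \<open>\<tau>(y', \<cdot>)\<close> may
  still drift apart from \<open>\<tau>(z, \<cdot>)\<close>, at a slow linear rate. Record the drift, rounded to a small step
  \<open>h\<close>, at the times \<open>0, T, 2T, \<dots>\<close>. If the orbits are close enough, the rounded drift changes by
  \<open>-1\<close>, \<open>0\<close> or \<open>1\<close> in each period \<open>T\<close>, so at most \<open>3\<^sup>n\<^sup>/\<^sup>T\<close> records occur. Two points with the same record have
  nearly equal clocks throughout, hence are not separated for \<open>\<psi>\<close>. So one \<open>\<phi>\<close>-separated point
  accounts for at most \<open>3\<^sup>n\<^sup>/\<^sup>T\<close> points of a \<open>\<psi>\<close>-separated set, and the exponential rate \<open>ln 3 / T\<close> is as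
  small as desired.

  The flow \<open>\<phi>\<close> is in turn the time change of \<open>\<psi>\<close> with the function \<open>1 / r\<close> (\<open>time_change_inverse\<close>),
  so the implication also holds in the opposite direction. Let \<open>P\<close> be the pressure of \<open>\<xi>\<close>. The
  pressure of \<open>(\<xi> - c) / r\<close> for \<open>\<psi>\<close> is continuous in \<open>c\<close>; it is at most \<open>0\<close> for \<open>c > P\<close>, hence
  for \<open>c = P\<close>. If it were negative at \<open>P\<close>, it would be negative at some \<open>c < P\<close>, and the reverse
  implication would make the pressure of \<open>\<xi>\<close> at most \<open>c\<close> (\<open>pressure_time_change\<close>).

  Two facts about the manifold are needed. First, the Riemannian distance induces the topology:
  short coordinate segments are short curves (\<open>riemannian_dist_locally_small\<close>), and a curve
  from the inner half of a coordinate ball to its outside has at least a definite length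
  (\<open>riemannian_dist_separates_locally\<close>). Together
  with compactness this gives all uniform statements, without the triangle inequality. Second, \<open>P\<close> is
  finite, because a differentiable flow is Lipschitz in finitely many charts, so that the number of
  separated points grows at most exponentially, with a rate that does not depend on the scale
  (\<open>card_separated_exponential\<close>).
\<close>

section \<open>Compact sets on which a distance induces the topology\<close>

text \<open>
  The covering arguments for statements with a uniform parameter all reduce to this lemma. Since \<open>F\<close> is arbitrary, the parameter \<open>d\<close> can be
  a small radius, a large Lipschitz constant, or a point close to a given one.
\<close>

lemma compact_eventually_uniform:
  assumes "compact K"
    and "\<And>p. p \<in> K \<Longrightarrow> \<exists>V. open V \<and> p \<in> V \<and> (\<forall>\<^sub>F d in F. \<forall>x\<in>V \<inter> K. P x d)"
  shows "\<forall>\<^sub>F d in F. \<forall>x\<in>K. P x d"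
proof -
  have "\<forall>p\<in>K. \<exists>V. open V \<and> p \<in> V \<and> (\<forall>\<^sub>F d in F. \<forall>x\<in>V \<inter> K. P x d)" using assms(2) by blast
  from bchoice[OF this] obtain V where
    V: "\<And>p. p \<in> K \<Longrightarrow> open (V p) \<and> p \<in> V p \<and> (\<forall>\<^sub>F d in F. \<forall>x\<in>V p \<inter> K. P x d)" by blast
  obtain Q where Q: "Q \<subseteq> K" "finite Q" "K \<subseteq> (\<Union>p\<in>Q. V p)"
  proof (rule compactE_image[OF assms(1), of K V])
    show "open (V p)" if "p \<in> K" for p using V[OF that] by blast
    show "K \<subseteq> (\<Union>p\<in>K. V p)" using V by blast
  qed
  have "\<forall>\<^sub>F d in F. \<forall>p\<in>Q. \<forall>x\<in>V p \<inter> K. P x d"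
    using V Q by (intro eventually_ball_finite) auto
  then show ?thesis by eventually_elim (use Q(3) in blast)
qed

text \<open>
  Symmetric by definition, because the distance itself is not assumed to be symmetric. The spanning
  property of a maximal separated set yields one of the two inequalities, but not a chosen one.
\<close>

definition close :: "('a \<Rightarrow> 'a \<Rightarrow> ennreal) \<Rightarrow> real \<Rightarrow> 'a \<Rightarrow> 'a \<Rightarrow> bool" where
  "close \<rho> d x y \<longleftrightarrow> \<rho> x y \<le> ennreal d \<or> \<rho> y x \<le> ennreal d"

text \<open>
  The properties \<open>gauge_small\<close> and \<open>gauge_separates\<close> express that \<open>\<rho>\<close> induces the topology near \<open>\<Lambda>\<close>.
  They replace the axioms of a metric: the uniform structure of a compact Hausdorff space is determined
  by its topology, so covering arguments can take the place of the triangle inequality.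
\<close>

locale compact_gauge =
  fixes \<rho> :: "'a::t2_space \<Rightarrow> 'a \<Rightarrow> ennreal" and \<Lambda> :: "'a set"
  assumes compact: "compact \<Lambda>"
    and gauge_small: "p \<in> \<Lambda> \<Longrightarrow> e > 0 \<Longrightarrow>
      \<exists>U. open U \<and> p \<in> U \<and> (\<forall>x\<in>U. \<forall>y\<in>U. \<rho> x y \<le> ennreal e)"
    and gauge_separates: "p \<in> \<Lambda> \<Longrightarrow> open W \<Longrightarrow> p \<in> W \<Longrightarrow>
      \<exists>V d. open V \<and> p \<in> V \<and> d > 0 \<and> (\<forall>x\<in>V. \<forall>y. y \<notin> W \<longrightarrow> ennreal d < \<rho> x y)"
begin

lemma gauge_refl: "p \<in> \<Lambda> \<Longrightarrow> d > 0 \<Longrightarrow> \<rho> p p \<le> ennreal d"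
  using gauge_small by blast

text \<open>
  A point \<open>q\<close> outside \<open>W\<close> has a neighbourhood at positive distance to a neighbourhood of \<open>p\<close>, by
  the Hausdorff property and \<open>gauge_separates\<close> at \<open>q\<close>. Compactness of \<open>\<Lambda> - W\<close> makes this
  uniform in \<open>q\<close>.
\<close>

lemma gauge_separates_rev:
  assumes "p \<in> \<Lambda>" "open W" "p \<in> W"
  shows "\<exists>V d. open V \<and> p \<in> V \<and> d > 0 \<and> (\<forall>x\<in>V. \<forall>y\<in>\<Lambda>. y \<notin> W \<longrightarrow> ennreal d < \<rho> y x)"
proof -
  have "\<forall>\<^sub>F z in nhds p \<times>\<^sub>F at_right 0. \<forall>q\<in>\<Lambda> - W. ennreal (snd z) < \<rho> q (fst z)"
  proof (rule compact_eventually_uniform[OF compact_diff[OF compact assms(2)]])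
    fix q assume q: "q \<in> \<Lambda> - W"
    then obtain S T where ST: "open S" "open T" "p \<in> S" "q \<in> T" "S \<inter> T = {}"
      using hausdorff[of p q] assms(3) by blast
    obtain V d where V: "open V" "q \<in> V" "d > 0" "\<And>x y. x \<in> V \<Longrightarrow> y \<notin> T \<Longrightarrow> ennreal d < \<rho> x y"
      using gauge_separates[of q T] q ST by blast
    have "\<forall>\<^sub>F x in nhds p. x \<in> S" using ST eventually_nhds by blast
    moreover have "\<forall>\<^sub>F d' in at_right 0. d' < d" using V(3) by (simp add: eventually_at_right_field) blast
    ultimately have "\<forall>\<^sub>F z in nhds p \<times>\<^sub>F at_right 0. fst z \<in> S \<and> snd z < d"
      by (auto simp: eventually_prod_filter)
    then have "\<forall>\<^sub>F z in nhds p \<times>\<^sub>F at_right 0. \<forall>x\<in>V \<inter> (\<Lambda> - W). ennreal (snd z) < \<rho> x (fst z)"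
    proof eventually_elim
      case (elim z)
      then have "fst z \<notin> T" using ST(5) by blast
      then show ?case using V(4) elim by (meson IntD1 ennreal_leI less_imp_le order_le_less_trans)
    qed
    then show "\<exists>V. open V \<and> q \<in> V \<and>
        (\<forall>\<^sub>F z in nhds p \<times>\<^sub>F at_right 0. \<forall>x\<in>V \<inter> (\<Lambda> - W). ennreal (snd z) < \<rho> x (fst z))"
      using V by blast
  qed
  then obtain Pf Pg where "eventually Pf (nhds p)" "eventually Pg (at_right (0::real))"
    and P: "\<And>x y. Pf x \<Longrightarrow> Pg y \<Longrightarrow> \<forall>q\<in>\<Lambda> - W. ennreal y < \<rho> q x"
    by (auto simp: eventually_prod_filter)
  then obtain V b where "open V" "p \<in> V" "\<forall>x\<in>V. Pf x" "b > 0" "\<forall>d>0. d < b \<longrightarrow> Pg d"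
    by (auto simp: eventually_nhds eventually_at_right_field)
  then have "open V \<and> p \<in> V \<and> b / 2 > 0 \<and> (\<forall>x\<in>V. \<forall>y\<in>\<Lambda>. y \<notin> W \<longrightarrow> ennreal (b / 2) < \<rho> y x)"
    using P[of _ "b / 2"] by simp
  then show ?thesis by blast
qed

text \<open>
  This is what the triangle inequality is otherwise used for: all points close to \<open>x\<close> lie
  in one common member of the cover, so they are also close to each other.
\<close>

lemma lebesgue_number:
  assumes "\<And>U. U \<in> C \<Longrightarrow> open U" "\<Lambda> \<subseteq> \<Union>C"
  obtains d where "d > 0"
    "\<And>x. x \<in> \<Lambda> \<Longrightarrow> \<exists>U\<in>C. x \<in> U \<and> (\<forall>y\<in>\<Lambda>. close \<rho> d x y \<longrightarrow> y \<in> U)"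
proof -
  have "\<forall>\<^sub>F d in at_right 0. \<forall>x\<in>\<Lambda>. \<exists>U\<in>C. x \<in> U \<and> (\<forall>y\<in>\<Lambda>. close \<rho> d x y \<longrightarrow> y \<in> U)"
  proof (rule compact_eventually_uniform[OF compact])
    fix p assume p: "p \<in> \<Lambda>"
    then obtain U where U: "U \<in> C" "p \<in> U" using assms(2) by blast
    have oU: "open U" using assms(1)[OF U(1)] .
    obtain V1 d1 where 1: "open V1" "p \<in> V1" "d1 > 0"
      "\<And>x y. x \<in> V1 \<Longrightarrow> y \<notin> U \<Longrightarrow> ennreal d1 < \<rho> x y"
      using gauge_separates[OF p oU U(2)] by blast
    obtain V2 d2 where 2: "open V2" "p \<in> V2" "d2 > 0"
      "\<And>x y. x \<in> V2 \<Longrightarrow> y \<in> \<Lambda> \<Longrightarrow> y \<notin> U \<Longrightarrow> ennreal d2 < \<rho> y x"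
      using gauge_separates_rev[OF p oU U(2)] by blast
    have "\<forall>\<^sub>F d in at_right 0. d < min d1 d2"
      using 1(3) 2(3) by (intro eventually_at_rightI[of 0 "min d1 d2"]) auto
    then have "\<forall>\<^sub>F d in at_right 0. \<forall>x\<in>(V1 \<inter> V2 \<inter> U) \<inter> \<Lambda>.
        \<exists>U\<in>C. x \<in> U \<and> (\<forall>y\<in>\<Lambda>. close \<rho> d x y \<longrightarrow> y \<in> U)"
    proof eventually_elim
      case (elim d)
      have "y \<in> U" if "x \<in> V1" "x \<in> V2" "y \<in> \<Lambda>" "close \<rho> d x y" for x y
      proof (rule ccontr)
        assume "y \<notin> U"
        then have "ennreal d1 < \<rho> x y" "ennreal d2 < \<rho> y x" using 1 2 that by auto
        moreover have "ennreal d \<le> ennreal d1" "ennreal d \<le> ennreal d2"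
          using elim by (auto intro: ennreal_leI)
        ultimately show False using that(4) by (auto simp: close_def)
      qed
      then show ?case using U by blast
    qed
    then show "\<exists>V. open V \<and> p \<in> V \<and> (\<forall>\<^sub>F d in at_right 0. \<forall>x\<in>V \<inter> \<Lambda>.
        \<exists>U\<in>C. x \<in> U \<and> (\<forall>y\<in>\<Lambda>. close \<rho> d x y \<longrightarrow> y \<in> U))"
      using 1 2 U oU by (intro exI[of _ "V1 \<inter> V2 \<inter> U"]) auto
  qed
  then obtain b :: real where "b > 0" "\<forall>d>0. d < b \<longrightarrow>
      (\<forall>x\<in>\<Lambda>. \<exists>U\<in>C. x \<in> U \<and> (\<forall>y\<in>\<Lambda>. close \<rho> d x y \<longrightarrow> y \<in> U))"
    unfolding eventually_at_right_field by blast
  then show ?thesis using that[of "b / 2"] by simp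
qed

lemma uniformly_continuous_real:
  fixes h :: "'a \<Rightarrow> real"
  assumes "continuous_on \<Lambda> h" "e > 0"
  obtains d where "d > 0" "\<And>x y. x \<in> \<Lambda> \<Longrightarrow> y \<in> \<Lambda> \<Longrightarrow> close \<rho> d x y \<Longrightarrow> \<bar>h x - h y\<bar> \<le> e"
proof -
  let ?C = "{U. open U \<and> (\<forall>y\<in>U \<inter> \<Lambda>. \<forall>y'\<in>U \<inter> \<Lambda>. \<bar>h y - h y'\<bar> \<le> e)}"
  have "\<Lambda> \<subseteq> \<Union>?C"
  proof
    fix p assume p: "p \<in> \<Lambda>"
    obtain B where B: "open B" "p \<in> B" "\<And>y. y \<in> \<Lambda> \<Longrightarrow> y \<in> B \<Longrightarrow> h y \<in> ball (h p) (e / 2)"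
      using assms p unfolding continuous_on_topological
      by (metis centre_in_ball half_gt_zero open_ball)
    have "\<bar>h y - h y'\<bar> \<le> e" if "y \<in> B \<inter> \<Lambda>" "y' \<in> B \<inter> \<Lambda>" for y y'
      using B(3)[of y] B(3)[of y'] that unfolding mem_ball dist_real_def by (simp, linarith)
    then have "B \<in> ?C" using B(1) by simp
    then show "p \<in> \<Union>?C" using B(2) by blast
  qed
  from lebesgue_number[OF _ this] obtain d where d: "d > 0"
    "\<And>x. x \<in> \<Lambda> \<Longrightarrow> \<exists>U\<in>?C. x \<in> U \<and> (\<forall>y\<in>\<Lambda>. close \<rho> d x y \<longrightarrow> y \<in> U)"
    by blast
  show ?thesis
  proof (rule that[OF d(1)])
    fix x y assume xy: "x \<in> \<Lambda>" "y \<in> \<Lambda>" "close \<rho> d x y"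
    obtain U where "U \<in> ?C" "x \<in> U" "y \<in> U" using d(2)[OF xy(1)] xy(2,3) by blast
    then show "\<bar>h x - h y\<bar> \<le> e" using xy(1,2) by blast
  qed
qed

end

locale compact_flow = compact_gauge \<rho> \<Lambda>
  for \<rho> :: "'a::t2_space \<Rightarrow> 'a \<Rightarrow> ennreal" and \<Lambda> +
  fixes \<phi> :: "real \<Rightarrow> 'a \<Rightarrow> 'a"
  assumes flow: "is_flow \<phi>" and flow_continuous: "continuous_on UNIV (\<lambda>(t, x). \<phi> t x)"
    and invariant: "x \<in> \<Lambda> \<Longrightarrow> \<phi> t x \<in> \<Lambda>"
begin

lemma flow_0 [simp]: "\<phi> 0 x = x" and flow_add: "\<phi> (s + t) x = \<phi> s (\<phi> t x)"
  using flow by (auto simp: is_flow_def)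

lemma flow_nhd:
  assumes "open W" "\<phi> t p \<in> W"
  obtains J B where "open J" "t \<in> J" "open B" "p \<in> B" "\<And>s x. s \<in> J \<Longrightarrow> x \<in> B \<Longrightarrow> \<phi> s x \<in> W"
proof -
  have "open ((\<lambda>(t, x). \<phi> t x) -` W)" using flow_continuous assms(1) by (simp add: open_vimage)
  moreover have "(t, p) \<in> (\<lambda>(t, x). \<phi> t x) -` W" using assms(2) by simp
  ultimately obtain J B where JB: "open J" "open B" "(t, p) \<in> J \<times> B"
    "J \<times> B \<subseteq> (\<lambda>(t, x). \<phi> t x) -` W"
    by (rule open_prod_elim)
  show ?thesis by (rule that[of J B]) (use JB in auto)
qed

lemma continuous_on_orbit: "continuous_on S (\<lambda>t. \<phi> t x)"
proof -
  have "continuous_on S (\<lambda>t. (\<lambda>(t, x). \<phi> t x) (t, x))"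
    by (rule continuous_on_compose2[OF flow_continuous]) (auto intro!: continuous_intros)
  then show ?thesis by simp
qed

lemma continuous_on_along_orbit:
  assumes "continuous_on \<Lambda> h" "x \<in> \<Lambda>" shows "continuous_on S (\<lambda>t. h (\<phi> t x))"
  using continuous_on_compose2[OF assms(1) continuous_on_orbit] invariant[OF assms(2)] by blast

text \<open>
  Two points close to a third one remain close when one of them is moved by the flow for a short
  time \<open>w\<close> of either sign. This absorbs the difference between two clocks.
\<close>

lemma short_time_uniformly_small:
  assumes "e > 0"
  obtains d h where "d > 0" "h > 0" "\<And>x y y' w. x \<in> \<Lambda> \<Longrightarrow> y \<in> \<Lambda> \<Longrightarrow> y' \<in> \<Lambda> \<Longrightarrow>
    close \<rho> d x y \<Longrightarrow> close \<rho> d x y' \<Longrightarrow> \<bar>w\<bar> \<le> h \<Longrightarrow> \<rho> y (\<phi> w y') \<le> ennreal e"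
proof -
  let ?C = "\<lambda>h. {U. open U \<and> (\<forall>y\<in>U. \<forall>y'\<in>U. \<forall>w. \<bar>w\<bar> \<le> h \<longrightarrow> \<rho> y (\<phi> w y') \<le> ennreal e)}"
  have "\<forall>\<^sub>F h in at_right 0. \<forall>p\<in>\<Lambda>. p \<in> \<Union>(?C h)"
  proof (rule compact_eventually_uniform[OF compact])
    fix p assume p: "p \<in> \<Lambda>"
    obtain U where U: "open U" "p \<in> U" "\<And>x y. x \<in> U \<Longrightarrow> y \<in> U \<Longrightarrow> \<rho> x y \<le> ennreal e"
      using gauge_small[OF p assms] by blast
    obtain J B where JB: "open J" "0 \<in> J" "open B" "p \<in> B" "\<And>s x. s \<in> J \<Longrightarrow> x \<in> B \<Longrightarrow> \<phi> s x \<in> U"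
      using flow_nhd[of U 0 p] U by (metis flow_0)
    obtain h0 where h0: "h0 > 0" "ball 0 h0 \<subseteq> J" using JB open_contains_ball by blast
    have "U \<inter> B \<in> ?C h" if "h < h0" for h
    proof -
      have "\<rho> y (\<phi> w y') \<le> ennreal e" if "y \<in> U \<inter> B" "y' \<in> U \<inter> B" "\<bar>w\<bar> \<le> h" for y y' w
        using that \<open>h < h0\<close> h0(2) JB(5)[of w y'] U(3) by (auto simp: subset_iff)
      then show ?thesis using U JB by blast
    qed
    moreover have "\<forall>\<^sub>F h in at_right 0. h < h0"
      using h0 by (intro eventually_at_rightI[of 0 h0]) auto
    ultimately have "\<forall>\<^sub>F h in at_right 0. \<forall>x\<in>(U \<inter> B) \<inter> \<Lambda>. x \<in> \<Union>(?C h)"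
      by (rule_tac eventually_mono) blast+
    then show "\<exists>V. open V \<and> p \<in> V \<and> (\<forall>\<^sub>F h in at_right 0. \<forall>x\<in>V \<inter> \<Lambda>. x \<in> \<Union>(?C h))"
      using U JB by (intro exI[of _ "U \<inter> B"]) auto
  qed
  then obtain b :: real where b: "b > 0" "\<forall>h>0. h < b \<longrightarrow> (\<forall>p\<in>\<Lambda>. p \<in> \<Union>(?C h))"
    unfolding eventually_at_right_field by blast
  define h where "h = b / 2"
  have h: "h > 0" "h < b" using b(1) unfolding h_def by auto
  then have cover: "\<Lambda> \<subseteq> \<Union>(?C h)" using b(2) by blast
  obtain d where d: "d > 0"
    "\<And>x. x \<in> \<Lambda> \<Longrightarrow> \<exists>U\<in>?C h. x \<in> U \<and> (\<forall>y\<in>\<Lambda>. close \<rho> d x y \<longrightarrow> y \<in> U)"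
    using lebesgue_number[OF _ cover] by blast
  show ?thesis
  proof (rule that[OF d(1) h(1)])
    fix x y y' w assume *: "x \<in> \<Lambda>" "y \<in> \<Lambda>" "y' \<in> \<Lambda>" "close \<rho> d x y" "close \<rho> d x y'" "\<bar>w\<bar> \<le> h"
    obtain U where "U \<in> ?C h" "y \<in> U" "y' \<in> U" using d(2)[OF *(1)] * by blast
    then show "\<rho> y (\<phi> w y') \<le> ennreal e" using *(6) by blast
  qed
qed

lemma unit_time_locally_small:
  assumes "p \<in> \<Lambda>" "e > 0"
  obtains U where "open U" "p \<in> U"
    "\<And>x y s. x \<in> U \<Longrightarrow> y \<in> U \<Longrightarrow> s \<in> {0..1} \<Longrightarrow> \<rho> (\<phi> s x) (\<phi> s y) \<le> ennreal e"
proof -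
  have "\<forall>\<^sub>F z in nhds p \<times>\<^sub>F nhds p. \<forall>s\<in>{0..1}. \<rho> (\<phi> s (fst z)) (\<phi> s (snd z)) \<le> ennreal e"
  proof (rule compact_eventually_uniform)
    fix t :: real
    obtain W where W: "open W" "\<phi> t p \<in> W" "\<And>x y. x \<in> W \<Longrightarrow> y \<in> W \<Longrightarrow> \<rho> x y \<le> ennreal e"
      using gauge_small[OF invariant[OF assms(1), of t] assms(2)] by blast
    obtain J B where JB: "open J" "t \<in> J" "open B" "p \<in> B" "\<And>s x. s \<in> J \<Longrightarrow> x \<in> B \<Longrightarrow> \<phi> s x \<in> W"
      using flow_nhd[OF W(1,2)] by blast
    have "\<forall>\<^sub>F x in nhds p. x \<in> B" using JB(3,4) by (simp add: eventually_nhds_in_open)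
    then have "\<forall>\<^sub>F z in nhds p \<times>\<^sub>F nhds p. fst z \<in> B \<and> snd z \<in> B"
      unfolding eventually_prod_filter by (intro exI[of _ "\<lambda>x. x \<in> B"]) simp
    then have "\<forall>\<^sub>F z in nhds p \<times>\<^sub>F nhds p.
        \<forall>s\<in>J \<inter> {0..1}. \<rho> (\<phi> s (fst z)) (\<phi> s (snd z)) \<le> ennreal e"
    proof eventually_elim
      case (elim z)
      have "\<phi> s (fst z) \<in> W" "\<phi> s (snd z) \<in> W" if "s \<in> J" for s
        using JB(5)[OF that] elim by blast+
      then show ?case using W(3) by blast
    qed
    then show "\<exists>V. open V \<and> t \<in> V \<and> (\<forall>\<^sub>F z in nhds p \<times>\<^sub>F nhds p.
        \<forall>s\<in>V \<inter> {0..1}. \<rho> (\<phi> s (fst z)) (\<phi> s (snd z)) \<le> ennreal e)"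
      using JB by blast
  qed simp
  then obtain P Q where PQ: "eventually P (nhds p)" "eventually Q (nhds p)"
    "\<And>x y. P x \<Longrightarrow> Q y \<Longrightarrow> \<forall>s\<in>{0..1}. \<rho> (\<phi> s x) (\<phi> s y) \<le> ennreal e"
    unfolding eventually_prod_filter by auto
  have "\<forall>\<^sub>F x in nhds p. P x \<and> Q x" using PQ(1,2) by (rule eventually_conj)
  then obtain U where U: "open U" "p \<in> U" "\<forall>x\<in>U. P x \<and> Q x" unfolding eventually_nhds by blast
  show ?thesis by (rule that[OF U(1,2)]) (use PQ(3) U(3) in blast)
qed

end

section \<open>Topological pressure as an exponential growth rate\<close>

lemma log_ennreal_le_iff: "log_ennreal a \<le> ereal c \<longleftrightarrow> a \<le> ennreal (exp c)"
proof (cases a)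
  case (real r)
  show ?thesis
  proof (cases "r = 0")
    case True
    then show ?thesis using real by (simp add: log_ennreal_def)
  next
    case False
    then have "r > 0" using real by simp
    then show ?thesis using real False ln_le_cancel_iff[of r "exp c"] by (simp add: log_ennreal_def)
  qed
next
  case top
  then show ?thesis using ennreal_less_top[of "exp c"] by (simp add: log_ennreal_def not_le)
qed

lemma scaled_log_le_iff:
  assumes "t > 0"
  shows "ereal (1 / t) * log_ennreal a \<le> ereal b \<longleftrightarrow> a \<le> ennreal (exp (b * t))"
proof -
  have "ereal (1 / t) * log_ennreal a \<le> ereal b \<longleftrightarrow> log_ennreal a \<le> ereal (b * t)"
    using assms by (cases "log_ennreal a") (auto simp: field_simps)
  then show ?thesis by (simp add: log_ennreal_le_iff)
qed

text \<open>
  The limit in the definition of the pressure exists because partition sums increase as the scale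
  decreases.
\<close>

lemma tendsto_at_right_SUP_of_antimono:
  fixes R :: "real \<Rightarrow> ereal"
  assumes "\<And>x y. 0 < x \<Longrightarrow> x \<le> y \<Longrightarrow> R y \<le> R x"
  shows "(R \<longlongrightarrow> (SUP x\<in>{0<..}. R x)) (at_right 0)"
proof (rule order_tendstoI)
  fix a assume "a < (SUP x\<in>{0<..}. R x)"
  then obtain y where y: "y > 0" "a < R y" by (auto simp: less_SUP_iff)
  have "\<forall>\<^sub>F x in at_right 0. x < y" "\<forall>\<^sub>F x::real in at_right 0. x > 0"
    using y(1) by (auto intro: eventually_at_rightI[of 0 y])
  then show "\<forall>\<^sub>F x in at_right 0. a < R x"
    by eventually_elim (use assms y(2) in \<open>force intro: order_less_le_trans\<close>)
next
  fix a assume a: "(SUP x\<in>{0<..}. R x) < a"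
  have "\<forall>\<^sub>F x::real in at_right 0. x > 0" by (auto intro: eventually_at_rightI[of 0 1])
  then show "\<forall>\<^sub>F x in at_right 0. R x < a"
    by eventually_elim (use a in \<open>auto intro: le_less_trans[OF SUP_upper]\<close>)
qed

lemma separated_subset: "separated \<rho> \<Lambda> \<phi> t \<epsilon> E \<Longrightarrow> F \<subseteq> E \<Longrightarrow> separated \<rho> \<Lambda> \<phi> t \<epsilon> F"
  unfolding separated_def by (meson subset_iff order_trans)

lemma separated_antimono:
  assumes "separated \<rho> \<Lambda> \<phi> t \<epsilon> E" "\<epsilon>' \<le> \<epsilon>" "t \<le> t'" shows "separated \<rho> \<Lambda> \<phi> t' \<epsilon>' E"
proof -
  have "ennreal \<epsilon>' \<le> ennreal \<epsilon>" using assms(2) by (rule ennreal_leI)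
  then show ?thesis using assms(1,3) unfolding separated_def
    by (meson atLeastAtMost_iff order_le_less_trans order_trans)
qed

lemma partition_sum_antimono:
  assumes "\<epsilon>' \<le> \<epsilon>"
  shows "partition_sum \<rho> \<Lambda> \<phi> \<xi> \<epsilon> t \<le> partition_sum \<rho> \<Lambda> \<phi> \<xi> \<epsilon>' t"
proof -
  have "{E. separated \<rho> \<Lambda> \<phi> t \<epsilon> E} \<subseteq> {E. separated \<rho> \<Lambda> \<phi> t \<epsilon>' E}"
    using separated_antimono[OF _ assms order_refl] by blast
  then show ?thesis unfolding partition_sum_def by (rule SUP_subset_mono) simp
qed

lemma top_pressure_eq_SUP:
  "top_pressure \<rho> \<Lambda> \<phi> \<xi> = (SUP \<epsilon>\<in>{0<..}. Limsup at_top
     (\<lambda>t::real. ereal (1 / t) * log_ennreal (partition_sum \<rho> \<Lambda> \<phi> \<xi> \<epsilon> t)))"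
  unfolding top_pressure_def
proof (intro tendsto_Lim tendsto_at_right_SUP_of_antimono)
  fix x y :: real assume xy: "0 < x" "x \<le> y"
  have mono: "log_ennreal a \<le> log_ennreal b" if "a \<le> b" for a b
  proof (rule ereal_le_real)
    fix z assume "log_ennreal b \<le> ereal z"
    then show "log_ennreal a \<le> ereal z" using that by (auto simp: log_ennreal_le_iff)
  qed
  have "\<forall>\<^sub>F t::real in at_top. t > 0" by (rule eventually_gt_at_top)
  then have "\<forall>\<^sub>F t::real in at_top. ereal (1 / t) * log_ennreal (partition_sum \<rho> \<Lambda> \<phi> \<xi> y t)
      \<le> ereal (1 / t) * log_ennreal (partition_sum \<rho> \<Lambda> \<phi> \<xi> x t)"
    by eventually_elim (intro ereal_mult_left_mono mono partition_sum_antimono xy(2), simp)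
  then show "Limsup at_top (\<lambda>t::real. ereal (1 / t) * log_ennreal (partition_sum \<rho> \<Lambda> \<phi> \<xi> y t))
      \<le> Limsup at_top (\<lambda>t::real. ereal (1 / t) * log_ennreal (partition_sum \<rho> \<Lambda> \<phi> \<xi> x t))"
    by (rule Limsup_mono)
qed simp

text \<open>
  All later estimates of the pressure rest on this characterization, which removes the iterated
  limit and the logarithm.
\<close>

lemma top_pressure_le_iff:
  "top_pressure \<rho> \<Lambda> \<phi> \<xi> \<le> ereal b \<longleftrightarrow>
     (\<forall>\<epsilon>>0. \<forall>b'>b. \<forall>\<^sub>F t in at_top. partition_sum \<rho> \<Lambda> \<phi> \<xi> \<epsilon> t \<le> ennreal (exp (b' * t)))"
proof -
  let ?R = "\<lambda>\<epsilon>. Limsup at_top (\<lambda>t::real. ereal (1 / t) * log_ennreal (partition_sum \<rho> \<Lambda> \<phi> \<xi> \<epsilon> t))"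
  have pos: "\<forall>\<^sub>F t::real in at_top. t > 0" by (rule eventually_gt_at_top)
  have "?R \<epsilon> \<le> ereal b \<longleftrightarrow>
      (\<forall>b'>b. \<forall>\<^sub>F t in at_top. partition_sum \<rho> \<Lambda> \<phi> \<xi> \<epsilon> t \<le> ennreal (exp (b' * t)))" for \<epsilon>
  proof (intro iffI allI impI)
    fix b' assume "?R \<epsilon> \<le> ereal b" "b' > b"
    then have "?R \<epsilon> < ereal b'" by (meson less_ereal.simps(1) order_le_less_trans)
    from Limsup_lessD[OF this] pos
    show "\<forall>\<^sub>F t in at_top. partition_sum \<rho> \<Lambda> \<phi> \<xi> \<epsilon> t \<le> ennreal (exp (b' * t))"
      by eventually_elim (use scaled_log_le_iff less_imp_le in blast)
  next
    assume *: "\<forall>b'>b. \<forall>\<^sub>F t in at_top. partition_sum \<rho> \<Lambda> \<phi> \<xi> \<epsilon> t \<le> ennreal (exp (b' * t))"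
    show "?R \<epsilon> \<le> ereal b"
    proof (rule ereal_le_epsilon2)
      fix e :: real assume "e > 0"
      then have "\<forall>\<^sub>F t in at_top. partition_sum \<rho> \<Lambda> \<phi> \<xi> \<epsilon> t \<le> ennreal (exp ((b + e) * t))"
        using * by simp
      then have "\<forall>\<^sub>F t in at_top.
          ereal (1 / t) * log_ennreal (partition_sum \<rho> \<Lambda> \<phi> \<xi> \<epsilon> t) \<le> ereal (b + e)"
        using pos by eventually_elim (use scaled_log_le_iff in blast)
      then show "?R \<epsilon> \<le> ereal b + ereal e" by (simp add: Limsup_bounded)
    qed
  qed
  then show ?thesis unfolding top_pressure_eq_SUP SUP_le_iff by auto
qed

lemma sum_le_partition_sum:
  assumes "separated \<rho> \<Lambda> \<phi> t \<epsilon> E" "finite E"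
  shows "ennreal (\<Sum>x\<in>E. exp (LBINT s=0..t. \<xi> (\<phi> s x))) \<le> partition_sum \<rho> \<Lambda> \<phi> \<xi> \<epsilon> t"
proof -
  have "ennreal (\<Sum>x\<in>E. exp (LBINT s=0..t. \<xi> (\<phi> s x))) =
      (\<Sum>\<^sub>\<infinity>x\<in>E. ennreal (exp (LBINT s=0..t. \<xi> (\<phi> s x))))"
    using assms(2) by (simp add: sum_ennreal)
  then show ?thesis unfolding partition_sum_def using assms(1) by (simp add: SUP_upper)
qed

text \<open>
  The sums over infinite separated sets are suprema of finite ones, and subsets of separated sets
  are separated; so only finite sets have to be estimated.
\<close>

lemma partition_sum_leI:
  assumes "\<And>E. separated \<rho> \<Lambda> \<phi> t \<epsilon> E \<Longrightarrow> finite E \<Longrightarrow>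
    (\<Sum>x\<in>E. exp (LBINT s=0..t. \<xi> (\<phi> s x))) \<le> B"
  shows "partition_sum \<rho> \<Lambda> \<phi> \<xi> \<epsilon> t \<le> ennreal B"
  unfolding partition_sum_def
proof (rule SUP_least)
  fix E assume E: "E \<in> {E. separated \<rho> \<Lambda> \<phi> t \<epsilon> E}"
  show "(\<Sum>\<^sub>\<infinity>x\<in>E. ennreal (exp (LBINT s=0..t. \<xi> (\<phi> s x)))) \<le> ennreal B"
    unfolding nonneg_infsum_complete[OF zero_le]
  proof (rule SUP_least)
    fix F assume "F \<in> {F. finite F \<and> F \<subseteq> E}"
    then have "separated \<rho> \<Lambda> \<phi> t \<epsilon> F" "finite F" using E separated_subset by auto
    from assms[OF this]
    show "(\<Sum>x\<in>F. ennreal (exp (LBINT s=0..t. \<xi> (\<phi> s x)))) \<le> ennreal B"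
      by (auto simp: sum_ennreal intro: ennreal_leI)
  qed
qed

context compact_flow
begin

definition orbit_integral :: "('a \<Rightarrow> real) \<Rightarrow> real \<Rightarrow> 'a \<Rightarrow> real" where
  "orbit_integral h t x = integral {0..t} (\<lambda>s. h (\<phi> s x))"

lemma along_orbit_integrable:
  fixes h :: "'a \<Rightarrow> real"
  assumes "continuous_on \<Lambda> h" "x \<in> \<Lambda>" shows "(\<lambda>s. h (\<phi> s x)) integrable_on {a..b}"
proof -
  have "continuous_on {a..b} (\<lambda>s. h (\<phi> s x))" using continuous_on_along_orbit[OF assms] .
  then show ?thesis by (rule integrable_continuous_real)
qed

lemma interval_integral_eq_orbit_integral:
  assumes "continuous_on \<Lambda> h" "x \<in> \<Lambda>" "0 \<le> t"
  shows "(LBINT s=0..t. h (\<phi> s x)) = orbit_integral h t x"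
proof -
  have "continuous_on {0..t} (\<lambda>s. h (\<phi> s x))" using continuous_on_along_orbit[OF assms(1,2)] .
  then have "set_integrable lborel {0..t} (\<lambda>s. h (\<phi> s x))"
    by (rule borel_integrable_atLeastAtMost')
  from interval_integral_eq_integral[OF assms(3) this]
  show ?thesis by (simp add: orbit_integral_def zero_ereal_def)
qed

lemma orbit_integral_bound:
  assumes "continuous_on \<Lambda> h" "x \<in> \<Lambda>" "0 \<le> t" "\<And>y. y \<in> \<Lambda> \<Longrightarrow> \<bar>h y\<bar> \<le> M"
  shows "\<bar>orbit_integral h t x\<bar> \<le> M * t"
proof -
  have "continuous_on {0..t} (\<lambda>s. h (\<phi> s x))" using continuous_on_along_orbit[OF assms(1,2)] .
  moreover have "norm (h (\<phi> s x)) \<le> M" for s using assms(4)[OF invariant[OF assms(2)]] by simp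
  ultimately have "norm (integral {0..t} (\<lambda>s. h (\<phi> s x))) \<le> M * (t - 0)"
    by (intro integral_bound[OF assms(3)]) auto
  then show ?thesis by (simp add: orbit_integral_def)
qed

lemma obtain_bound:
  fixes h :: "'a \<Rightarrow> real"
  assumes "continuous_on \<Lambda> h" obtains M where "M > 0" "\<And>x. x \<in> \<Lambda> \<Longrightarrow> \<bar>h x\<bar> \<le> M"
proof -
  have "bounded (h ` \<Lambda>)" using compact_continuous_image[OF assms compact] compact_imp_bounded by blast
  then obtain M where "M > 0" "\<forall>y\<in>h ` \<Lambda>. norm y \<le> M" unfolding bounded_pos by blast
  then show ?thesis by (intro that[of M]) auto
qed

lemma top_pressure_perturb:
  assumes "continuous_on \<Lambda> h" "continuous_on \<Lambda> h'" "\<And>x. x \<in> \<Lambda> \<Longrightarrow> h' x \<le> h x + c"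
    and "top_pressure \<rho> \<Lambda> \<phi> h \<le> ereal b"
  shows "top_pressure \<rho> \<Lambda> \<phi> h' \<le> ereal (b + c)"
  unfolding top_pressure_le_iff
proof (intro allI impI)
  fix \<epsilon> b' :: real assume "\<epsilon> > 0" "b' > b + c"
  then have "\<forall>\<^sub>F t in at_top. partition_sum \<rho> \<Lambda> \<phi> h \<epsilon> t \<le> ennreal (exp ((b' - c) * t))"
    using assms(4)[unfolded top_pressure_le_iff] by (simp add: less_diff_eq)
  then show "\<forall>\<^sub>F t in at_top. partition_sum \<rho> \<Lambda> \<phi> h' \<epsilon> t \<le> ennreal (exp (b' * t))"
    using eventually_ge_at_top[of 0]
  proof eventually_elim
    case (elim t)
    show ?case
    proof (rule partition_sum_leI)
      fix E assume E: "separated \<rho> \<Lambda> \<phi> t \<epsilon> E" "finite E"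
      have int: "(LBINT s=0..t. h' (\<phi> s x)) \<le> (LBINT s=0..t. h (\<phi> s x)) + c * t" if "x \<in> E" for x
      proof -
        have x: "x \<in> \<Lambda>" using E(1) that by (auto simp: separated_def)
        have int: "(\<lambda>s. h (\<phi> s x)) integrable_on {0..t}" "(\<lambda>s. h' (\<phi> s x)) integrable_on {0..t}"
          by (rule along_orbit_integrable[OF assms(1) x], rule along_orbit_integrable[OF assms(2) x])
        have "orbit_integral h' t x \<le> integral {0..t} (\<lambda>s. h (\<phi> s x) + c)"
          unfolding orbit_integral_def
          by (rule integral_le[OF int(2) integrable_add[OF int(1) integrable_const_ivl]])
             (rule assms(3)[OF invariant[OF x]])
        also have "\<dots> = orbit_integral h t x + c * t"
          unfolding orbit_integral_def integral_add[OF int(1) integrable_const_ivl]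
          using elim(2) by simp
        finally show ?thesis using x elim(2) assms(1,2) by (simp add: interval_integral_eq_orbit_integral)
      qed
      have "(\<Sum>x\<in>E. exp (LBINT s=0..t. h' (\<phi> s x))) \<le> (\<Sum>x\<in>E. exp (LBINT s=0..t. h (\<phi> s x)) * exp (c * t))"
        using int by (intro sum_mono) (simp flip: exp_add)
      also have "\<dots> = (\<Sum>x\<in>E. exp (LBINT s=0..t. h (\<phi> s x))) * exp (c * t)"
        by (simp add: sum_distrib_right)
      also have "(\<Sum>x\<in>E. exp (LBINT s=0..t. h (\<phi> s x))) \<le> exp ((b' - c) * t)"
        using order_trans[OF sum_le_partition_sum[OF E] elim(1)] by simp
      finally show "(\<Sum>x\<in>E. exp (LBINT s=0..t. h' (\<phi> s x))) \<le> exp (b' * t)"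
        by (simp add: algebra_simps flip: exp_add)
    qed
  qed
qed

text \<open>
  A single point is a separated set, and its weight decays at most like \<open>exp (- M t)\<close>.
\<close>

lemma top_pressure_lower_bound:
  assumes "continuous_on \<Lambda> h" "\<Lambda> \<noteq> {}" "\<And>x. x \<in> \<Lambda> \<Longrightarrow> \<bar>h x\<bar> \<le> M" "b < - M"
  shows "\<not> top_pressure \<rho> \<Lambda> \<phi> h \<le> ereal b"
proof
  define c where "c = (b - M) / 2"
  have c: "b < c" "c < - M" using assms(4) by (auto simp: c_def)
  assume "top_pressure \<rho> \<Lambda> \<phi> h \<le> ereal b"
  then have "\<forall>\<^sub>F t in at_top. partition_sum \<rho> \<Lambda> \<phi> h 1 t \<le> ennreal (exp (c * t))"
    unfolding top_pressure_le_iff using c by simp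
  from eventually_happens'[OF _ eventually_conj[OF eventually_gt_at_top[of 0] this]]
  obtain t where t: "t > 0" "partition_sum \<rho> \<Lambda> \<phi> h 1 t \<le> ennreal (exp (c * t))"
    by auto
  obtain x where x: "x \<in> \<Lambda>" using assms(2) by blast
  have "separated \<rho> \<Lambda> \<phi> t 1 {x}" using x by (auto simp: separated_def)
  from order_trans[OF sum_le_partition_sum[OF this] t(2)]
  have "orbit_integral h t x \<le> c * t"
    using x t(1) assms(1) by (simp add: interval_integral_eq_orbit_integral)
  moreover have "- M * t \<le> orbit_integral h t x"
    using orbit_integral_bound[OF assms(1) x _ assms(3), of t] t(1) by (auto simp: abs_le_iff)
  ultimately have "- M * t \<le> c * t" by linarith
  then show False using t(1) c(2) mult_strict_right_mono[OF c(2) t(1)] by simp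
qed

end

section \<open>Orbit integrals, spanning sets and drift of clocks\<close>

context compact_flow
begin

lemma orbit_integral_0 [simp]: "orbit_integral h 0 x = 0"
  by (simp add: orbit_integral_def)

lemma orbit_integral_split:
  assumes "continuous_on \<Lambda> h" "x \<in> \<Lambda>" "0 \<le> s" "s \<le> t"
  shows "orbit_integral h t x = orbit_integral h s x + integral {s..t} (\<lambda>u. h (\<phi> u x))"
  using Henstock_Kurzweil_Integration.integral_combine[OF assms(3,4) along_orbit_integrable[OF assms(1,2)]]
  by (simp add: orbit_integral_def)

lemma orbit_integral_increment_ge:
  assumes "continuous_on \<Lambda> h" "x \<in> \<Lambda>" "0 \<le> s" "s \<le> t" "\<And>y. y \<in> \<Lambda> \<Longrightarrow> a \<le> h y"
  shows "a * (t - s) \<le> orbit_integral h t x - orbit_integral h s x"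
proof -
  have "integral {s..t} (\<lambda>u. a) \<le> integral {s..t} (\<lambda>u. h (\<phi> u x))"
    by (rule integral_le[OF integrable_const_ivl along_orbit_integrable[OF assms(1,2)]])
       (rule assms(5)[OF invariant[OF assms(2)]])
  then show ?thesis using orbit_integral_split[OF assms(1-4)] assms(4) by (simp add: mult.commute)
qed

lemma orbit_integral_increment_le:
  assumes "continuous_on \<Lambda> h" "x \<in> \<Lambda>" "0 \<le> s" "s \<le> t" "\<And>y. y \<in> \<Lambda> \<Longrightarrow> h y \<le> b"
  shows "orbit_integral h t x - orbit_integral h s x \<le> b * (t - s)"
proof -
  have "integral {s..t} (\<lambda>u. h (\<phi> u x)) \<le> integral {s..t} (\<lambda>u. b)"
    by (rule integral_le[OF along_orbit_integrable[OF assms(1,2)] integrable_const_ivl])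
       (rule assms(5)[OF invariant[OF assms(2)]])
  then show ?thesis using orbit_integral_split[OF assms(1-4)] assms(4) by (simp add: mult.commute)
qed

lemma orbit_integral_increments_close:
  assumes "continuous_on \<Lambda> h" "x \<in> \<Lambda>" "y \<in> \<Lambda>" "0 \<le> s" "s \<le> t"
    and "\<And>u. u \<in> {s..t} \<Longrightarrow> \<bar>h (\<phi> u x) - h (\<phi> u y)\<bar> \<le> \<delta>"
  shows "\<bar>(orbit_integral h t x - orbit_integral h s x) -
          (orbit_integral h t y - orbit_integral h s y)\<bar> \<le> \<delta> * (t - s)"
proof -
  let ?d = "\<lambda>u. h (\<phi> u x) - h (\<phi> u y)"
  have int: "(\<lambda>u. h (\<phi> u x)) integrable_on {s..t}" "(\<lambda>u. h (\<phi> u y)) integrable_on {s..t}"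
    using along_orbit_integrable[OF assms(1,2)] along_orbit_integrable[OF assms(1,3)] by auto
  have "norm (integral {s..t} ?d) \<le> integral {s..t} (\<lambda>u. \<delta>)"
    by (rule integral_norm_bound_integral[OF integrable_diff[OF int] integrable_const_ivl])
       (use assms(6) in simp)
  moreover have "integral {s..t} ?d = (orbit_integral h t x - orbit_integral h s x) -
          (orbit_integral h t y - orbit_integral h s y)"
    unfolding integral_diff[OF int]
    using orbit_integral_split[OF assms(1,2,4,5)] orbit_integral_split[OF assms(1,3,4,5)] by simp
  ultimately show ?thesis using assms(5) by (simp add: mult.commute)
qed

text \<open>
  The set is a separated set of maximal cardinality. Such a set exists because a
  finite partition sum bounds the cardinality, every weight being at least \<open>exp (- M t)\<close>.
\<close>

lemma exists_spanning_set:
  assumes "continuous_on \<Lambda> h" "0 \<le> t" "\<epsilon> > 0"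
    and "partition_sum \<rho> \<Lambda> \<phi> h \<epsilon> t \<le> ennreal B" "0 \<le> B"
  shows "\<exists>F. finite F \<and> F \<subseteq> \<Lambda> \<and> (\<Sum>z\<in>F. exp (orbit_integral h t z)) \<le> B \<and>
    (\<forall>y\<in>\<Lambda>. \<exists>z\<in>F. \<forall>s\<in>{0..t}. close \<rho> \<epsilon> (\<phi> s z) (\<phi> s y))"
proof -
  obtain M where M: "M > 0" "\<And>x. x \<in> \<Lambda> \<Longrightarrow> \<bar>h x\<bar> \<le> M" using obtain_bound[OF assms(1)] by blast
  let ?sep = "\<lambda>F. finite F \<and> separated \<rho> \<Lambda> \<phi> t \<epsilon> F"
  have sub: "F \<subseteq> \<Lambda>" if "?sep F" for F using that by (simp add: separated_def)
  have sum: "(\<Sum>z\<in>F. exp (orbit_integral h t z)) \<le> max 0 B" if "?sep F" for F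
  proof -
    have "ennreal (\<Sum>z\<in>F. exp (LBINT s=0..t. h (\<phi> s z))) \<le> ennreal (max 0 B)"
      using order_trans[OF sum_le_partition_sum assms(4)] that by (simp add: ennreal_max_0)
    then have "(\<Sum>z\<in>F. exp (LBINT s=0..t. h (\<phi> s z))) \<le> max 0 B" by (simp add: ennreal_le_iff)
    moreover have "(\<Sum>z\<in>F. exp (LBINT s=0..t. h (\<phi> s z))) = (\<Sum>z\<in>F. exp (orbit_integral h t z))"
      using sub[OF that] assms(1,2)
      by (intro sum.cong) (auto simp: interval_integral_eq_orbit_integral)
    ultimately show ?thesis by simp
  qed
  have card: "card F \<le> nat \<lceil>max 0 B * exp (M * t)\<rceil>" if "?sep F" for F
  proof -
    have "exp (- (M * t)) \<le> exp (orbit_integral h t z)" if "z \<in> F" for z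
      using orbit_integral_bound[OF assms(1) _ assms(2) M(2), of z] sub[OF \<open>?sep F\<close>] that by auto
    then have "card F * exp (- (M * t)) \<le> (\<Sum>z\<in>F. exp (orbit_integral h t z))"
      by (rule sum_bounded_below)
    then have "card F * exp (- (M * t)) \<le> max 0 B" using sum[OF that] by linarith
    then have "real (card F) \<le> max 0 B * exp (M * t)" by (simp add: exp_minus field_simps)
    then show ?thesis by linarith
  qed
  have "?sep {}" by (simp add: separated_def)
  moreover have "\<forall>G. ?sep G \<longrightarrow> card G < Suc (nat \<lceil>max 0 B * exp (M * t)\<rceil>)" using card by (simp add: less_Suc_eq_le)
  ultimately have "\<exists>F. ?sep F \<and> (\<forall>G. ?sep G \<longrightarrow> card G \<le> card F)"
    by (rule Lattices_Big.ex_has_greatest_nat)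
  then obtain F where F: "?sep F" "\<And>G. ?sep G \<Longrightarrow> card G \<le> card F" by blast
  have span: "\<exists>z\<in>F. \<forall>s\<in>{0..t}. close \<rho> \<epsilon> (\<phi> s z) (\<phi> s y)" if y: "y \<in> \<Lambda>" for y
  proof (cases "y \<in> F")
    case True
    have "close \<rho> \<epsilon> (\<phi> s y) (\<phi> s y)" for s
      unfolding close_def using gauge_refl[OF invariant[OF y] assms(3)] by blast
    then show ?thesis using True by blast
  next
    case False
    then have "card (insert y F) > card F" using F(1) by simp
    then have "\<not> separated \<rho> \<Lambda> \<phi> t \<epsilon> (insert y F)" using F(2)[of "insert y F"] F(1) by fastforce
    then obtain x1 x2 where x: "x1 \<in> insert y F" "x2 \<in> insert y F" "x1 \<noteq> x2"
      "\<forall>s\<in>{0..t}. \<rho> (\<phi> s x1) (\<phi> s x2) \<le> ennreal \<epsilon>"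
      using y sub[OF F(1)] unfolding separated_def not_less[symmetric] by blast
    have "x1 = y \<or> x2 = y"
    proof (rule ccontr)
      assume "\<not> (x1 = y \<or> x2 = y)"
      then obtain s where "s \<in> {0..t}" "ennreal \<epsilon> < \<rho> (\<phi> s x1) (\<phi> s x2)"
        using F(1) x(1-3) unfolding separated_def by blast
      then show False using x(4) by (simp add: not_less[symmetric])
    qed
    then show ?thesis
    proof
      assume "x1 = y"
      then show ?thesis using x by (intro bexI[of _ x2]) (simp_all add: close_def)
    next
      assume "x2 = y"
      then show ?thesis using x by (intro bexI[of _ x1]) (simp_all add: close_def)
    qed
  qed
  have "(\<Sum>z\<in>F. exp (orbit_integral h t z)) \<le> B"
    using sum[OF F(1)] assms(5) by simp
  then show ?thesis using sub[OF F(1)] span F(1) by blast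
qed

end

text \<open>
  Rounding the drift \<open>d\<close> to multiples of \<open>h\<close> before taking differences keeps the rounding errors from
  accumulating: together with \<open>d 0\<close> the code determines the rounded drift at every index.
\<close>

definition drift_code :: "real \<Rightarrow> (nat \<Rightarrow> real) \<Rightarrow> nat \<Rightarrow> int list" where
  "drift_code h d N = map (\<lambda>j. \<lfloor>d (Suc j) / h\<rfloor> - \<lfloor>d j / h\<rfloor>) [0..<N]"

lemma drift_code_eqD:
  assumes "drift_code h d N = drift_code h d' N" "d 0 = d' 0" "h > 0" "j \<le> N"
  shows "\<bar>d j - d' j\<bar> < h"
proof -
  have "\<lfloor>d j / h\<rfloor> = \<lfloor>d' j / h\<rfloor>"
    using assms(4)
  proof (induction j)
    case (Suc j)
    have "drift_code h d N ! j = drift_code h d' N ! j" using assms(1) by simp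
    then show ?case using Suc by (simp add: drift_code_def)
  qed (simp add: assms(2))
  then have "\<bar>d j / h - d' j / h\<bar> < 1" by linarith
  then have "\<bar>(d j - d' j) / h\<bar> < 1" by (simp add: diff_divide_distrib)
  then show ?thesis using assms(3) by (simp add: abs_divide)
qed

lemma drift_code_in_lists:
  assumes "\<And>j. j < N \<Longrightarrow> \<bar>d (Suc j) - d j\<bar> \<le> h" "h > 0"
  shows "drift_code h d N \<in> {l. set l \<subseteq> {-1, 0, 1} \<and> length l = N}"
proof -
  have step: "\<lfloor>d (Suc j) / h\<rfloor> - \<lfloor>d j / h\<rfloor> \<in> {-1, 0, 1}" if "j < N" for j
  proof -
    have "\<bar>(d (Suc j) - d j) / h\<bar> \<le> 1" using assms(1)[OF that] assms(2) by (simp add: abs_divide)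
    then have "\<bar>d (Suc j) / h - d j / h\<bar> \<le> 1" by (simp add: diff_divide_distrib)
    then have "\<lfloor>d (Suc j) / h\<rfloor> - \<lfloor>d j / h\<rfloor> \<le> 1" "\<lfloor>d j / h\<rfloor> - \<lfloor>d (Suc j) / h\<rfloor> \<le> 1"
      by linarith+
    then show ?thesis by auto
  qed
  have "set (drift_code h d N) \<subseteq> {-1, 0, 1}"
    unfolding drift_code_def set_map set_upt by (intro image_subsetI step) simp
  then show ?thesis by (simp add: drift_code_def)
qed

lemma card_drift_codes:
  "finite {l. set l \<subseteq> {-1, 0, 1::int} \<and> length l = N}"
  "card {l. set l \<subseteq> {-1, 0, 1::int} \<and> length l = N} = 3 ^ N"
  by (simp_all add: finite_lists_length_eq card_lists_length_eq numeral_3_eq_3)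

text \<open>
  A time change only relates the flows for nonnegative times; negative times enter through the flow
  property alone. The integral of \<open>r\<close> along the orbit is the \<open>\<psi>\<close>-time that corresponds to the \<open>\<phi>\<close>-time.
\<close>

locale time_change = P: compact_flow \<rho> \<Lambda> \<phi> + S: compact_flow \<rho> \<Lambda> \<psi>
  for \<rho> :: "'a::t2_space \<Rightarrow> 'a \<Rightarrow> ennreal" and \<Lambda> \<phi> \<psi> +
  fixes r :: "'a \<Rightarrow> real"
  assumes r_continuous: "continuous_on \<Lambda> r" and r_pos: "x \<in> \<Lambda> \<Longrightarrow> 0 < r x"
    and time_change: "x \<in> \<Lambda> \<Longrightarrow> 0 \<le> t \<Longrightarrow> \<psi> (P.orbit_integral r t x) x = \<phi> t x"
begin

abbreviation clock :: "'a \<Rightarrow> real \<Rightarrow> real" where "clock x t \<equiv> P.orbit_integral r t x"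

lemma continuous_on_inverse_r: "continuous_on \<Lambda> (\<lambda>x. 1 / r x)"
  using r_pos by (intro continuous_intros r_continuous) (force dest: r_pos)

lemma obtain_r_bounds:
  obtains r0 r1 where "0 < r0" "0 < r1" "\<And>x. x \<in> \<Lambda> \<Longrightarrow> r0 \<le> r x" "\<And>x. x \<in> \<Lambda> \<Longrightarrow> r x \<le> r1"
proof -
  obtain r1 where r1: "r1 > 0" "\<And>x. x \<in> \<Lambda> \<Longrightarrow> \<bar>r x\<bar> \<le> r1"
    using P.obtain_bound[OF r_continuous] by blast
  obtain M where M: "M > 0" "\<And>x. x \<in> \<Lambda> \<Longrightarrow> \<bar>1 / r x\<bar> \<le> M"
    using P.obtain_bound[OF continuous_on_inverse_r] by blast
  show ?thesis
  proof (rule that[of "1 / M" r1])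
    fix x assume x: "x \<in> \<Lambda>"
    show "1 / M \<le> r x" using M(2)[OF x] M(1) r_pos[OF x] by (simp add: field_simps)
    show "r x \<le> r1" using r1(2)[OF x] by simp
  qed (use r1 M in auto)
qed

lemma clock_mono:
  assumes "x \<in> \<Lambda>" "0 \<le> s" "s \<le> t" shows "clock x s \<le> clock x t"
proof -
  have "0 * (t - s) \<le> clock x t - clock x s"
    using r_pos by (intro P.orbit_integral_increment_ge[OF r_continuous assms]) (auto intro: less_imp_le)
  then show ?thesis by simp
qed

lemma clock_le_imp_le:
  assumes "x \<in> \<Lambda>" "0 \<le> s" "0 \<le> t" "clock x s \<le> clock x t" shows "s \<le> t"
proof (rule ccontr)
  assume "\<not> s \<le> t"
  obtain r0 r1 where r: "0 < r0" "\<And>x. x \<in> \<Lambda> \<Longrightarrow> r0 \<le> r x" using obtain_r_bounds by metis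
  have "r0 * (s - t) \<le> clock x s - clock x t"
    using \<open>\<not> s \<le> t\<close> by (intro P.orbit_integral_increment_ge[OF r_continuous assms(1,3) _ r(2)]) auto
  moreover have "r0 * (s - t) > 0" using r(1) \<open>\<not> s \<le> t\<close> by simp
  ultimately show False using assms(4) by simp
qed

lemma clock_surj:
  assumes "x \<in> \<Lambda>" "0 \<le> u" obtains t where "0 \<le> t" "clock x t = u"
proof -
  obtain r0 r1 where r: "0 < r0" "\<And>x. x \<in> \<Lambda> \<Longrightarrow> r0 \<le> r x" using obtain_r_bounds by metis
  have "r0 * (u / r0 - 0) \<le> clock x (u / r0) - clock x 0"
    using assms r by (intro P.orbit_integral_increment_ge[OF r_continuous assms(1) _ _ r(2)]) auto
  then have "u \<le> clock x (u / r0)" using r(1) by simp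
  moreover have "continuous_on {0..u / r0} (clock x)"
    unfolding P.orbit_integral_def
    by (rule indefinite_integral_continuous_1[OF P.along_orbit_integrable[OF r_continuous assms(1)]])
  ultimately obtain t where "0 \<le> t" "t \<le> u / r0" "clock x t = u"
    using IVT'[of "clock x" 0 u "u / r0"] assms(2) r(1) by auto
  then show ?thesis using that by blast
qed

text \<open>
  Substitution \<open>u = clock x s\<close>, with \<open>du = r (\<phi> s x) ds\<close>.
\<close>

lemma orbit_integral_change_of_time:
  assumes "continuous_on \<Lambda> h" "x \<in> \<Lambda>" "0 \<le> t"
  shows "S.orbit_integral h (clock x t) x = P.orbit_integral (\<lambda>y. h y * r y) t x"
proof -
  have deriv: "(clock x has_vector_derivative r (\<phi> s x)) (at s within {0..t})" if "s \<in> {0..t}" for s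
    unfolding P.orbit_integral_def
    by (rule integral_has_vector_derivative[OF P.continuous_on_along_orbit[OF r_continuous assms(2)] that])
  have "((\<lambda>s. r (\<phi> s x) *\<^sub>R h (\<psi> (clock x s) x)) has_integral
      integral {clock x 0..clock x t} (\<lambda>u. h (\<psi> u x))) {0..t}"
  proof (rule has_integral_substitution[where c = 0 and d = "clock x t"])
    show "clock x ` {0..t} \<subseteq> {0..clock x t}"
      using clock_mono[OF assms(2)] P.orbit_integral_0 by (auto; metis order_refl)
    show "continuous_on {0..clock x t} (\<lambda>u. h (\<psi> u x))"
      by (rule S.continuous_on_along_orbit[OF assms(1,2)])
    show "clock x 0 \<le> clock x t" using clock_mono[OF assms(2) order_refl assms(3)] .
  qed (use assms(3) deriv in \<open>auto simp: has_real_derivative_iff_has_vector_derivative\<close>)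
  then have "integral {0..t} (\<lambda>s. r (\<phi> s x) *\<^sub>R h (\<psi> (clock x s) x)) = S.orbit_integral h (clock x t) x"
    by (simp add: integral_unique S.orbit_integral_def)
  moreover have "integral {0..t} (\<lambda>s. r (\<phi> s x) *\<^sub>R h (\<psi> (clock x s) x)) =
      P.orbit_integral (\<lambda>y. h y * r y) t x"
    unfolding P.orbit_integral_def using time_change[OF assms(2)]
    by (intro integral_cong) (simp add: P.orbit_integral_def)
  ultimately show ?thesis by simp
qed

lemma orbit_integral_quotient:
  assumes "continuous_on \<Lambda> \<zeta>" "x \<in> \<Lambda>" "0 \<le> t"
  shows "S.orbit_integral (\<lambda>y. \<zeta> y / r y) (clock x t) x = P.orbit_integral \<zeta> t x"
proof -
  have "continuous_on \<Lambda> (\<lambda>y. \<zeta> y / r y)"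
    using continuous_on_mult[OF assms(1) continuous_on_inverse_r] by simp
  from orbit_integral_change_of_time[OF this assms(2,3)]
  have "S.orbit_integral (\<lambda>y. \<zeta> y / r y) (clock x t) x = P.orbit_integral (\<lambda>y. \<zeta> y / r y * r y) t x" .
  also have "\<dots> = P.orbit_integral \<zeta> t x"
    unfolding P.orbit_integral_def
    by (intro integral_cong) (use r_pos[OF P.invariant[OF assms(2)]] in \<open>simp add: less_imp_neq[symmetric]\<close>)
  finally show ?thesis .
qed

end

section \<open>Pressure under a change of time\<close>

lemma close_mono: "close \<rho> d x y \<Longrightarrow> d \<le> d' \<Longrightarrow> close \<rho> d' x y"
  unfolding close_def by (meson ennreal_leI order_trans)

context time_change
begin

text \<open>
  At the last grid time \<open>j T \<le> s\<close> the clocks of \<open>y\<close> and \<open>y'\<close> differ by at most \<open>h\<close>, because their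
  rounded drifts against \<open>z\<close> agree. From there to \<open>s\<close> each of them gains or loses at most \<open>h\<close>
  against the clock of \<open>z\<close>.
\<close>

lemma same_code_imp_close:
  assumes "T > 0" "h > 0" "\<delta> * real T \<le> h"
    and r: "\<And>x y. x \<in> \<Lambda> \<Longrightarrow> y \<in> \<Lambda> \<Longrightarrow> close \<rho> d x y \<Longrightarrow> \<bar>r x - r y\<bar> \<le> \<delta>"
    and in_\<Lambda>: "y \<in> \<Lambda>" "y' \<in> \<Lambda>" "z \<in> \<Lambda>"
    and near: "\<And>s. s \<in> {0..real n} \<Longrightarrow> close \<rho> d (\<phi> s z) (\<phi> s y)"
      "\<And>s. s \<in> {0..real n} \<Longrightarrow> close \<rho> d (\<phi> s z) (\<phi> s y')"
    and code: "drift_code h (\<lambda>j. clock z (j * T) - clock y (j * T)) (n div T) =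
      drift_code h (\<lambda>j. clock z (j * T) - clock y' (j * T)) (n div T)"
    and s: "s \<in> {0..real n}"
  shows "\<bar>clock y s - clock y' s\<bar> \<le> 3 * h"
proof -
  \<comment> \<open>The index of the last grid time before \<open>s\<close>.\<close>
  define j where "j = nat \<lfloor>s\<rfloor> div T"
  have "j * T \<le> nat \<lfloor>s\<rfloor>" by (simp add: j_def)
  then have "real (j * T) \<le> real (nat \<lfloor>s\<rfloor>)" by (rule of_nat_mono)
  then have jT: "real (j * T) \<le> s" using s by (simp del: of_nat_mult) linarith
  have "nat \<lfloor>s\<rfloor> < Suc j * T" unfolding j_def using assms(1) by (simp add: dividend_less_div_times add.commute)
  then have "nat \<lfloor>s\<rfloor> + 1 \<le> j * T + T" by simp
  then have "real (nat \<lfloor>s\<rfloor>) + 1 \<le> real (j * T) + real T" by linarith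
  then have sj: "s - real (j * T) \<le> real T" using s by linarith
  have "real (j * T) \<le> real n" using jT s by simp
  then have j: "j \<le> n div T" using assms(1) by (simp add: less_eq_div_iff_mult_less_eq flip: of_nat_mult)
  have h0: "0 \<le> \<delta>" using r[OF in_\<Lambda>(3,1)] near(1)[of 0] by simp
  have step: "\<bar>(clock z s - clock z (j * T)) - (clock x s - clock x (j * T))\<bar> \<le> h"
    if x: "x \<in> \<Lambda>" "\<And>s. s \<in> {0..real n} \<Longrightarrow> close \<rho> d (\<phi> s z) (\<phi> s x)" for x
  proof -
    have "\<bar>(clock z s - clock z (j * T)) - (clock x s - clock x (j * T))\<bar> \<le> \<delta> * (s - j * T)"
    proof (rule P.orbit_integral_increments_close[OF r_continuous in_\<Lambda>(3) x(1) _ jT])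
      fix u assume u: "u \<in> {real (j * T)..s}"
      have "0 \<le> real (j * T)" by simp
      then have "u \<in> {0..real n}" using u s by (simp del: of_nat_mult)
      then show "\<bar>r (\<phi> u z) - r (\<phi> u x)\<bar> \<le> \<delta>"
        by (intro r P.invariant in_\<Lambda> x)
    qed simp
    also have "\<dots> \<le> \<delta> * real T" using sj h0 by (rule mult_left_mono)
    finally show ?thesis using assms(3) by linarith
  qed
  have "\<bar>(clock z (j * T) - clock y (j * T)) - (clock z (j * T) - clock y' (j * T))\<bar> < h"
    using drift_code_eqD[OF code _ assms(2) j] by simp
  then show ?thesis using step[OF in_\<Lambda>(1) near(1)] step[OF in_\<Lambda>(2) near(2)] by linarith
qed

text \<open>
  To each \<open>y \<in> E\<close> assign a point \<open>z \<in> F\<close> whose \<open>\<phi>\<close>-orbit follows that of \<open>y\<close> up to time \<open>n\<close>, and the code of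
  the drift of its clock against that of \<open>z\<close>. Points with equal assignments are close at equal
  \<open>\<psi>\<close>-times, so the assignment is injective on the \<open>\<psi>\<close>-separated set \<open>E\<close>. The factor
  \<open>3 ^ (n div T)\<close> counts the codes; the factor \<open>exp (\<gamma> * n + M)\<close> compares the weights of \<open>y\<close> and \<open>z\<close>,
  with \<open>M\<close> for the time between the actual cut-off and \<open>n\<close>, which is at most \<open>1\<close>.
\<close>

lemma separated_sum_bound:
  assumes T: "T > 0" "h > 0" "\<delta> * real T \<le> h"
    and r: "\<And>x y. x \<in> \<Lambda> \<Longrightarrow> y \<in> \<Lambda> \<Longrightarrow> close \<rho> d x y \<Longrightarrow> \<bar>r x - r y\<bar> \<le> \<delta>"
    and small: "\<And>x y y' w. x \<in> \<Lambda> \<Longrightarrow> y \<in> \<Lambda> \<Longrightarrow> y' \<in> \<Lambda> \<Longrightarrow> close \<rho> d x y \<Longrightarrow> close \<rho> d x y' \<Longrightarrow>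
      \<bar>w\<bar> \<le> 3 * h \<Longrightarrow> \<rho> y (\<psi> w y') \<le> ennreal \<epsilon>"
    and \<zeta>: "continuous_on \<Lambda> \<zeta>" "\<And>x. x \<in> \<Lambda> \<Longrightarrow> \<bar>\<zeta> x\<bar> \<le> M"
      "\<And>x y. x \<in> \<Lambda> \<Longrightarrow> y \<in> \<Lambda> \<Longrightarrow> close \<rho> d x y \<Longrightarrow> \<bar>\<zeta> x - \<zeta> y\<bar> \<le> \<gamma>"
    and F: "finite F" "F \<subseteq> \<Lambda>"
      "\<And>y. y \<in> \<Lambda> \<Longrightarrow> \<exists>z\<in>F. \<forall>s\<in>{0..real n}. close \<rho> d (\<phi> s z) (\<phi> s y)"
    and E: "finite E" "separated \<rho> \<Lambda> \<psi> \<tau> \<epsilon> E"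
    and time: "\<And>y. y \<in> E \<Longrightarrow> \<exists>t. 0 \<le> t \<and> real n - 1 \<le> t \<and> t \<le> real n \<and> clock y t = \<tau>"
  shows "(\<Sum>y\<in>E. exp (S.orbit_integral (\<lambda>x. \<zeta> x / r x) \<tau> y)) \<le>
    3 ^ (n div T) * exp (\<gamma> * n + M) * (\<Sum>z\<in>F. exp (P.orbit_integral \<zeta> n z))"
proof -
  let ?N = "n div T"
  let ?L = "{l. set l \<subseteq> {-1, 0, 1::int} \<and> length l = ?N}"
  have E\<Lambda>: "y \<in> \<Lambda>" if "y \<in> E" for y using E(2) that by (auto simp: separated_def)
  have "\<forall>y\<in>E. \<exists>z. z \<in> F \<and> (\<forall>s\<in>{0..real n}. close \<rho> d (\<phi> s z) (\<phi> s y))" using F(3) E\<Lambda> by blast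
  from bchoice[OF this] obtain z where
    z: "\<And>y. y \<in> E \<Longrightarrow> z y \<in> F" and near: "\<And>y s. y \<in> E \<Longrightarrow> s \<in> {0..real n} \<Longrightarrow> close \<rho> d (\<phi> s (z y)) (\<phi> s y)"
    by blast
  have z\<Lambda>: "z y \<in> \<Lambda>" if "y \<in> E" for y using z[OF that] F(2) by blast
  define c where "c y = (z y, drift_code h (\<lambda>j. clock (z y) (j * T) - clock y (j * T)) ?N)" for y
  have c_mem: "c y \<in> F \<times> ?L" if y: "y \<in> E" for y
  proof -
    have step: "\<bar>(clock (z y) (Suc j * T) - clock y (Suc j * T)) - (clock (z y) (j * T) - clock y (j * T))\<bar> \<le> h"
      if "j < ?N" for j
    proof -
      have le: "Suc j * T \<le> n" using that T(1) by (meson Suc_leI less_eq_div_iff_mult_less_eq)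
      have "\<bar>(clock (z y) (Suc j * T) - clock (z y) (j * T)) - (clock y (Suc j * T) - clock y (j * T))\<bar>
          \<le> \<delta> * (real (Suc j * T) - real (j * T))"
      proof (rule P.orbit_integral_increments_close[OF r_continuous z\<Lambda>[OF y] E\<Lambda>[OF y]])
        fix u assume u: "u \<in> {real (j * T)..real (Suc j * T)}"
        have "0 \<le> real (j * T)" "real (Suc j * T) \<le> real n" using le by (simp, intro of_nat_mono)
        then have "u \<in> {0..real n}" using u by (simp del: of_nat_mult)
        then show "\<bar>r (\<phi> u (z y)) - r (\<phi> u y)\<bar> \<le> \<delta>"
          by (intro r P.invariant z\<Lambda> E\<Lambda> near y)
      qed (auto intro: mult_right_mono simp del: of_nat_mult)
      also have "\<dots> = \<delta> * real T" by (simp add: algebra_simps)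
      finally show ?thesis using T(3) by linarith
    qed
    have "drift_code h (\<lambda>j. clock (z y) (j * T) - clock y (j * T)) ?N \<in> ?L"
      by (rule drift_code_in_lists[where d = "\<lambda>j. clock (z y) (j * T) - clock y (j * T)", OF step T(2)])
    then show ?thesis using z[OF y] by (simp add: c_def)
  qed
  have inj: "inj_on c E"
  proof (rule inj_onI, rule ccontr)
    fix y y' assume y: "y \<in> E" "y' \<in> E" and eq: "c y = c y'" and "y \<noteq> y'"
    then obtain u where u: "u \<in> {0..\<tau>}" "ennreal \<epsilon> < \<rho> (\<psi> u y) (\<psi> u y')"
      using E(2) unfolding separated_def by blast
    obtain s where s: "0 \<le> s" "clock y s = u" using clock_surj[OF E\<Lambda>[OF y(1)], of u] u(1) by auto
    obtain t where t: "0 \<le> t" "t \<le> real n" "clock y t = \<tau>" using time[OF y(1)] by blast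
    have "s \<le> t" using clock_le_imp_le[OF E\<Lambda>[OF y(1)] s(1) t(1)] s(2) t(3) u(1) by simp
    then have sn: "s \<in> {0..real n}" using s(1) t(2) by simp
    have zz: "z y' = z y" using eq by (simp add: c_def)
    have near': "close \<rho> d (\<phi> s (z y)) (\<phi> s y')" if "s \<in> {0..real n}" for s
      using near[OF y(2) that] by (simp add: zz)
    have "\<bar>clock y s - clock y' s\<bar> \<le> 3 * h"
      using eq zz by (intro same_code_imp_close[OF T r E\<Lambda>[OF y(1)] E\<Lambda>[OF y(2)] z\<Lambda>[OF y(1)]
          near[OF y(1)] near' _ sn]) (simp_all add: c_def)
    from small[OF P.invariant[OF z\<Lambda>[OF y(1)]] P.invariant[OF E\<Lambda>[OF y(1)]] P.invariant[OF E\<Lambda>[OF y(2)]]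
        near[OF y(1) sn] near'[OF sn] this]
    have "\<rho> (\<phi> s y) (\<psi> (clock y s - clock y' s) (\<phi> s y')) \<le> ennreal \<epsilon>" .
    moreover have "\<psi> (clock y s - clock y' s) (\<phi> s y') = \<psi> u y'"
      using time_change[OF E\<Lambda>[OF y(2)] s(1)] S.flow_add[of "clock y s - clock y' s" "clock y' s" y'] s(2)
      by simp
    moreover have "\<phi> s y = \<psi> u y" using time_change[OF E\<Lambda>[OF y(1)] s(1)] s(2) by simp
    ultimately show False using u(2) by simp
  qed
  define W where "W p = exp (\<gamma> * n + M) * exp (P.orbit_integral \<zeta> n (fst p))" for p :: "'a \<times> int list"
  have weight: "exp (S.orbit_integral (\<lambda>x. \<zeta> x / r x) \<tau> y) \<le> W (c y)" if y: "y \<in> E" for y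
  proof -
    obtain t where t: "0 \<le> t" "real n - 1 \<le> t" "t \<le> real n" "clock y t = \<tau>" using time[OF y] by blast
    have "S.orbit_integral (\<lambda>x. \<zeta> x / r x) \<tau> y = P.orbit_integral \<zeta> t y"
      using orbit_integral_quotient[OF \<zeta>(1) E\<Lambda>[OF y] t(1)] t(4) by simp
    moreover have "(- M) * (n - t) \<le> P.orbit_integral \<zeta> n y - P.orbit_integral \<zeta> t y"
    proof (rule P.orbit_integral_increment_ge[OF \<zeta>(1) E\<Lambda>[OF y] t(1,3)])
      show "- M \<le> \<zeta> x" if "x \<in> \<Lambda>" for x using \<zeta>(2)[OF that] by linarith
    qed
    moreover have "M * (n - t) \<le> M * 1"
      using t \<zeta>(2)[OF E\<Lambda>[OF y]] by (intro mult_left_mono) auto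
    moreover have "\<bar>(P.orbit_integral \<zeta> n (z y) - P.orbit_integral \<zeta> 0 (z y)) -
        (P.orbit_integral \<zeta> n y - P.orbit_integral \<zeta> 0 y)\<bar> \<le> \<gamma> * (real n - 0)"
      by (intro P.orbit_integral_increments_close[OF \<zeta>(1) z\<Lambda>[OF y] E\<Lambda>[OF y]] \<zeta>(3) P.invariant
          z\<Lambda>[OF y] E\<Lambda>[OF y] near[OF y]) auto
    ultimately have "S.orbit_integral (\<lambda>x. \<zeta> x / r x) \<tau> y \<le> \<gamma> * n + M + P.orbit_integral \<zeta> n (z y)"
      by (simp add: abs_le_iff)
    then show ?thesis by (simp add: W_def c_def flip: exp_add)
  qed
  have "(\<Sum>y\<in>E. exp (S.orbit_integral (\<lambda>x. \<zeta> x / r x) \<tau> y)) \<le> (\<Sum>y\<in>E. W (c y))"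
    by (rule sum_mono) (rule weight)
  also have "\<dots> = sum W (c ` E)" using inj by (simp add: sum.reindex)
  also have "\<dots> \<le> sum W (F \<times> ?L)"
  proof (rule sum_mono2)
    show "finite (F \<times> ?L)" using F(1) card_drift_codes(1) by (rule finite_cartesian_product)
    show "c ` E \<subseteq> F \<times> ?L" by (rule image_subsetI) (rule c_mem)
  qed (simp add: W_def)
  also have "\<dots> = (\<Sum>z\<in>F. \<Sum>l\<in>?L. exp (\<gamma> * n + M) * exp (P.orbit_integral \<zeta> n z))"
    by (simp only: W_def[abs_def] sum.cartesian_product case_prod_unfold)
  also have "\<dots> = 3 ^ ?N * exp (\<gamma> * n + M) * (\<Sum>z\<in>F. exp (P.orbit_integral \<zeta> n z))"
    unfolding sum_constant card_drift_codes(2) by (simp add: sum_distrib_left mult.assoc)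
  finally show ?thesis .
qed

text \<open>
  The \<open>\<phi>\<close>-times at which the points of a \<open>(\<tau>, \<epsilon>)\<close>-separated set for \<open>\<psi>\<close> reach the \<open>\<psi>\<close>-time \<open>\<tau>\<close> lie between
  \<open>\<tau> / r1\<close> and \<open>\<tau> / r0\<close>. After rounding them up to integers \<open>n\<close>, each \<open>n\<close> contributes a bounded amount,
  because the decay \<open>exp (- a n / 2)\<close> of the partition sums of \<open>\<phi>\<close> beats the errors of
  \<open>separated_sum_bound\<close>. The total is \<open>O(\<tau>)\<close>.
\<close>

lemma pressure_time_change_nonpos:
  assumes \<zeta>: "continuous_on \<Lambda> \<zeta>" and "a > 0" and pressure: "top_pressure \<rho> \<Lambda> \<phi> \<zeta> \<le> ereal (- a)"
  shows "top_pressure \<rho> \<Lambda> \<psi> (\<lambda>x. \<zeta> x / r x) \<le> ereal 0"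
  unfolding top_pressure_le_iff
proof (intro allI impI)
  fix \<epsilon> b :: real assume "\<epsilon> > 0" "b > 0"
  obtain r0 r1 where r0: "0 < r0" "\<And>x. x \<in> \<Lambda> \<Longrightarrow> r0 \<le> r x"
    and r1: "0 < r1" "\<And>x. x \<in> \<Lambda> \<Longrightarrow> r x \<le> r1" using obtain_r_bounds by metis
  obtain M where M: "M > 0" "\<And>x. x \<in> \<Lambda> \<Longrightarrow> \<bar>\<zeta> x\<bar> \<le> M" using P.obtain_bound[OF \<zeta>] by blast
  \<comment> \<open>Two errors of rate \<open>\<gamma>\<close>, one from the drift codes and one from the weights, leave a decay of
    rate \<open>a / 2 - 2 * \<gamma> = a / 4\<close>.\<close>
  define \<gamma> where "\<gamma> = a / 8"
  have "\<gamma> > 0" using \<open>a > 0\<close> by (simp add: \<gamma>_def)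
  obtain d1 h' where d1: "d1 > 0" "h' > 0" "\<And>x y y' w. x \<in> \<Lambda> \<Longrightarrow> y \<in> \<Lambda> \<Longrightarrow> y' \<in> \<Lambda> \<Longrightarrow>
    close \<rho> d1 x y \<Longrightarrow> close \<rho> d1 x y' \<Longrightarrow> \<bar>w\<bar> \<le> h' \<Longrightarrow> \<rho> y (\<psi> w y') \<le> ennreal \<epsilon>"
    using S.short_time_uniformly_small[OF \<open>\<epsilon> > 0\<close>] by blast
  define h where "h = h' / 3"
  have h: "h > 0" "h' = 3 * h" using d1(2) by (simp_all add: h_def)
  \<comment> \<open>The codes of length \<open>n div T\<close> number at most \<open>exp (\<gamma> * n)\<close>.\<close>
  obtain T :: nat where T: "ln 3 / \<gamma> < real T" using reals_Archimedean2 by blast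
  have "0 < ln 3 / \<gamma>" using \<open>\<gamma> > 0\<close> by simp
  then have T0: "T > 0" using T by (cases T) auto
  have lnT: "ln 3 \<le> \<gamma> * T" using T \<open>\<gamma> > 0\<close> by (simp add: divide_less_eq mult.commute)
  \<comment> \<open>If \<open>r\<close> varies by at most \<open>\<delta>\<close> between two orbits, their clocks drift by at most \<open>h\<close> in time \<open>T\<close>.\<close>
  define \<delta> where "\<delta> = h / T"
  have \<delta>: "\<delta> > 0" "\<delta> * T \<le> h" using h T0 by (simp_all add: \<delta>_def)
  obtain d2 where d2: "d2 > 0" "\<And>x y. x \<in> \<Lambda> \<Longrightarrow> y \<in> \<Lambda> \<Longrightarrow> close \<rho> d2 x y \<Longrightarrow> \<bar>r x - r y\<bar> \<le> \<delta>"
    using P.uniformly_continuous_real[OF r_continuous \<delta>(1)] by blast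
  obtain d3 where d3: "d3 > 0" "\<And>x y. x \<in> \<Lambda> \<Longrightarrow> y \<in> \<Lambda> \<Longrightarrow> close \<rho> d3 x y \<Longrightarrow> \<bar>\<zeta> x - \<zeta> y\<bar> \<le> \<gamma>"
    using P.uniformly_continuous_real[OF \<zeta> \<open>\<gamma> > 0\<close>] by blast
  define d where "d = min d1 (min d2 d3)"
  have d: "d > 0" "d \<le> d1" "d \<le> d2" "d \<le> d3" using d1(1) d2(1) d3(1) by (auto simp: d_def)
  have "\<forall>\<^sub>F t in at_top. partition_sum \<rho> \<Lambda> \<phi> \<zeta> d t \<le> ennreal (exp (- (a / 2) * t))"
    using pressure[unfolded top_pressure_le_iff, rule_format, of d "- (a / 2)"] d(1) \<open>a > 0\<close> by simp
  then obtain t0 where t0: "\<And>t. t \<ge> t0 \<Longrightarrow> partition_sum \<rho> \<Lambda> \<phi> \<zeta> d t \<le> ennreal (exp (- (a / 2) * t))"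
    unfolding eventually_at_top_linorder by blast
  \<comment> \<open>The contribution of the points whose \<open>\<phi>\<close>-time, rounded up, is \<open>n\<close>.\<close>
  have piece: "(\<Sum>y\<in>E. exp (S.orbit_integral (\<lambda>x. \<zeta> x / r x) \<tau> y)) \<le> exp M"
    if n: "real n \<ge> t0" and E: "finite E" "separated \<rho> \<Lambda> \<psi> \<tau> \<epsilon> E"
      and time: "\<And>y. y \<in> E \<Longrightarrow> \<exists>t. 0 \<le> t \<and> real n - 1 \<le> t \<and> t \<le> real n \<and> clock y t = \<tau>" for n E \<tau>
  proof -
    obtain F where F: "finite F" "F \<subseteq> \<Lambda>"
      "(\<Sum>z\<in>F. exp (P.orbit_integral \<zeta> n z)) \<le> exp (- (a / 2) * real n)"
      and span: "\<forall>y\<in>\<Lambda>. \<exists>z\<in>F. \<forall>s\<in>{0..real n}. close \<rho> d (\<phi> s z) (\<phi> s y)"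
      using P.exists_spanning_set[OF \<zeta> of_nat_0_le_iff d(1) t0[OF n] exp_ge_zero] by blast
    have "(\<Sum>y\<in>E. exp (S.orbit_integral (\<lambda>x. \<zeta> x / r x) \<tau> y)) \<le>
        3 ^ (n div T) * exp (\<gamma> * n + M) * (\<Sum>z\<in>F. exp (P.orbit_integral \<zeta> n z))"
    proof (rule separated_sum_bound[OF T0 h(1) \<delta>(2) _ _ \<zeta> M(2) _ F(1,2) bspec[OF span] E time])
      show "\<bar>r x - r y\<bar> \<le> \<delta>" if "x \<in> \<Lambda>" "y \<in> \<Lambda>" "close \<rho> d x y" for x y
        using d2(2)[OF that(1,2) close_mono[OF that(3) d(3)]] .
      show "\<bar>\<zeta> x - \<zeta> y\<bar> \<le> \<gamma>" if "x \<in> \<Lambda>" "y \<in> \<Lambda>" "close \<rho> d x y" for x y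
        using d3(2)[OF that(1,2) close_mono[OF that(3) d(4)]] .
      show "\<rho> y (\<psi> w y') \<le> ennreal \<epsilon>" if "x \<in> \<Lambda>" "y \<in> \<Lambda>" "y' \<in> \<Lambda>" "close \<rho> d x y" "close \<rho> d x y'"
        "\<bar>w\<bar> \<le> 3 * h" for x y y' w
        using d1(3)[OF that(1-3) close_mono[OF that(4) d(2)] close_mono[OF that(5) d(2)]] that(6) h(2) by simp
    qed
    also have "\<dots> \<le> exp (\<gamma> * n) * exp (\<gamma> * n + M) * exp (- (a / 2) * real n)"
    proof (intro mult_mono F(3) order_refl)
      have "n div T * ln 3 \<le> n div T * (\<gamma> * T)" using lnT by (intro mult_left_mono) auto
      also have "\<dots> = \<gamma> * real (n div T * T)" by simp
      also have "\<dots> \<le> \<gamma> * n" using \<open>\<gamma> > 0\<close> by (intro mult_left_mono of_nat_mono) auto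
      finally have "exp (n div T * ln 3) \<le> exp (\<gamma> * n)" by simp
      moreover have "exp (n div T * ln 3) = (3::real) ^ (n div T)" by (simp add: exp_of_nat_mult)
      ultimately show "(3::real) ^ (n div T) \<le> exp (\<gamma> * n)" by simp
    qed (auto intro!: sum_nonneg)
    also have "\<dots> = exp (M - (a / 4) * n)" by (simp add: \<gamma>_def algebra_simps flip: exp_add)
    also have "\<dots> \<le> exp M" using \<open>a > 0\<close> by simp
    finally show ?thesis .
  qed
  have "\<forall>\<^sub>F \<tau> in at_top. (\<tau> / r0 + 2) * exp M \<le> exp (b * \<tau>)"
    using r0(1) \<open>b > 0\<close> by real_asymp
  moreover have "\<forall>\<^sub>F \<tau>::real in at_top. \<tau> \<ge> 0" by (rule eventually_ge_at_top)
  moreover have "\<forall>\<^sub>F \<tau> in at_top. \<tau> \<ge> r1 * t0" by (rule eventually_ge_at_top)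
  ultimately show "\<forall>\<^sub>F \<tau> in at_top. partition_sum \<rho> \<Lambda> \<psi> (\<lambda>x. \<zeta> x / r x) \<epsilon> \<tau> \<le> ennreal (exp (b * \<tau>))"
  proof eventually_elim
    case (elim \<tau>)
    show ?case
    proof (rule partition_sum_leI)
      fix E assume E: "separated \<rho> \<Lambda> \<psi> \<tau> \<epsilon> E" "finite E"
      have E\<Lambda>: "y \<in> \<Lambda>" if "y \<in> E" for y using E(1) that by (auto simp: separated_def)
      have "\<forall>y\<in>E. \<exists>t. 0 \<le> t \<and> clock y t = \<tau>" using clock_surj[OF E\<Lambda> elim(2)] by metis
      from bchoice[OF this] obtain t where t: "\<And>y. y \<in> E \<Longrightarrow> 0 \<le> t y" "\<And>y. y \<in> E \<Longrightarrow> clock y (t y) = \<tau>"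
        by blast
      define N where "N = nat \<lceil>\<tau> / r0\<rceil>"
      \<comment> \<open>Rounding up ensures that the orbit of \<open>y\<close> is followed over its whole length.\<close>
      define k where "k y = nat \<lceil>t y\<rceil>" for y
      have k: "real (k y) - 1 \<le> t y" "t y \<le> real (k y)" if "y \<in> E" for y
        using t(1)[OF that] unfolding k_def by linarith+
      have bounds: "t y \<le> \<tau> / r0" "t0 \<le> t y" if y: "y \<in> E" for y
      proof -
        have "r0 * (t y - 0) \<le> clock y (t y) - clock y 0"
          by (rule P.orbit_integral_increment_ge[OF r_continuous E\<Lambda>[OF y] order_refl t(1)[OF y] r0(2)])
        then show "t y \<le> \<tau> / r0" using t(2)[OF y] r0(1) by (simp add: pos_le_divide_eq mult.commute)
        have "clock y (t y) - clock y 0 \<le> r1 * (t y - 0)"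
          by (rule P.orbit_integral_increment_le[OF r_continuous E\<Lambda>[OF y] order_refl t(1)[OF y] r1(2)])
        then have "r1 * t0 \<le> r1 * t y" using t(2)[OF y] elim(3) by simp
        then show "t0 \<le> t y" using r1(1) by simp
      qed
      have kN: "k ` E \<subseteq> {..N}"
        using bounds(1) unfolding k_def N_def by (auto intro!: nat_mono ceiling_mono)
      have "(\<Sum>y\<in>E. exp (LBINT s=0..\<tau>. \<zeta> (\<psi> s y) / r (\<psi> s y))) =
          (\<Sum>y\<in>E. exp (S.orbit_integral (\<lambda>x. \<zeta> x / r x) \<tau> y))"
      proof (intro sum.cong refl arg_cong[of _ _ exp])
        fix y assume "y \<in> E"
        have "continuous_on \<Lambda> (\<lambda>x. \<zeta> x / r x)"
          using continuous_on_mult[OF \<zeta> continuous_on_inverse_r] by simp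
        from S.interval_integral_eq_orbit_integral[OF this E\<Lambda>[OF \<open>y \<in> E\<close>] elim(2)]
        show "(LBINT s=0..\<tau>. \<zeta> (\<psi> s y) / r (\<psi> s y)) = S.orbit_integral (\<lambda>x. \<zeta> x / r x) \<tau> y" .
      qed
      also have "\<dots> = (\<Sum>n\<le>N. \<Sum>y\<in>{y\<in>E. k y = n}. exp (S.orbit_integral (\<lambda>x. \<zeta> x / r x) \<tau> y))"
        by (rule sum.group[OF E(2) finite_atMost kN, symmetric])
      also have "\<dots> \<le> (\<Sum>n\<le>N. exp M)"
      proof (rule sum_mono)
        fix n
        show "(\<Sum>y\<in>{y\<in>E. k y = n}. exp (S.orbit_integral (\<lambda>x. \<zeta> x / r x) \<tau> y)) \<le> exp M"
        proof (cases "{y\<in>E. k y = n} = {}")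
          case True
          then show ?thesis by (simp only: sum.empty exp_ge_zero)
        next
          case False
          then obtain y where "y \<in> E" "k y = n" by blast
          then have "t0 \<le> real n" using bounds(2)[of y] k(2)[of y] by simp
          then show ?thesis
          proof (rule piece[where n = n])
            show "separated \<rho> \<Lambda> \<psi> \<tau> \<epsilon> {y\<in>E. k y = n}" by (rule separated_subset[OF E(1)]) blast
            show "\<exists>t. 0 \<le> t \<and> real n - 1 \<le> t \<and> t \<le> real n \<and> clock y t = \<tau>" if "y \<in> {y\<in>E. k y = n}" for y
              using that k[of y] t[of y] by (intro exI[of _ "t y"]) auto
          qed (use E(2) in simp)
        qed
      qed
      also have "\<dots> = (real N + 1) * exp M" by simp
      also have "\<dots> \<le> (\<tau> / r0 + 2) * exp M"
      proof (rule mult_right_mono)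
        have "0 \<le> \<tau> / r0" using elim(2) r0(1) by simp
        then show "real N + 1 \<le> \<tau> / r0 + 2" unfolding N_def by linarith
      qed simp
      finally show "(\<Sum>y\<in>E. exp (LBINT s=0..\<tau>. \<zeta> (\<psi> s y) / r (\<psi> s y))) \<le> exp (b * \<tau>)"
        using elim(1) by linarith
    qed
  qed
qed

text \<open>
  The integral of \<open>1 / r\<close> along the \<open>\<psi>\<close>-orbit gives back the \<open>\<phi>\<close>-time.
\<close>

lemma time_change_inverse: "time_change \<rho> \<Lambda> \<psi> \<phi> (\<lambda>x. 1 / r x)"
proof (unfold_locales, fact continuous_on_inverse_r)
  fix x assume x: "x \<in> \<Lambda>"
  show "0 < 1 / r x" using r_pos[OF x] by simp
  fix u :: real assume "0 \<le> u"
  then obtain t where t: "0 \<le> t" "clock x t = u" using clock_surj[OF x] by blast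
  have "S.orbit_integral (\<lambda>x. 1 / r x) u x = P.orbit_integral (\<lambda>x. 1) t x"
    using orbit_integral_quotient[OF continuous_on_const[of _ "1::real"] x t(1)] t(2) by simp
  also have "\<dots> = t" using t(1) by (simp add: P.orbit_integral_def)
  finally show "\<phi> (S.orbit_integral (\<lambda>x. 1 / r x) u x) x = \<psi> u x"
    using time_change[OF x t(1)] t(2) by simp
qed

text \<open>
  Both inequalities follow from \<open>pressure_time_change_nonpos\<close>, for the time change and for its
  inverse. That result needs strictly negative pressure, which is gained by shifting \<open>p\<close>
  slightly, at a proportional cost in the pressure for \<open>\<psi>\<close> because \<open>1 / r\<close> is bounded.
\<close>

theorem pressure_time_change:
  assumes \<xi>: "continuous_on \<Lambda> \<xi>" and P: "top_pressure \<rho> \<Lambda> \<phi> \<xi> = ereal p"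
  shows "top_pressure \<rho> \<Lambda> \<psi> (\<lambda>x. (\<xi> x - p) / r x) = 0"
proof (rule antisym)
  let ?\<eta> = "\<lambda>c x. (\<xi> x - c) / r x"
  have cont: "continuous_on \<Lambda> (\<lambda>x. \<xi> x - c)" "continuous_on \<Lambda> (?\<eta> c)" for c
  proof -
    show *: "continuous_on \<Lambda> (\<lambda>x. \<xi> x - c)" by (intro continuous_intros \<xi>)
    show "continuous_on \<Lambda> (?\<eta> c)" using continuous_on_mult[OF * continuous_on_inverse_r] by simp
  qed
  obtain K where K: "K > 0" "\<And>x. x \<in> \<Lambda> \<Longrightarrow> \<bar>1 / r x\<bar> \<le> K"
    using P.obtain_bound[OF continuous_on_inverse_r] by blast
  have shift: "?\<eta> c x \<le> ?\<eta> (c + e) x + e * K" if "x \<in> \<Lambda>" "e \<ge> 0" for c e x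
  proof -
    have "?\<eta> c x - ?\<eta> (c + e) x = e * (1 / r x)" by (simp add: diff_divide_distrib add_divide_distrib)
    also have "\<dots> \<le> e * K" using K(2)[OF that(1)] that(2) by (intro mult_left_mono) (simp_all only: abs_le_iff)
    finally show ?thesis by simp
  qed
  show "top_pressure \<rho> \<Lambda> \<psi> (?\<eta> p) \<le> 0"
  proof (rule ereal_le_epsilon2)
    fix e :: real assume "e > 0"
    define e' where "e' = e / K"
    have e': "e' > 0" "e' * K = e" using K(1) \<open>e > 0\<close> by (simp_all add: e'_def)
    have "top_pressure \<rho> \<Lambda> \<phi> (\<lambda>x. \<xi> x - (p + e')) \<le> ereal (p + (- p - e'))"
      by (rule P.top_pressure_perturb[OF \<xi> cont(1)]) (auto simp: P)
    then have "top_pressure \<rho> \<Lambda> \<psi> (?\<eta> (p + e')) \<le> ereal 0"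
      using pressure_time_change_nonpos[OF cont(1) e'(1)] by simp
    then have "top_pressure \<rho> \<Lambda> \<psi> (?\<eta> p) \<le> ereal (0 + e' * K)"
      using shift e'(1) by (intro S.top_pressure_perturb[OF cont(2) cont(2)]) auto
    then show "top_pressure \<rho> \<Lambda> \<psi> (?\<eta> p) \<le> 0 + ereal e" using e'(2) by simp
  qed
  show "0 \<le> top_pressure \<rho> \<Lambda> \<psi> (?\<eta> p)"
  proof (rule ccontr)
    interpret inv: time_change \<rho> \<Lambda> \<psi> \<phi> "\<lambda>x. 1 / r x" by (rule time_change_inverse)
    assume "\<not> 0 \<le> top_pressure \<rho> \<Lambda> \<psi> (?\<eta> p)"
    then obtain q where q: "top_pressure \<rho> \<Lambda> \<psi> (?\<eta> p) < ereal q" "q < 0"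
      using ereal_dense2[of "top_pressure \<rho> \<Lambda> \<psi> (?\<eta> p)" 0] by (auto simp: not_le)
    \<comment> \<open>Lowering \<open>p\<close> by \<open>e\<close> raises the pressure for \<open>\<psi>\<close> by at most \<open>e * K = - q / 2\<close>,
      which leaves it negative.\<close>
    define e where "e = - q / (2 * K)"
    have e: "e > 0" "q + e * K = - (- q / 2)" using K(1) q(2) by (simp_all add: e_def divide_neg_pos)
    have "?\<eta> (p - e) x \<le> ?\<eta> p x + e * K" if "x \<in> \<Lambda>" for x
      using shift[OF that, of e "p - e"] e(1) by simp
    then have "top_pressure \<rho> \<Lambda> \<psi> (?\<eta> (p - e)) \<le> ereal (q + e * K)"
      using q(1) by (intro S.top_pressure_perturb[OF cont(2) cont(2)]) auto
    then have "top_pressure \<rho> \<Lambda> \<phi> (\<lambda>x. ?\<eta> (p - e) x / (1 / r x)) \<le> ereal 0"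
      unfolding e(2) using q(2) by (intro inv.pressure_time_change_nonpos[OF cont(2), of "- q / 2"]) auto
    moreover have "continuous_on \<Lambda> (\<lambda>x. ?\<eta> (p - e) x / (1 / r x))"
      using continuous_on_mult[OF cont(2) r_continuous] by simp
    ultimately have "top_pressure \<rho> \<Lambda> \<phi> \<xi> \<le> ereal (0 + (p - e))"
      using r_pos by (intro P.top_pressure_perturb[OF _ \<xi>]) (auto simp: less_imp_neq[symmetric])
    then show False using P e(1) by simp
  qed
qed

end

section \<open>Charts of a manifold\<close>

lemma Ck_on_imp_continuous_on:
  assumes "Ck_on k f S"
  shows "continuous_on S f"
proof (cases k)
  case 0
  then show ?thesis using assms by simp
next
  case (Suc j)
  then obtain D where "\<forall>x\<in>S. (f has_derivative D x) (at x)" using assms by auto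
  then have "\<forall>x\<in>S. isCont f x" using has_derivative_continuous by blast
  then show ?thesis by (simp add: continuous_at_imp_continuous_on)
qed

lemma Ck_on_obtain_derivative:
  assumes "Ck_on k f S" "1 \<le> k"
  obtains D where "\<And>x. x \<in> S \<Longrightarrow> (f has_derivative D x) (at x)"
    and "\<And>v. continuous_on S (\<lambda>x. D x v)"
proof -
  obtain j where "k = Suc j" using assms(2) by (cases k) auto
  then obtain D where "\<forall>x\<in>S. (f has_derivative D x) (at x)" "\<forall>v. Ck_on j (\<lambda>x. D x v) S"
    using assms(1) by auto
  then show ?thesis using that Ck_on_imp_continuous_on by blast
qed

locale Ck_manifold =
  fixes A :: "('a::{t2_space,second_countable_topology}, 'b::euclidean_space) chart set"
    and m :: nat
  assumes atlas: "Ck_atlas m A" and m_pos: "1 \<le> m"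
begin

lemma open_chart_dom: "\<kappa> \<in> A \<Longrightarrow> open (chart_dom \<kappa>)"
  and open_chart_image: "\<kappa> \<in> A \<Longrightarrow> open (chart_map \<kappa> ` chart_dom \<kappa>)"
  and chart_homeomorphism: "\<kappa> \<in> A \<Longrightarrow>
    homeomorphism (chart_dom \<kappa>) (chart_map \<kappa> ` chart_dom \<kappa>) (chart_map \<kappa>) (chart_inv \<kappa>)"
  and chart_cover: "(\<Union>\<kappa>\<in>A. chart_dom \<kappa>) = UNIV"
  and transition_Ck: "\<kappa> \<in> A \<Longrightarrow> \<kappa>' \<in> A \<Longrightarrow>
    Ck_on m (transition \<kappa> \<kappa>') (chart_map \<kappa> ` (chart_dom \<kappa> \<inter> chart_dom \<kappa>'))"
  using atlas unfolding Ck_atlas_def by auto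

lemma chart_inv_map [simp]: "\<kappa> \<in> A \<Longrightarrow> p \<in> chart_dom \<kappa> \<Longrightarrow> chart_inv \<kappa> (chart_map \<kappa> p) = p"
  using chart_homeomorphism by (auto simp: homeomorphism_def)

lemma chart_map_inv [simp]:
  "\<kappa> \<in> A \<Longrightarrow> y \<in> chart_map \<kappa> ` chart_dom \<kappa> \<Longrightarrow> chart_map \<kappa> (chart_inv \<kappa> y) = y"
  using chart_homeomorphism by (auto simp: homeomorphism_def)

lemma chart_inv_dom:
  "\<kappa> \<in> A \<Longrightarrow> y \<in> chart_map \<kappa> ` chart_dom \<kappa> \<Longrightarrow> chart_inv \<kappa> y \<in> chart_dom \<kappa>"
  by auto

lemma continuous_on_chart_map: "\<kappa> \<in> A \<Longrightarrow> continuous_on (chart_dom \<kappa>) (chart_map \<kappa>)"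
  and continuous_on_chart_inv:
    "\<kappa> \<in> A \<Longrightarrow> continuous_on (chart_map \<kappa> ` chart_dom \<kappa>) (chart_inv \<kappa>)"
  using chart_homeomorphism by (auto simp: homeomorphism_def)

lemma obtain_chart: obtains \<kappa> where "\<kappa> \<in> A" "p \<in> chart_dom \<kappa>"
  using chart_cover by blast

definition chart_ball :: "('a, 'b) chart \<Rightarrow> 'b \<Rightarrow> real \<Rightarrow> 'a set" where
  "chart_ball \<kappa> c R = {q \<in> chart_dom \<kappa>. chart_map \<kappa> q \<in> ball c R}"

lemma open_chart_preimage:
  assumes "\<kappa> \<in> A" "open S" shows "open {q \<in> chart_dom \<kappa>. chart_map \<kappa> q \<in> S}"
proof -
  have "open (chart_dom \<kappa> \<inter> chart_map \<kappa> -` S)"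
    using continuous_on_chart_map[OF assms(1)] open_chart_dom[OF assms(1)] assms(2)
    by (simp add: continuous_on_open_vimage Int_commute)
  moreover have "chart_dom \<kappa> \<inter> chart_map \<kappa> -` S = {q \<in> chart_dom \<kappa>. chart_map \<kappa> q \<in> S}" by auto
  ultimately show ?thesis by simp
qed

lemma open_chart_ball: "\<kappa> \<in> A \<Longrightarrow> open (chart_ball \<kappa> c R)"
  unfolding chart_ball_def by (rule open_chart_preimage) auto

lemma open_chart_map_image:
  assumes "\<kappa> \<in> A" "open V" shows "open (chart_map \<kappa> ` (chart_dom \<kappa> \<inter> V))"
proof -
  have "open (chart_map \<kappa> ` chart_dom \<kappa> \<inter> chart_inv \<kappa> -` V)"
    using continuous_on_chart_inv[OF assms(1)] open_chart_image[OF assms(1)] assms(2)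
    by (simp add: continuous_on_open_vimage Int_commute)
  moreover have "chart_map \<kappa> ` chart_dom \<kappa> \<inter> chart_inv \<kappa> -` V = chart_map \<kappa> ` (chart_dom \<kappa> \<inter> V)"
    using assms(1) by auto
  ultimately show ?thesis by simp
qed

lemma obtain_small_chart_cball:
  assumes "\<kappa> \<in> A" "p \<in> chart_dom \<kappa>" "open W" "p \<in> W"
  obtains R where "R > 0" "cball (chart_map \<kappa> p) R \<subseteq> chart_map \<kappa> ` (chart_dom \<kappa> \<inter> W)"
proof -
  have "chart_map \<kappa> p \<in> chart_map \<kappa> ` (chart_dom \<kappa> \<inter> W)" using assms(2,4) by blast
  then show ?thesis using open_chart_map_image[OF assms(1,3)] that open_contains_cball by blast
qed

lemma chart_preimage_compact:
  assumes "\<kappa> \<in> A" "compact Y" "Y \<subseteq> chart_map \<kappa> ` chart_dom \<kappa>"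
  shows "compact (chart_inv \<kappa> ` Y)"
  using assms continuous_on_chart_inv continuous_on_subset compact_continuous_image by blast

lemma chart_cball_preimage:
  assumes "\<kappa> \<in> A" "cball c R \<subseteq> chart_map \<kappa> ` chart_dom \<kappa>"
  shows "chart_inv \<kappa> ` cball c R = {q \<in> chart_dom \<kappa>. chart_map \<kappa> q \<in> cball c R}"
proof (intro equalityI subsetI)
  fix q assume "q \<in> {q \<in> chart_dom \<kappa>. chart_map \<kappa> q \<in> cball c R}"
  then show "q \<in> chart_inv \<kappa> ` cball c R"
    using assms(1) by (intro image_eqI[of _ _ "chart_map \<kappa> q"]) auto
next
  fix q assume "q \<in> chart_inv \<kappa> ` cball c R"
  then obtain y where "y \<in> cball c R" "q = chart_inv \<kappa> y" by blast
  then show "q \<in> {q \<in> chart_dom \<kappa>. chart_map \<kappa> q \<in> cball c R}"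
    using assms chart_inv_dom[OF assms(1)] chart_map_inv[OF assms(1)] by auto
qed

lemma transition_derivative:
  assumes "\<kappa> \<in> A" "\<kappa>' \<in> A" "p \<in> chart_dom \<kappa> \<inter> chart_dom \<kappa>'"
  shows "(transition \<kappa> \<kappa>' has_derivative trans_diff \<kappa> \<kappa>' p) (at (chart_map \<kappa> p))"
proof -
  obtain D where "\<And>x. x \<in> chart_map \<kappa> ` (chart_dom \<kappa> \<inter> chart_dom \<kappa>') \<Longrightarrow>
      (transition \<kappa> \<kappa>' has_derivative D x) (at x)"
    using Ck_on_obtain_derivative[OF transition_Ck[OF assms(1,2)] m_pos] by metis
  then have D: "(transition \<kappa> \<kappa>' has_derivative D (chart_map \<kappa> p)) (at (chart_map \<kappa> p))"
    using assms(3) by blast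
  then show ?thesis using frechet_derivative_at[OF D] by (simp add: trans_diff_def)
qed

text \<open>
  The derivative is taken within a set, so that the rule also covers the one-sided derivatives at
  the ends of a smooth piece of a curve.
\<close>

lemma velocity_change_of_chart:
  assumes "\<kappa> \<in> A" "\<kappa>' \<in> A" "\<gamma> t \<in> chart_dom \<kappa> \<inter> chart_dom \<kappa>'"
    and "continuous (at t within S) \<gamma>" "t \<in> S"
    and "((\<lambda>s. chart_map \<kappa> (\<gamma> s)) has_vector_derivative v) (at t within S)"
  shows "((\<lambda>s. chart_map \<kappa>' (\<gamma> s)) has_vector_derivative trans_diff \<kappa> \<kappa>' (\<gamma> t) v) (at t within S)"
proof -
  let ?T = "trans_diff \<kappa> \<kappa>' (\<gamma> t)"
  have T: "(transition \<kappa> \<kappa>' has_derivative ?T) (at (chart_map \<kappa> (\<gamma> t)))"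
    using transition_derivative assms by blast
  have lin: "?T (h *\<^sub>R v) = h *\<^sub>R ?T v" for h
    using has_derivative_linear[OF T] by (simp add: linear_scale)
  have "((\<lambda>s. transition \<kappa> \<kappa>' (chart_map \<kappa> (\<gamma> s))) has_derivative (\<lambda>h. h *\<^sub>R ?T v)) (at t within S)"
    using has_derivative_compose[OF assms(6)[unfolded has_vector_derivative_def] T]
    by (simp add: lin)
  moreover have "\<forall>\<^sub>F s in at t within S. \<gamma> s \<in> chart_dom \<kappa>"
    using assms(3,4) open_chart_dom[OF assms(1)] by (auto simp: continuous_within tendsto_def)
  then have "\<forall>\<^sub>F s in at t within S. transition \<kappa> \<kappa>' (chart_map \<kappa> (\<gamma> s)) = chart_map \<kappa>' (\<gamma> s)"
    by eventually_elim (use assms(1) in \<open>auto simp: transition_def\<close>)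
  ultimately have "((\<lambda>s. chart_map \<kappa>' (\<gamma> s)) has_derivative (\<lambda>h. h *\<^sub>R ?T v)) (at t within S)"
    by (rule has_derivative_transform_eventually)
       (use assms in \<open>auto simp: transition_def\<close>)
  then show ?thesis by (simp add: has_vector_derivative_def)
qed

end

section \<open>The Riemannian distance and the topology of the manifold\<close>

locale Riemannian_manifold = Ck_manifold A m
  for A :: "('a::{t2_space,second_countable_topology}, 'b::euclidean_space) chart set" and m +
  fixes k :: nat and g :: "('a, 'b) chart \<Rightarrow> 'a \<Rightarrow> 'b \<Rightarrow> 'b \<Rightarrow> real"
  assumes metric: "Ck_riemannian_metric k A g"
begin

lemma metric_bilinear: "\<kappa> \<in> A \<Longrightarrow> p \<in> chart_dom \<kappa> \<Longrightarrow> bilinear (g \<kappa> p)"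
  and metric_pos: "\<kappa> \<in> A \<Longrightarrow> p \<in> chart_dom \<kappa> \<Longrightarrow> v \<noteq> 0 \<Longrightarrow> 0 < g \<kappa> p v v"
  and metric_transform: "\<kappa> \<in> A \<Longrightarrow> \<kappa>' \<in> A \<Longrightarrow> p \<in> chart_dom \<kappa> \<inter> chart_dom \<kappa>' \<Longrightarrow>
        g \<kappa>' p (trans_diff \<kappa> \<kappa>' p v) (trans_diff \<kappa> \<kappa>' p w) = g \<kappa> p v w"
  and metric_Ck: "\<kappa> \<in> A \<Longrightarrow>
        Ck_on k (\<lambda>y. g \<kappa> (chart_inv \<kappa> y) v w) (chart_map \<kappa> ` chart_dom \<kappa>)"
  using metric unfolding Ck_riemannian_metric_def by auto

lemma metric_nonneg: "\<kappa> \<in> A \<Longrightarrow> p \<in> chart_dom \<kappa> \<Longrightarrow> 0 \<le> g \<kappa> p v v"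
  using metric_pos[of \<kappa> p v] metric_bilinear[of \<kappa> p] by (cases "v = 0") (auto simp: bilinear_lzero)

lemma metric_scale: "\<kappa> \<in> A \<Longrightarrow> p \<in> chart_dom \<kappa> \<Longrightarrow> g \<kappa> p (c *\<^sub>R v) (c *\<^sub>R v) = c\<^sup>2 * g \<kappa> p v v"
  using metric_bilinear[of \<kappa> p] by (simp add: bilinear_lmul bilinear_rmul power2_eq_square)

lemma continuous_on_metric:
  assumes "\<kappa> \<in> A" "continuous_on T y" "y ` T \<subseteq> chart_map \<kappa> ` chart_dom \<kappa>" "continuous_on T v"
  shows "continuous_on T (\<lambda>t. g \<kappa> (chart_inv \<kappa> (y t)) (v t) (v t))"
proof -
  have eq: "g \<kappa> (chart_inv \<kappa> (y t)) (v t) (v t) =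
      (\<Sum>i\<in>Basis. \<Sum>j\<in>Basis. (v t \<bullet> i) * (v t \<bullet> j) * g \<kappa> (chart_inv \<kappa> (y t)) i j)" if "t \<in> T" for t
  proof -
    have "chart_inv \<kappa> (y t) \<in> chart_dom \<kappa>" using assms(1,3) that by auto
    then have B: "bilinear (g \<kappa> (chart_inv \<kappa> (y t)))" using metric_bilinear assms(1) by blast
    have "g \<kappa> (chart_inv \<kappa> (y t)) (v t) (v t) = g \<kappa> (chart_inv \<kappa> (y t))
        (\<Sum>i\<in>Basis. (v t \<bullet> i) *\<^sub>R i) (\<Sum>j\<in>Basis. (v t \<bullet> j) *\<^sub>R j)"
      by (simp add: euclidean_representation)
    also have "\<dots> = (\<Sum>i\<in>Basis. \<Sum>j\<in>Basis. (v t \<bullet> i) * (v t \<bullet> j) * g \<kappa> (chart_inv \<kappa> (y t)) i j)"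
      by (subst bilinear_sum[OF B])
         (simp add: bilinear_lmul[OF B] bilinear_rmul[OF B] sum.cartesian_product ac_simps)
    finally show ?thesis .
  qed
  have "continuous_on T (\<lambda>t. g \<kappa> (chart_inv \<kappa> (y t)) i j)" for i j
    using continuous_on_compose2[OF Ck_on_imp_continuous_on[OF metric_Ck[OF assms(1)]] assms(2,3)] .
  then have "continuous_on T (\<lambda>t. \<Sum>i\<in>Basis. \<Sum>j\<in>Basis.
      (v t \<bullet> i) * (v t \<bullet> j) * g \<kappa> (chart_inv \<kappa> (y t)) i j)"
    using assms(4) by (intro continuous_intros) auto
  then show ?thesis using eq by (simp cong: continuous_on_cong)
qed

text \<open>
  By homogeneity it suffices to consider unit vectors, over which the square root of the metric is
  continuous and positive on a compact set.
\<close>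

lemma metric_comparable_to_norm:
  assumes "\<kappa> \<in> A" "compact Y" "Y \<subseteq> chart_map \<kappa> ` chart_dom \<kappa>"
  obtains c C where "c > 0"
    and "\<And>y v. y \<in> Y \<Longrightarrow> c * norm v \<le> sqrt (g \<kappa> (chart_inv \<kappa> y) v v)"
    and "\<And>y v. y \<in> Y \<Longrightarrow> sqrt (g \<kappa> (chart_inv \<kappa> y) v v) \<le> C * norm v"
proof (cases "Y = {}")
  case True
  then show ?thesis using that[of 1 1] by auto
next
  case False
  let ?X = "Y \<times> sphere (0::'b) 1"
  let ?q = "\<lambda>p. sqrt (g \<kappa> (chart_inv \<kappa> (fst p)) (snd p) (snd p))"
  have X: "compact ?X" using assms(2) by (intro compact_Times) auto
  have ne: "?X \<noteq> {}" using False by (auto simp: sphere_eq_empty)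
  have cont: "continuous_on ?X ?q"
    by (intro continuous_on_real_sqrt continuous_on_metric[OF assms(1)] continuous_on_fst
        continuous_on_snd continuous_on_id) (use assms(3) in auto)
  obtain u where u: "u \<in> ?X" "\<And>x. x \<in> ?X \<Longrightarrow> ?q u \<le> ?q x"
    using continuous_attains_inf[OF X ne cont] by blast
  obtain w where w: "w \<in> ?X" "\<And>x. x \<in> ?X \<Longrightarrow> ?q x \<le> ?q w"
    using continuous_attains_sup[OF X ne cont] by blast
  have dom: "chart_inv \<kappa> y \<in> chart_dom \<kappa>" if "y \<in> Y" for y using assms(1,3) that by auto
  have hom: "sqrt (g \<kappa> (chart_inv \<kappa> y) v v) = norm v * ?q (y, v /\<^sub>R norm v)"
    if "y \<in> Y" "v \<noteq> 0" for y v
    using that metric_scale[OF assms(1) dom[OF that(1)], of "norm v" "v /\<^sub>R norm v"]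
    by (simp add: real_sqrt_mult)
  show ?thesis
  proof (rule that[of "?q u" "?q w"])
    have "snd u \<noteq> 0" using u(1) by auto
    then show "?q u > 0" using u(1) metric_pos[OF assms(1) dom] by auto
  next
    fix y v assume y: "y \<in> Y"
    show "?q u * norm v \<le> sqrt (g \<kappa> (chart_inv \<kappa> y) v v)"
    proof (cases "v = 0")
      case True
      then show ?thesis using metric_nonneg[OF assms(1) dom[OF y]] by auto
    next
      case False
      then have "?q u \<le> ?q (y, v /\<^sub>R norm v)" using y by (intro u(2)) auto
      then show ?thesis using hom[OF y False] False by (simp add: mult.commute mult_left_mono)
    qed
  next
    fix y v assume y: "y \<in> Y"
    show "sqrt (g \<kappa> (chart_inv \<kappa> y) v v) \<le> ?q w * norm v"
    proof (cases "v = 0")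
      case True
      then show ?thesis using metric_bilinear[OF assms(1) dom[OF y]] by (simp add: bilinear_lzero)
    next
      case False
      then have "?q (y, v /\<^sub>R norm v) \<le> ?q w" using y by (intro w(2)) auto
      then show ?thesis using hom[OF y False] False by (simp add: mult.commute mult_left_mono)
    qed
  qed
qed

lemma speed_chart_independent:
  assumes "\<kappa> \<in> A" "\<kappa>' \<in> A" "\<gamma> t \<in> chart_dom \<kappa> \<inter> chart_dom \<kappa>'"
    and "continuous (at t within {a..b}) \<gamma>" "t \<in> {a..b}" "a < b"
    and "((\<lambda>s. chart_map \<kappa> (\<gamma> s)) has_vector_derivative v) (at t within {a..b})"
    and "((\<lambda>s. chart_map \<kappa>' (\<gamma> s)) has_vector_derivative v') (at t within {a..b})"
  shows "g \<kappa> (\<gamma> t) v v = g \<kappa>' (\<gamma> t) v' v'"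
proof -
  have "v' = trans_diff \<kappa> \<kappa>' (\<gamma> t) v"
    using vector_derivative_within_cbox[of a b t, unfolded cbox_interval, OF assms(6,5)]
      velocity_change_of_chart[OF assms(1-5,7)] assms(8) by metis
  then show ?thesis using metric_transform assms(1-3) by simp
qed

definition some_chart :: "'a \<Rightarrow> ('a, 'b) chart" where
  "some_chart p = (SOME \<kappa>. \<kappa> \<in> A \<and> p \<in> chart_dom \<kappa>)"

lemma some_chart: "some_chart p \<in> A" "p \<in> chart_dom (some_chart p)"
proof -
  have "\<exists>\<kappa>. \<kappa> \<in> A \<and> p \<in> chart_dom \<kappa>" using obtain_chart[of p] by metis
  from someI_ex[OF this] show "some_chart p \<in> A" "p \<in> chart_dom (some_chart p)"
    unfolding some_chart_def by auto
qed

lemma speed_eq_some_chart: "speed A g \<gamma> t =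
  (let v = vector_derivative (\<lambda>s. chart_map (some_chart (\<gamma> t)) (\<gamma> s)) (at t)
   in sqrt (g (some_chart (\<gamma> t)) (\<gamma> t) v v))"
  unfolding speed_def some_chart_def Let_def by simp

lemma speed_nonneg: "0 \<le> speed A g \<gamma> t"
  unfolding speed_eq_some_chart Let_def using metric_nonneg some_chart by simp

lemma speed_in_chart:
  assumes "\<kappa> \<in> A" "\<gamma> t \<in> chart_dom \<kappa>" "isCont \<gamma> t"
    and "((\<lambda>s. chart_map \<kappa> (\<gamma> s)) has_vector_derivative v) (at t)"
  shows "speed A g \<gamma> t = sqrt (g \<kappa> (\<gamma> t) v v)"
proof -
  let ?c = "some_chart (\<gamma> t)"
  have "((\<lambda>s. chart_map ?c (\<gamma> s)) has_vector_derivative trans_diff \<kappa> ?c (\<gamma> t) v) (at t)"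
    using velocity_change_of_chart[of \<kappa> ?c \<gamma> t UNIV v] assms some_chart by auto
  then have "vector_derivative (\<lambda>s. chart_map ?c (\<gamma> s)) (at t) = trans_diff \<kappa> ?c (\<gamma> t) v"
    by (rule vector_derivative_at)
  then show ?thesis
    unfolding speed_eq_some_chart Let_def using metric_transform assms(1,2) some_chart by simp
qed

end

context Riemannian_manifold begin

text \<open>
  The extension uses the one-sided derivatives at the ends. It bounds the speed near the break
  points, which makes the speed integrable; otherwise the length of a curve, an integral with
  default value \<open>0\<close>, would carry no information.
\<close>

lemma C1_curve_speed_continuous_extension:
  assumes "C1_curve A \<gamma> a b" "a < b"
  obtains \<sigma> where "continuous_on {a..b} \<sigma>" "\<And>t. t \<in> {a<..<b} \<Longrightarrow> speed A g \<gamma> t = \<sigma> t"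
proof -
  have cont: "continuous_on {a..b} \<gamma>" using assms(1) by (simp add: C1_curve_def)
  then have contw: "continuous (at t within {a..b}) \<gamma>" if "t \<in> {a..b}" for t
    using that by (simp add: continuous_on_eq_continuous_within)
  obtain v where vc: "\<And>\<kappa>. \<kappa> \<in> A \<Longrightarrow> continuous_on {t\<in>{a..b}. \<gamma> t \<in> chart_dom \<kappa>} (v \<kappa>)"
    and vd: "\<And>\<kappa> t. \<kappa> \<in> A \<Longrightarrow> t \<in> {a..b} \<Longrightarrow> \<gamma> t \<in> chart_dom \<kappa> \<Longrightarrow>
      ((\<lambda>s. chart_map \<kappa> (\<gamma> s)) has_vector_derivative v \<kappa> t) (at t within {a..b})"
  proof -
    have "\<forall>\<kappa>\<in>A. \<exists>v. continuous_on {t\<in>{a..b}. \<gamma> t \<in> chart_dom \<kappa>} v \<and>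
        (\<forall>t\<in>{a..b}. \<gamma> t \<in> chart_dom \<kappa> \<longrightarrow>
           ((\<lambda>s. chart_map \<kappa> (\<gamma> s)) has_vector_derivative v t) (at t within {a..b}))"
      using assms(1) by (simp add: C1_curve_def)
    from bchoice[OF this] show ?thesis using that by blast
  qed
  \<comment> \<open>By \<open>speed_chart_independent\<close>, near any time \<open>\<sigma>\<close> can be computed in one fixed chart.\<close>
  define \<sigma> where "\<sigma> t = (let \<kappa> = some_chart (\<gamma> t) in sqrt (g \<kappa> (\<gamma> t) (v \<kappa> t) (v \<kappa> t)))" for t
  have \<sigma>: "\<sigma> t = sqrt (g \<kappa> (\<gamma> t) (v \<kappa> t) (v \<kappa> t))"
    if "\<kappa> \<in> A" "t \<in> {a..b}" "\<gamma> t \<in> chart_dom \<kappa>" for \<kappa> t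
  proof -
    let ?k = "some_chart (\<gamma> t)"
    have "g ?k (\<gamma> t) (v ?k t) (v ?k t) = g \<kappa> (\<gamma> t) (v \<kappa> t) (v \<kappa> t)"
    proof (rule speed_chart_independent[where \<gamma> = \<gamma> and t = t and a = a and b = b])
      show "?k \<in> A" by (rule some_chart)
      show "\<kappa> \<in> A" by fact
      show "\<gamma> t \<in> chart_dom ?k \<inter> chart_dom \<kappa>" using some_chart(2) that(3) by simp
      show "continuous (at t within {a..b}) \<gamma>" using contw[OF that(2)] .
      show "t \<in> {a..b}" "a < b" by fact+
      show "((\<lambda>s. chart_map ?k (\<gamma> s)) has_vector_derivative v ?k t) (at t within {a..b})"
        by (rule vd) (use some_chart that in auto)
      show "((\<lambda>s. chart_map \<kappa> (\<gamma> s)) has_vector_derivative v \<kappa> t) (at t within {a..b})"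
        by (rule vd) (use that in auto)
    qed
    then show ?thesis by (simp add: \<sigma>_def Let_def)
  qed
  show ?thesis
  proof
    show "continuous_on {a..b} \<sigma>"
      unfolding continuous_on_eq_continuous_within
    proof
      fix t assume t: "t \<in> {a..b}"
      let ?k = "some_chart (\<gamma> t)" and ?S = "\<lambda>\<kappa>. {t\<in>{a..b}. \<gamma> t \<in> chart_dom \<kappa>}"
      have "openin (top_of_set {a..b}) ({a..b} \<inter> \<gamma> -` chart_dom ?k)"
        by (rule continuous_openin_preimage_gen[OF cont open_chart_dom[OF some_chart(1)]])
      then obtain U where U: "open U" "{a..b} \<inter> \<gamma> -` chart_dom ?k = {a..b} \<inter> U"
        unfolding openin_open by metis
      have "?S ?k = {a..b} \<inter> \<gamma> -` chart_dom ?k" by blast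
      then have S: "?S ?k = {a..b} \<inter> U" using U(2) by simp
      have "continuous_on (?S ?k) (\<lambda>s. chart_map ?k (\<gamma> s))"
        by (rule continuous_on_compose2[where f = \<gamma> and g = "chart_map ?k",
              OF continuous_on_chart_map[OF some_chart(1)] continuous_on_subset[OF cont]]) auto
      then have "continuous_on (?S ?k)
          (\<lambda>s. sqrt (g ?k (chart_inv ?k (chart_map ?k (\<gamma> s))) (v ?k s) (v ?k s)))"
        by (intro continuous_on_real_sqrt
            continuous_on_metric[OF some_chart(1) _ _ vc[OF some_chart(1)]]) auto
      also have "?this \<longleftrightarrow> continuous_on (?S ?k) \<sigma>"
        by (rule continuous_on_cong) (auto simp: \<sigma>[OF some_chart(1)] some_chart(1))
      finally have "continuous_on (?S ?k) \<sigma>" .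
      moreover have "t \<in> ?S ?k" using t some_chart(2) by auto
      ultimately have "continuous (at t within ?S ?k) \<sigma>"
        by (simp add: continuous_on_eq_continuous_within)
      moreover have "at t within ?S ?k = at t within {a..b}"
        unfolding S using t some_chart(2) U by (intro at_within_nhd[of t U]) auto
      ultimately show "continuous (at t within {a..b}) \<sigma>" by simp
    qed
  next
    fix t assume t: "t \<in> {a<..<b}"
    let ?k = "some_chart (\<gamma> t)"
    have at: "at t within {a..b} = at t" using t by (simp add: at_within_Icc_at)
    have "((\<lambda>s. chart_map ?k (\<gamma> s)) has_vector_derivative v ?k t) (at t)"
      using vd[OF some_chart(1) _ some_chart(2), of t] t by (simp add: at)
    moreover have "isCont \<gamma> t" using contw[of t] t by (simp add: at)
    ultimately show "speed A g \<gamma> t = \<sigma> t"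
      using speed_in_chart[where \<gamma> = \<gamma> and t = t, OF some_chart] by (simp add: \<sigma>_def Let_def)
  qed
qed

definition partition_points :: "(real \<Rightarrow> 'a) \<Rightarrow> nat \<Rightarrow> (nat \<Rightarrow> real) \<Rightarrow> bool" where
  "partition_points \<gamma> n p \<longleftrightarrow>
     p 0 = 0 \<and> p n = 1 \<and> (\<forall>i<n. p i < p (Suc i) \<and> C1_curve A \<gamma> (p i) (p (Suc i)))"

lemma piecewise_C1_curve_iff: "piecewise_C1_curve A \<gamma> \<longleftrightarrow> (\<exists>n p. partition_points \<gamma> n p)"
  by (simp add: piecewise_C1_curve_def partition_points_def)

lemma partition_points_mono:
  assumes "partition_points \<gamma> n p" "i \<le> j" "j \<le> n" shows "p i \<le> p j"
  using assms(2,3)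
proof (induction j rule: dec_induct)
  case (step j)
  then show ?case using assms(1) unfolding partition_points_def
    by (meson Suc_le_lessD less_imp_le order_trans Suc_leD)
qed simp

lemma partition_points_induct:
  assumes "partition_points \<gamma> n p" "P {0..0}"
    and "\<And>a b. 0 \<le> a \<Longrightarrow> a < b \<Longrightarrow> b \<le> 1 \<Longrightarrow> C1_curve A \<gamma> a b \<Longrightarrow> P {0..a} \<Longrightarrow> P {0..b}"
  shows "P {0..1::real}"
proof -
  have "P {0..p i}" if "i \<le> n" for i
    using that
  proof (induction i)
    case 0
    then show ?case using assms(1,2) by (simp add: partition_points_def)
  next
    case (Suc i)
    have "0 \<le> p i" "p (Suc i) \<le> 1"
      using partition_points_mono[OF assms(1), of 0 i] partition_points_mono[OF assms(1), of "Suc i" n]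
        assms(1) Suc.prems by (auto simp: partition_points_def)
    then show ?case
      using assms(3)[of "p i" "p (Suc i)"] Suc assms(1) by (auto simp: partition_points_def)
  qed
  from this[of n] show ?thesis using assms(1) by (simp add: partition_points_def)
qed

lemma piecewise_C1_curve_continuous:
  assumes "partition_points \<gamma> n p" shows "continuous_on {0..1} \<gamma>"
  using assms
proof (rule partition_points_induct[where P = "\<lambda>S. continuous_on S \<gamma>"])
  fix a b :: real assume ab: "0 \<le> a" "a < b" "C1_curve A \<gamma> a b" "continuous_on {0..a} \<gamma>"
  have "continuous_on ({0..a} \<union> {a..b}) \<gamma>"
    using ab by (intro continuous_on_closed_Un) (auto simp: C1_curve_def)
  then show "continuous_on {0..b} \<gamma>" using ab by (simp add: ivl_disj_un_two_touch)
qed simp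

lemma speed_integrable:
  assumes "partition_points \<gamma> n p" shows "speed A g \<gamma> integrable_on {0..1}"
  using assms
proof (rule partition_points_induct[where P = "\<lambda>S. speed A g \<gamma> integrable_on S"])
  fix a b :: real assume ab: "0 \<le> a" "a < b" "C1_curve A \<gamma> a b" "speed A g \<gamma> integrable_on {0..a}"
  obtain \<sigma> where \<sigma>: "continuous_on {a..b} \<sigma>" "\<And>t. t \<in> {a<..<b} \<Longrightarrow> speed A g \<gamma> t = \<sigma> t"
    using C1_curve_speed_continuous_extension[OF ab(3,2)] by blast
  have piece: "speed A g \<gamma> integrable_on {a..b}"
    by (rule integrable_spike_finite[OF _ _ integrable_continuous_real[OF \<sigma>(1)], of "{a, b}"])
       (use \<sigma>(2) in auto)
  show "speed A g \<gamma> integrable_on {0..b}"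
    by (rule Henstock_Kurzweil_Integration.integrable_combine[OF ab(1) _ ab(4) piece])
      (use ab(2) in simp)
qed (use has_integral_refl(2) in \<open>auto simp: integrable_on_def\<close>)

text \<open>
  The first partition point to the right of \<open>t\<close> ends the piece.
\<close>

lemma obtain_piece:
  assumes "partition_points \<gamma> n p" "t \<in> {0..1} - p ` {..n}"
  obtains i where "i < n" "p i < t" "t < p (Suc i)"
proof -
  define i where "i = (LEAST j. t < p j)"
  have n: "t < p n" using assms by (auto simp: partition_points_def less_le)
  then have i: "t < p i" "i \<le> n" unfolding i_def by (auto intro: LeastI Least_le)
  have "i \<noteq> 0" using i(1) assms by (auto simp: partition_points_def intro!: notI)
  then obtain j where j: "i = Suc j" by (cases i) auto
  then have "\<not> t < p j" using not_less_Least[of j "\<lambda>j. t < p j"] by (simp add: i_def)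
  moreover have "t \<noteq> p j" using assms(2) i(2) j by auto
  ultimately show ?thesis using that[of j] i j by auto
qed

lemma velocity_at_smooth_point:
  assumes "partition_points \<gamma> n p" "t \<in> {0..1} - p ` {..n}" "\<kappa> \<in> A" "\<gamma> t \<in> chart_dom \<kappa>"
  obtains v where "((\<lambda>s. chart_map \<kappa> (\<gamma> s)) has_vector_derivative v) (at t)"
    and "speed A g \<gamma> t = sqrt (g \<kappa> (\<gamma> t) v v)"
proof -
  obtain i where i: "i < n" "p i < t" "t < p (Suc i)" using obtain_piece[OF assms(1,2)] by blast
  then have C: "C1_curve A \<gamma> (p i) (p (Suc i))" using assms(1) by (simp add: partition_points_def)
  have at: "at t within {p i..p (Suc i)} = at t" using i by (simp add: at_within_Icc_at)
  have "\<exists>v. ((\<lambda>s. chart_map \<kappa> (\<gamma> s)) has_vector_derivative v) (at t within {p i..p (Suc i)})"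
    using C assms(3,4) i unfolding C1_curve_def by (meson atLeastAtMost_iff less_imp_le)
  then obtain v where v: "((\<lambda>s. chart_map \<kappa> (\<gamma> s)) has_vector_derivative v) (at t)"
    by (auto simp: at)
  have "continuous (at t within {p i..p (Suc i)}) \<gamma>"
    using C i by (simp add: C1_curve_def continuous_on_eq_continuous_within)
  then have "isCont \<gamma> t" by (simp add: at)
  then show ?thesis using that v speed_in_chart[where \<gamma> = \<gamma> and t = t, OF assms(3,4)] by blast
qed

text \<open>
  The fundamental theorem of calculus for the coordinates of the curve, with the finitely many
  break points as exceptional set.
\<close>

lemma curve_length_ge_in_chart:
  assumes curve: "partition_points \<gamma> n p" and "\<kappa> \<in> A" "0 \<le> s" "s \<le> 1"
    and inside: "\<And>t. t \<in> {0..s} \<Longrightarrow> \<gamma> t \<in> chart_dom \<kappa>" and "c > 0"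
    and lower: "\<And>t v. t \<in> {0..s} \<Longrightarrow> c * norm v \<le> sqrt (g \<kappa> (\<gamma> t) v v)"
  shows "c * dist (chart_map \<kappa> (\<gamma> 0)) (chart_map \<kappa> (\<gamma> s)) \<le> curve_length A g \<gamma>"
proof -
  let ?x = "\<lambda>t. chart_map \<kappa> (\<gamma> t)" and ?P = "p ` {..n}"
  have "\<exists>v. (?x has_vector_derivative v) (at t) \<and> c * norm v \<le> speed A g \<gamma> t"
    if "t \<in> {0<..<s} - ?P" for t
  proof -
    have t: "t \<in> {0..1} - ?P" "t \<in> {0..s}" using that assms(4) by auto
    obtain v where "((\<lambda>s. chart_map \<kappa> (\<gamma> s)) has_vector_derivative v) (at t)"
      "speed A g \<gamma> t = sqrt (g \<kappa> (\<gamma> t) v v)"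
      using velocity_at_smooth_point[OF curve t(1) assms(2) inside[OF t(2)]] by blast
    then show ?thesis using lower[OF t(2)] by auto
  qed
  then obtain v where v: "\<And>t. t \<in> {0<..<s} - ?P \<Longrightarrow>
      (?x has_vector_derivative v t) (at t) \<and> c * norm (v t) \<le> speed A g \<gamma> t"
    by metis
  \<comment> \<open>The value \<open>0\<close> at the exceptional points makes the bound by the speed hold everywhere.\<close>
  define w where "w t = (if t \<in> {0<..<s} - ?P then v t else 0)" for t
  have w: "norm (w t) \<le> speed A g \<gamma> t / c" for t
    using v[of t] speed_nonneg[of \<gamma> t] \<open>c > 0\<close> by (auto simp: w_def field_simps)
  have "continuous_on {0..s} \<gamma>"
    by (rule continuous_on_subset[OF piecewise_C1_curve_continuous[OF curve]]) (use assms(4) in auto)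
  then have "continuous_on {0..s} ?x"
    by (rule continuous_on_compose2[OF continuous_on_chart_map[OF assms(2)]]) (use inside in auto)
  then have ftc: "(w has_integral (?x s - ?x 0)) {0..s}"
    using v by (intro fundamental_theorem_of_calculus_interior_strong[of ?P])
      (auto simp: w_def \<open>0 \<le> s\<close>)
  have int: "speed A g \<gamma> integrable_on {0..s}"
    by (rule integrable_on_subinterval[OF speed_integrable[OF curve]]) (use assms(4) in auto)
  have "norm (?x s - ?x 0) \<le> integral {0..s} (\<lambda>t. speed A g \<gamma> t / c)"
    using integral_norm_bound_integral[OF has_integral_integrable[OF ftc]
        integrable_on_divide[OF int, of c] w] integral_unique[OF ftc] by simp
  also have "\<dots> = integral {0..s} (speed A g \<gamma>) / c" by simp
  also have "\<dots> \<le> integral {0..1} (speed A g \<gamma>) / c"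
    using \<open>c > 0\<close> speed_nonneg assms(4) int speed_integrable[OF curve]
    by (intro divide_right_mono integral_subset_le) auto
  finally show ?thesis
    using \<open>c > 0\<close> by (simp add: curve_length_def dist_norm norm_minus_commute field_simps)
qed

text \<open>
  Up to its first exit from the ball the curve stays in the chart, where it covers a coordinate
  distance of at least \<open>R / 2\<close>.
\<close>

lemma curve_length_ge_exit:
  assumes curve: "partition_points \<gamma> n p" and "\<kappa> \<in> A"
    and ball: "cball c R \<subseteq> chart_map \<kappa> ` chart_dom \<kappa>"
    and "a > 0" "\<And>y v. y \<in> cball c R \<Longrightarrow> a * norm v \<le> sqrt (g \<kappa> (chart_inv \<kappa> y) v v)"
    and start: "\<gamma> 0 \<in> chart_ball \<kappa> c (R / 2)" and finish: "\<gamma> 1 \<notin> chart_ball \<kappa> c R"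
  shows "a * (R / 2) \<le> curve_length A g \<gamma>"
proof -
  let ?B = "chart_ball \<kappa> c R" and ?K = "chart_inv \<kappa> ` cball c R"
  have cont: "continuous_on {0..1} \<gamma>" using piecewise_C1_curve_continuous[OF curve] .
  have "compact ({0..1} \<inter> \<gamma> -` (- ?B))"
    using continuous_closed_preimage[OF cont] open_chart_ball[OF assms(2)]
    by (simp add: compact_eq_bounded_closed closed_Compl bounded_Int)
  moreover have "1 \<in> {0..1} \<inter> \<gamma> -` (- ?B)" using finish by simp
  then have "{0..1} \<inter> \<gamma> -` (- ?B) \<noteq> {}" by blast
  ultimately obtain s where s': "s \<in> {0..1} \<inter> \<gamma> -` (- ?B)"
    and min: "\<forall>t \<in> {0..1} \<inter> \<gamma> -` (- ?B). s \<le> t"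
    using compact_attains_inf by metis
  then have s: "s \<in> {0..1}" "\<gamma> s \<notin> ?B" by simp_all
  have first: "s \<le> t" if "t \<in> {0..1}" "\<gamma> t \<notin> ?B" for t using min that by simp
  have K: "?K = {q \<in> chart_dom \<kappa>. chart_map \<kappa> q \<in> cball c R}"
    by (rule chart_cball_preimage[OF assms(2) ball])
  have d0: "\<gamma> 0 \<in> chart_dom \<kappa>" "dist c (chart_map \<kappa> (\<gamma> 0)) < R / 2"
    using start by (simp_all add: chart_ball_def)
  then have R: "R > 0" using zero_le_dist[of c "chart_map \<kappa> (\<gamma> 0)"] by linarith
  then have "\<gamma> 0 \<in> ?B" using d0 by (simp add: chart_ball_def)
  then have s0: "0 < s" using s by (cases "s = 0") auto
  have before: "\<gamma> t \<in> ?K" if "t \<in> {0..<s}" for t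
    using first[of t] that s(1) unfolding K by (force simp: chart_ball_def)
  \<comment> \<open>The exit point lies on the sphere, which is still in the chart: the compact set \<open>?K\<close> is closed in
    the manifold and contains the curve before time \<open>s\<close>.\<close>
  have "closed ({0..s} \<inter> \<gamma> -` ?K)"
    using s(1) compact_imp_closed[OF chart_preimage_compact[OF assms(2) compact_cball ball]]
    by (intro continuous_closed_preimage continuous_on_subset[OF cont]) auto
  then have "closure {0..<s} \<subseteq> {0..s} \<inter> \<gamma> -` ?K"
    using before by (intro closure_minimal) auto
  then have inK: "\<gamma> t \<in> ?K" if "t \<in> {0..s}" for t using that s0 by auto
  have "a * dist (chart_map \<kappa> (\<gamma> 0)) (chart_map \<kappa> (\<gamma> s)) \<le> curve_length A g \<gamma>"
  proof (rule curve_length_ge_in_chart[OF curve assms(2) _ _ _ \<open>a > 0\<close>])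
    fix t v assume t: "t \<in> {0..s}"
    show "\<gamma> t \<in> chart_dom \<kappa>" using inK[OF t] K by auto
    show "a * norm v \<le> sqrt (g \<kappa> (\<gamma> t) v v)"
      using assms(5)[of "chart_map \<kappa> (\<gamma> t)" v] inK[OF t] K assms(2) by auto
  qed (use s in auto)
  moreover have "R / 2 \<le> dist (chart_map \<kappa> (\<gamma> 0)) (chart_map \<kappa> (\<gamma> s))"
  proof -
    have "dist c (chart_map \<kappa> (\<gamma> s)) \<ge> R" "dist c (chart_map \<kappa> (\<gamma> 0)) < R / 2"
      using s(2) inK[of s] s0 K start by (auto simp: chart_ball_def)
    then show ?thesis using dist_triangle[of c "chart_map \<kappa> (\<gamma> s)" "chart_map \<kappa> (\<gamma> 0)"] by simp
  qed
  ultimately show ?thesis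
    using \<open>a > 0\<close> by (meson mult_left_mono less_imp_le order_trans)
qed

text \<open>
  A curve from \<open>V\<close> to a point outside \<open>W\<close> has to leave a coordinate ball that is contained in \<open>W\<close>.
\<close>

lemma riemannian_dist_separates_locally:
  assumes "open W" "p \<in> W"
  obtains V d where "open V" "p \<in> V" "V \<subseteq> W" "d > 0"
    "\<And>x y. x \<in> V \<Longrightarrow> y \<notin> W \<Longrightarrow> ennreal d < riemannian_dist A g x y"
proof -
  obtain \<kappa> where \<kappa>: "\<kappa> \<in> A" "p \<in> chart_dom \<kappa>" using obtain_chart .
  let ?c = "chart_map \<kappa> p"
  obtain R where R: "R > 0" "cball ?c R \<subseteq> chart_map \<kappa> ` (chart_dom \<kappa> \<inter> W)"
    using obtain_small_chart_cball[OF \<kappa> assms] .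
  then have ball: "cball ?c R \<subseteq> chart_map \<kappa> ` chart_dom \<kappa>" by auto
  obtain a where a: "a > 0"
    "\<And>y v. y \<in> cball ?c R \<Longrightarrow> a * norm v \<le> sqrt (g \<kappa> (chart_inv \<kappa> y) v v)"
    using metric_comparable_to_norm[OF \<kappa>(1) compact_cball ball] by metis
  have W: "chart_ball \<kappa> ?c r \<subseteq> W" if "r \<le> R" for r
  proof
    fix q assume q: "q \<in> chart_ball \<kappa> ?c r"
    then have "chart_map \<kappa> q \<in> chart_map \<kappa> ` (chart_dom \<kappa> \<inter> W)"
      using R(2) that by (auto simp: chart_ball_def)
    then show "q \<in> W" using q \<kappa>(1) by (auto simp: chart_ball_def) (metis chart_inv_map)
  qed
  show ?thesis
  proof (rule that[of "chart_ball \<kappa> ?c (R / 2)" "a * (R / 4)"])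
    show "open (chart_ball \<kappa> ?c (R / 2))" using open_chart_ball \<kappa>(1) .
    show "p \<in> chart_ball \<kappa> ?c (R / 2)" using \<kappa>(2) R(1) by (simp add: chart_ball_def)
    show "chart_ball \<kappa> ?c (R / 2) \<subseteq> W" using W R(1) by simp
    show "a * (R / 4) > 0" using a R by simp
    fix x y assume x: "x \<in> chart_ball \<kappa> ?c (R / 2)" and y: "y \<notin> W"
    have "a * (R / 2) \<le> curve_length A g \<gamma>" if curve: "piecewise_C1_curve A \<gamma>" "\<gamma> 0 = x" "\<gamma> 1 = y" for \<gamma>
    proof -
      obtain n q where part: "partition_points \<gamma> n q"
        using curve(1) unfolding piecewise_C1_curve_iff by blast
      have start: "\<gamma> 0 \<in> chart_ball \<kappa> ?c (R / 2)" unfolding curve(2) by (rule x)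
      have finish: "\<gamma> 1 \<notin> chart_ball \<kappa> ?c R" unfolding curve(3) using y W[OF order_refl] by blast
      show ?thesis
        by (rule curve_length_ge_exit[OF part \<kappa>(1) ball a(1) _ start finish]) (rule a(2))
    qed
    then have "ennreal (a * (R / 2)) \<le> riemannian_dist A g x y"
      unfolding riemannian_dist_def by (auto intro!: INF_greatest ennreal_leI)
    moreover have "ennreal (a * (R / 4)) < ennreal (a * (R / 2))"
      using a R by (intro ennreal_lessI) auto
    ultimately show "ennreal (a * (R / 4)) < riemannian_dist A g x y" by (simp add: order_less_le_trans)
  qed
qed

lemma C1_curve_chart_segment:
  assumes "\<kappa> \<in> A" "closed_segment a b \<subseteq> chart_map \<kappa> ` chart_dom \<kappa>"
  defines "\<gamma> \<equiv> \<lambda>t. chart_inv \<kappa> ((1 - t) *\<^sub>R a + t *\<^sub>R b)"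
  shows "C1_curve A \<gamma> 0 1"
    and "t \<in> {0..1} \<Longrightarrow> speed A g \<gamma> t = sqrt (g \<kappa> (\<gamma> t) (b - a) (b - a))"
proof -
  let ?l = "\<lambda>t. (1 - t) *\<^sub>R a + t *\<^sub>R b"
  have l: "?l t \<in> chart_map \<kappa> ` chart_dom \<kappa>" if "t \<in> {0..1}" for t
    using assms(2) that by (auto simp: closed_segment_def)
  have ld: "(?l has_vector_derivative (b - a)) (at t within S)" for t S
    by (auto intro!: derivative_eq_intros simp: has_vector_derivative_def algebra_simps)
  have lc: "continuous_on S ?l" for S by (intro continuous_intros)
  have cont: "continuous_on {0..1} \<gamma>" unfolding \<gamma>_def
    by (rule continuous_on_compose2[OF continuous_on_chart_inv[OF assms(1)] lc]) (use l in auto)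
  have isCont: "isCont \<gamma> t" if "t \<in> {0..1}" for t
  proof -
    have "isCont (chart_inv \<kappa>) (?l t)"
      using continuous_on_chart_inv[OF assms(1)] open_chart_image[OF assms(1)] l[OF that]
        continuous_on_eq_continuous_at by blast
    moreover have "isCont ?l t" by (intro continuous_intros)
    ultimately show ?thesis unfolding \<gamma>_def by (rule isCont_o2[rotated])
  qed
  show "C1_curve A \<gamma> 0 1"
    unfolding C1_curve_def
  proof (intro conjI cont ballI)
    fix \<kappa>' assume \<kappa>': "\<kappa>' \<in> A"
    let ?D = "chart_map \<kappa> ` (chart_dom \<kappa> \<inter> chart_dom \<kappa>')"
    obtain D where D: "\<And>x. x \<in> ?D \<Longrightarrow> (transition \<kappa> \<kappa>' has_derivative D x) (at x)"
      and Dc: "\<And>v. continuous_on ?D (\<lambda>x. D x v)"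
      using Ck_on_obtain_derivative[OF transition_Ck[OF assms(1) \<kappa>'] m_pos] by blast
    have in_D: "?l t \<in> ?D" if "t \<in> {0..1}" "\<gamma> t \<in> chart_dom \<kappa>'" for t
    proof -
      have "?l t = chart_map \<kappa> (\<gamma> t)" using l[OF that(1)] assms(1) by (simp add: \<gamma>_def)
      moreover have "\<gamma> t \<in> chart_dom \<kappa>" using l[OF that(1)] assms(1) chart_inv_dom by (simp add: \<gamma>_def)
      ultimately show ?thesis using that(2) by blast
    qed
    show "\<exists>v. continuous_on {t \<in> {0..1}. \<gamma> t \<in> chart_dom \<kappa>'} v \<and>
        (\<forall>t\<in>{0..1}. \<gamma> t \<in> chart_dom \<kappa>' \<longrightarrow>
          ((\<lambda>s. chart_map \<kappa>' (\<gamma> s)) has_vector_derivative v t) (at t within {0..1}))"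
    proof (intro exI[of _ "\<lambda>t. D (?l t) (b - a)"] conjI ballI impI)
      show "continuous_on {t \<in> {0..1}. \<gamma> t \<in> chart_dom \<kappa>'} (\<lambda>t. D (?l t) (b - a))"
        by (rule continuous_on_compose2[OF Dc lc]) (use in_D in auto)
    next
      fix t :: real assume t: "t \<in> {0..1}" "\<gamma> t \<in> chart_dom \<kappa>'"
      have "(transition \<kappa> \<kappa>' \<circ> ?l has_vector_derivative D (?l t) (b - a)) (at t within {0..1})"
        by (rule vector_derivative_diff_chain_within[OF ld has_derivative_at_withinI[OF D[OF in_D[OF t]]]])
      then show "((\<lambda>s. chart_map \<kappa>' (\<gamma> s)) has_vector_derivative D (?l t) (b - a)) (at t within {0..1})"
        by (simp add: transition_def \<gamma>_def o_def)
    qed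
  qed
  assume t: "t \<in> {0..1}"
  have dom: "\<gamma> t \<in> chart_dom \<kappa>" using l[OF t] assms(1) chart_inv_dom by (simp add: \<gamma>_def)
  have "((\<lambda>s. chart_map \<kappa> (\<gamma> s)) has_vector_derivative (b - a)) (at t)"
  proof (rule has_vector_derivative_transform_within_open[OF ld])
    show "open (?l -` (chart_map \<kappa> ` chart_dom \<kappa>))"
      using open_chart_image[OF assms(1)] lc by (simp add: continuous_on_open_vimage open_vimage)
  qed (use l[OF t] assms(1) in \<open>auto simp: \<gamma>_def\<close>)
  from speed_in_chart[where \<gamma> = \<gamma> and t = t, OF assms(1) dom isCont[OF t] this]
  show "speed A g \<gamma> t = sqrt (g \<kappa> (\<gamma> t) (b - a) (b - a))" .
qed

lemma riemannian_dist_locally_small: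
  assumes "e > 0"
  obtains U where "open U" "p \<in> U"
    "\<And>x y. x \<in> U \<Longrightarrow> y \<in> U \<Longrightarrow> riemannian_dist A g x y \<le> ennreal e"
proof -
  obtain \<kappa> where \<kappa>: "\<kappa> \<in> A" "p \<in> chart_dom \<kappa>" using obtain_chart .
  let ?c = "chart_map \<kappa> p"
  obtain R where R: "R > 0" "cball ?c R \<subseteq> chart_map \<kappa> ` (chart_dom \<kappa> \<inter> UNIV)"
    using obtain_small_chart_cball[OF \<kappa> open_UNIV UNIV_I] .
  then have ball: "cball ?c R \<subseteq> chart_map \<kappa> ` chart_dom \<kappa>" by auto
  obtain C where C:
    "\<And>y v. y \<in> cball ?c R \<Longrightarrow> sqrt (g \<kappa> (chart_inv \<kappa> y) v v) \<le> C * norm v"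
    using metric_comparable_to_norm[OF \<kappa>(1) compact_cball ball] by metis
  \<comment> \<open>A coordinate segment in the ball of radius \<open>\<rho>\<close> has length at most \<open>C * (2 * \<rho>)\<close>.\<close>
  define \<rho> where "\<rho> = min R (e / (2 * (\<bar>C\<bar> + 1)))"
  have "\<rho> \<le> e / (2 * (\<bar>C\<bar> + 1))" by (simp add: \<rho>_def)
  then have "(2 * (\<bar>C\<bar> + 1)) * \<rho> \<le> e" by (subst (asm) pos_le_divide_eq) (auto simp: mult.commute)
  then have \<rho>: "\<rho> > 0" "\<rho> \<le> R" "(\<bar>C\<bar> + 1) * (2 * \<rho>) \<le> e"
    using R(1) assms by (simp_all add: \<rho>_def) (simp add: algebra_simps)
  show ?thesis
  proof (rule that[of "chart_ball \<kappa> ?c \<rho>"])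
    show "open (chart_ball \<kappa> ?c \<rho>)" using open_chart_ball \<kappa>(1) .
    show "p \<in> chart_ball \<kappa> ?c \<rho>" using \<kappa>(2) \<rho>(1) by (simp add: chart_ball_def)
    fix x y assume xy: "x \<in> chart_ball \<kappa> ?c \<rho>" "y \<in> chart_ball \<kappa> ?c \<rho>"
    let ?a = "chart_map \<kappa> x" and ?b = "chart_map \<kappa> y"
    let ?\<gamma> = "\<lambda>t. chart_inv \<kappa> ((1 - t) *\<^sub>R ?a + t *\<^sub>R ?b)"
    have ab: "?a \<in> ball ?c \<rho>" "?b \<in> ball ?c \<rho>" using xy by (auto simp: chart_ball_def)
    then have "closed_segment ?a ?b \<subseteq> ball ?c \<rho>" by (intro closed_segment_subset) auto
    then have seg: "closed_segment ?a ?b \<subseteq> cball ?c R" using \<rho>(2) by auto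
    then have seg': "closed_segment ?a ?b \<subseteq> chart_map \<kappa> ` chart_dom \<kappa>" using ball by auto
    have "dist ?a ?b \<le> 2 * \<rho>" using ab dist_triangle2[of ?a ?b ?c] by (auto simp: dist_commute)
    then have len: "norm (?b - ?a) \<le> 2 * \<rho>" by (simp add: dist_norm norm_minus_commute)
    have speed: "speed A g ?\<gamma> t \<le> e" if "t \<in> {0..1}" for t
    proof -
      have "(1 - t) *\<^sub>R ?a + t *\<^sub>R ?b \<in> cball ?c R" using seg that by (auto simp: closed_segment_def)
      then have "speed A g ?\<gamma> t \<le> C * norm (?b - ?a)"
        using C C1_curve_chart_segment(2)[OF \<kappa>(1) seg' that] by simp
      also have "\<dots> \<le> (\<bar>C\<bar> + 1) * (2 * \<rho>)" using len by (intro mult_mono) auto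
      finally show ?thesis using \<rho>(3) by simp
    qed
    have "curve_length A g ?\<gamma> \<le> e"
    proof (cases "speed A g ?\<gamma> integrable_on {0..1}")
      case True
      then have "curve_length A g ?\<gamma> \<le> integral {0..1} (\<lambda>t::real. e)"
        unfolding curve_length_def using speed by (intro integral_le) auto
      then show ?thesis by simp
    qed (use assms in \<open>simp add: curve_length_def not_integrable_integral\<close>)
    moreover have "piecewise_C1_curve A ?\<gamma>"
      unfolding piecewise_C1_curve_def
      using C1_curve_chart_segment(1)[OF \<kappa>(1) seg'] by (intro exI[of _ 1] exI[of _ real]) auto
    moreover have "?\<gamma> 0 = x" "?\<gamma> 1 = y" using xy \<kappa>(1) by (auto simp: chart_ball_def)
    ultimately show "riemannian_dist A g x y \<le> ennreal e"
      unfolding riemannian_dist_def by (intro INF_lower2[of ?\<gamma>] ennreal_leI) auto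
  qed
qed

end

section \<open>Exponential growth of separated sets of a differentiable flow\<close>

text \<open>
  The points fall into different cells of a grid of mesh \<open>h / DIM('b)\<close>, since the norm is at most the
  sum of the absolute coordinates.
\<close>

lemma card_le_of_separated_in_ball:
  fixes X :: "'b::euclidean_space set"
  assumes "finite X" "\<And>x. x \<in> X \<Longrightarrow> norm x \<le> B" "h > 0"
    and "\<And>x y. x \<in> X \<Longrightarrow> y \<in> X \<Longrightarrow> x \<noteq> y \<Longrightarrow> h \<le> dist x y"
    and "B \<ge> 0"
  shows "real (card X) \<le> (2 * B * DIM('b) / h + 5) ^ DIM('b)"
proof (cases "X = {}")
  case False
  \<comment> \<open>The inverse mesh of the grid.\<close>
  define q where "q = DIM('b) / h"
  have "q > 0" using assms(3) by (simp add: q_def)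
  define N where "N = \<lceil>B * q\<rceil> + 1"
  define c where "c x = (\<lambda>b\<in>Basis. \<lfloor>(x \<bullet> b) * q\<rfloor>)" for x :: 'b
  have "inj_on c X"
  proof (rule inj_onI, rule ccontr)
    fix x y assume xy: "x \<in> X" "y \<in> X" "c x = c y" "x \<noteq> y"
    have "\<bar>(x - y) \<bullet> b\<bar> < h / DIM('b)" if "b \<in> Basis" for b
    proof -
      have "\<lfloor>(x \<bullet> b) * q\<rfloor> = \<lfloor>(y \<bullet> b) * q\<rfloor>" using fun_cong[OF xy(3), of b] that by (simp add: c_def)
      then have "\<bar>(x \<bullet> b) * q - (y \<bullet> b) * q\<bar> < 1" by linarith
      then have "\<bar>((x - y) \<bullet> b) * q\<bar> < 1" by (simp add: inner_diff_left left_diff_distrib)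
      then have "\<bar>(x - y) \<bullet> b\<bar> * q < 1" using \<open>q > 0\<close> by (simp add: abs_mult)
      then have "\<bar>(x - y) \<bullet> b\<bar> < 1 / q" using \<open>q > 0\<close> by (simp add: pos_less_divide_eq)
      then show ?thesis by (simp add: q_def)
    qed
    then have "(\<Sum>b\<in>Basis. \<bar>(x - y) \<bullet> b\<bar>) < (\<Sum>b\<in>(Basis :: 'b set). h / DIM('b))"
      by (intro sum_strict_mono) auto
    then have "norm (x - y) < h" using norm_le_l1[of "x - y"] by simp
    then show False using assms(4)[OF xy(1,2,4)] by (simp add: dist_norm)
  qed
  have "\<lfloor>(x \<bullet> b) * q\<rfloor> \<in> {- N..N}" if "x \<in> X" "b \<in> Basis" for x b
  proof -
    have "\<bar>x \<bullet> b\<bar> \<le> B" using Basis_le_norm[OF that(2), of x] assms(2)[OF that(1)] by linarith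
    then have "\<bar>(x \<bullet> b) * q\<bar> \<le> B * q" using \<open>q > 0\<close> by (simp add: abs_mult)
    then show ?thesis unfolding N_def atLeastAtMost_iff by linarith
  qed
  then have "c ` X \<subseteq> Basis \<rightarrow>\<^sub>E {- N..N}" unfolding c_def by (intro image_subsetI) auto
  then have "card (c ` X) \<le> card ((Basis :: 'b set) \<rightarrow>\<^sub>E {- N..N})"
    by (intro card_mono finite_PiE) auto
  also have "\<dots> = nat (2 * N + 1) ^ DIM('b)" by (simp add: card_PiE algebra_simps)
  finally have "card X \<le> nat (2 * N + 1) ^ DIM('b)" using card_image[OF \<open>inj_on c X\<close>] by simp
  then have "real (card X) \<le> real (nat (2 * N + 1)) ^ DIM('b)" by (metis of_nat_le_iff of_nat_power)
  also have "\<dots> \<le> (2 * B * DIM('b) / h + 5) ^ DIM('b)"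
  proof (rule power_mono)
    have "B * q \<ge> 0" using assms(5) \<open>q > 0\<close> by simp
    then have "0 \<le> \<lceil>B * q\<rceil>" "real_of_int \<lceil>B * q\<rceil> \<le> B * q + 1" by linarith+
    then have "real (nat (2 * N + 1)) \<le> 2 * (B * q) + 5" unfolding N_def by simp linarith
    then show "real (nat (2 * N + 1)) \<le> 2 * B * DIM('b) / h + 5" by (simp add: q_def)
  qed simp
  finally show ?thesis .
qed (use assms(3,5) in simp)

lemma norm_le_of_Basis_bounds:
  fixes f :: "'b::euclidean_space \<Rightarrow> 'c::real_normed_vector"
  assumes "linear f" "\<And>i. i \<in> Basis \<Longrightarrow> norm (f i) \<le> B i"
  shows "norm (f h) \<le> (\<Sum>i\<in>Basis. B i) * norm h"
proof -
  have "f h = f (\<Sum>i\<in>Basis. (h \<bullet> i) *\<^sub>R i)" by (simp add: euclidean_representation)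
  also have "\<dots> = (\<Sum>i\<in>Basis. (h \<bullet> i) *\<^sub>R f i)"
    by (simp add: linear_sum[OF assms(1)] linear_scale[OF assms(1)])
  finally have "norm (f h) \<le> (\<Sum>i\<in>Basis. norm ((h \<bullet> i) *\<^sub>R f i))" using norm_sum by metis
  also have "\<dots> \<le> (\<Sum>i\<in>Basis. B i * norm h)"
  proof (rule sum_mono)
    fix i :: 'b assume i: "i \<in> Basis"
    have "\<bar>h \<bullet> i\<bar> * norm (f i) \<le> norm h * B i"
      using Basis_le_norm[OF i, of h] assms(2)[OF i] by (intro mult_mono) auto
    then show "norm ((h \<bullet> i) *\<^sub>R f i) \<le> B i * norm h" by (simp add: mult.commute)
  qed
  finally show ?thesis by (simp add: sum_distrib_right)
qed

context Ck_manifold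
begin

text \<open>
  The mean value inequality on a coordinate ball, with the partial derivatives in the space
  directions bounded by compactness.
\<close>

lemma local_lipschitz_in_charts:
  assumes flow: "Ck_flow l A \<phi>" "1 \<le> l" and \<kappa>: "\<kappa> \<in> A" "\<kappa>' \<in> A"
    and p: "p \<in> chart_dom \<kappa>" "\<phi> t p \<in> chart_dom \<kappa>'"
  shows "\<exists>U L. open U \<and> p \<in> U \<and> U \<subseteq> chart_dom \<kappa> \<and> (\<forall>x\<in>U. \<phi> t x \<in> chart_dom \<kappa>') \<and>
    (\<forall>x\<in>U. \<forall>y\<in>U. dist (chart_map \<kappa>' (\<phi> t x)) (chart_map \<kappa>' (\<phi> t y)) \<le>
      L * dist (chart_map \<kappa> x) (chart_map \<kappa> y))"
proof -
  let ?S = "{(t, y). y \<in> chart_map \<kappa> ` chart_dom \<kappa> \<and> \<phi> t (chart_inv \<kappa> y) \<in> chart_dom \<kappa>'}"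
  let ?G = "\<lambda>(t, y). chart_map \<kappa>' (\<phi> t (chart_inv \<kappa> y))"
  have "Ck_on l ?G ?S" using flow(1) \<kappa> by (simp add: Ck_flow_def)
  from Ck_on_obtain_derivative[OF this flow(2)] obtain D where
    D: "\<And>z. z \<in> ?S \<Longrightarrow> (?G has_derivative D z) (at z)" and Dc: "\<And>v. continuous_on ?S (\<lambda>z. D z v)"
    by blast
  have cont: "continuous_on UNIV (\<phi> t)"
  proof -
    have "continuous_on UNIV (\<lambda>(t, x). \<phi> t x)" using flow(1) by (simp add: Ck_flow_def)
    then have "continuous_on UNIV (\<lambda>x. (\<lambda>(t, x). \<phi> t x) (t, x))"
      by (rule continuous_on_compose2) (auto intro!: continuous_intros)
    then show ?thesis by simp
  qed
  have "open (\<phi> t -` chart_dom \<kappa>')" using cont open_chart_dom[OF \<kappa>(2)] by (simp add: open_vimage)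
  then obtain R where R: "R > 0" "cball (chart_map \<kappa> p) R \<subseteq> chart_map \<kappa> ` (chart_dom \<kappa> \<inter> \<phi> t -` chart_dom \<kappa>')"
    using obtain_small_chart_cball[OF \<kappa>(1) p(1)] p(2) by (metis vimageI)
  let ?B = "cball (chart_map \<kappa> p) R"
  have BS: "(t, y) \<in> ?S" if y: "y \<in> ?B" for y
  proof -
    obtain x where "x \<in> chart_dom \<kappa>" "\<phi> t x \<in> chart_dom \<kappa>'" "y = chart_map \<kappa> x" using R(2) y by blast
    then show ?thesis using \<kappa>(1) by simp
  qed
  have "\<exists>b. \<forall>y\<in>?B. norm (D (t, y) (0, i)) \<le> b" for i
  proof -
    have "continuous_on ?B (\<lambda>y. D (t, y) (0, i))"
      by (rule continuous_on_compose2[OF Dc[of "(0, i)"]]) (use BS in \<open>auto intro!: continuous_intros\<close>)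
    then have "bounded ((\<lambda>y. D (t, y) (0, i)) ` ?B)"
      using compact_continuous_image compact_cball compact_imp_bounded by blast
    then show ?thesis by (auto simp: bounded_iff)
  qed
  then obtain b where b: "\<And>i y. y \<in> ?B \<Longrightarrow> norm (D (t, y) (0, i)) \<le> b i" by metis
  define L where "L = (\<Sum>i\<in>Basis. b i)"
  have lip: "norm (?G (t, y) - ?G (t, y')) \<le> L * norm (y - y')" if "y \<in> ?B" "y' \<in> ?B" for y y'
  proof (rule differentiable_bound[where f = "\<lambda>y. ?G (t, y)" and S = ?B and f' = "\<lambda>y h. D (t, y) (0, h)"])
    fix y assume y: "y \<in> ?B"
    have "(Pair t has_derivative (\<lambda>h. (0, h))) (at y within ?B)"
      by (auto intro!: derivative_eq_intros)
    from has_derivative_compose[OF this D[OF BS[OF y]]]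
    show "((\<lambda>y. ?G (t, y)) has_derivative (\<lambda>h. D (t, y) (0, h))) (at y within ?B)" .
    then have "linear (\<lambda>h. D (t, y) (0, h))" by (rule has_derivative_linear)
    from norm_le_of_Basis_bounds[OF this b[OF y]]
    show "onorm (\<lambda>h. D (t, y) (0, h)) \<le> L" unfolding L_def by (intro onorm_le)
  qed (use that in auto)
  let ?U = "chart_ball \<kappa> (chart_map \<kappa> p) R"
  have U: "x \<in> chart_dom \<kappa>" "chart_map \<kappa> x \<in> ?B" "\<phi> t x \<in> chart_dom \<kappa>'" if "x \<in> ?U" for x
    using that BS[of "chart_map \<kappa> x"] \<kappa>(1) by (auto simp: chart_ball_def)
  show ?thesis
  proof (intro exI[of _ ?U] exI[of _ L] conjI ballI)
    show "open ?U" using open_chart_ball \<kappa>(1) .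
    show "p \<in> ?U" using p(1) R(1) by (simp add: chart_ball_def)
    fix x y assume xy: "x \<in> ?U" "y \<in> ?U"
    show "dist (chart_map \<kappa>' (\<phi> t x)) (chart_map \<kappa>' (\<phi> t y)) \<le> L * dist (chart_map \<kappa> x) (chart_map \<kappa> y)"
      using lip[OF U(2)[OF xy(1)] U(2)[OF xy(2)]] U(1)[OF xy(1)] U(1)[OF xy(2)] \<kappa>(1)
      by (simp add: dist_norm)
  qed (use U in auto)
qed

lemma finite_compact_chart_cover:
  assumes "compact \<Lambda>"
  shows "\<exists>I. finite I \<and> (\<forall>i\<in>I. fst i \<in> A \<and> compact (snd i) \<and> snd i \<subseteq> chart_dom (fst i)) \<and>
    \<Lambda> \<subseteq> \<Union>(snd ` I)"
proof -
  have "\<exists>\<kappa> K V. \<kappa> \<in> A \<and> compact K \<and> K \<subseteq> chart_dom \<kappa> \<and> open V \<and> p \<in> V \<and> V \<subseteq> K" for p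
  proof -
    obtain \<kappa> where \<kappa>: "\<kappa> \<in> A" "p \<in> chart_dom \<kappa>" using obtain_chart .
    obtain R where R: "R > 0" "cball (chart_map \<kappa> p) R \<subseteq> chart_map \<kappa> ` (chart_dom \<kappa> \<inter> UNIV)"
      using obtain_small_chart_cball[OF \<kappa> open_UNIV UNIV_I] .
    then have R': "cball (chart_map \<kappa> p) R \<subseteq> chart_map \<kappa> ` chart_dom \<kappa>" by simp
    have K: "chart_inv \<kappa> ` cball (chart_map \<kappa> p) R = {q \<in> chart_dom \<kappa>. chart_map \<kappa> q \<in> cball (chart_map \<kappa> p) R}"
      by (rule chart_cball_preimage[OF \<kappa>(1) R'])
    show ?thesis
    proof (intro exI conjI)
      show "\<kappa> \<in> A" by fact
      show "compact (chart_inv \<kappa> ` cball (chart_map \<kappa> p) R)"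
        by (rule chart_preimage_compact[OF \<kappa>(1) compact_cball R'])
      show "chart_inv \<kappa> ` cball (chart_map \<kappa> p) R \<subseteq> chart_dom \<kappa>" unfolding K by blast
      show "open (chart_ball \<kappa> (chart_map \<kappa> p) R)" using open_chart_ball \<kappa>(1) .
      show "p \<in> chart_ball \<kappa> (chart_map \<kappa> p) R" using \<kappa>(2) R(1) by (simp add: chart_ball_def)
      show "chart_ball \<kappa> (chart_map \<kappa> p) R \<subseteq> chart_inv \<kappa> ` cball (chart_map \<kappa> p) R"
        unfolding K by (auto simp: chart_ball_def)
    qed
  qed
  then obtain c K V where c: "\<And>p. c p \<in> A \<and> compact (K p) \<and> K p \<subseteq> chart_dom (c p) \<and>
      open (V p) \<and> p \<in> V p \<and> V p \<subseteq> K p" by metis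
  obtain Q where Q: "Q \<subseteq> \<Lambda>" "finite Q" "\<Lambda> \<subseteq> (\<Union>p\<in>Q. V p)"
    by (rule compactE_image[OF assms, of \<Lambda> V]) (use c in auto)
  show ?thesis
  proof (intro exI[of _ "(\<lambda>p. (c p, K p)) ` Q"] conjI)
    show "\<Lambda> \<subseteq> \<Union>(snd ` (\<lambda>p. (c p, K p)) ` Q)" using Q(3) c by fastforce
  qed (use Q(2) c in auto)
qed

text \<open>
  A Lebesgue number for the coordinate distance of a single chart.
\<close>

lemma close_in_chart_imp_in_cover:
  assumes "\<kappa> \<in> A" "compact K" "K \<subseteq> chart_dom \<kappa>" "\<And>U. U \<in> C \<Longrightarrow> open U" "K \<subseteq> \<Union>C"
  shows "\<forall>\<^sub>F \<eta> in at_right 0. \<forall>x\<in>K. \<forall>y\<in>chart_dom \<kappa>.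
    dist (chart_map \<kappa> x) (chart_map \<kappa> y) < \<eta> \<longrightarrow> (\<exists>U\<in>C. x \<in> U \<and> y \<in> U)"
proof (rule compact_eventually_uniform[OF assms(2)])
  fix p assume p: "p \<in> K"
  then obtain U where U: "U \<in> C" "p \<in> U" using assms(5) by blast
  obtain R where R: "R > 0" "cball (chart_map \<kappa> p) R \<subseteq> chart_map \<kappa> ` (chart_dom \<kappa> \<inter> U)"
    by (rule obtain_small_chart_cball[OF assms(1) _ assms(4)[OF U(1)] U(2)]) (use p assms(3) in auto)
  have inU: "q \<in> U" if q: "q \<in> chart_dom \<kappa>" "chart_map \<kappa> q \<in> cball (chart_map \<kappa> p) R" for q
  proof -
    obtain q' where "q' \<in> chart_dom \<kappa> \<inter> U" "chart_map \<kappa> q = chart_map \<kappa> q'" using R(2) q(2) by blast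
    then show ?thesis using chart_inv_map[OF assms(1)] q(1) by (metis IntE)
  qed
  have "\<forall>\<^sub>F \<eta> in at_right 0. \<eta> < R / 2" using R(1) by (intro eventually_at_rightI[of 0 "R / 2"]) auto
  then have "\<forall>\<^sub>F \<eta> in at_right 0. \<forall>x\<in>chart_ball \<kappa> (chart_map \<kappa> p) (R / 2) \<inter> K. \<forall>y\<in>chart_dom \<kappa>.
      dist (chart_map \<kappa> x) (chart_map \<kappa> y) < \<eta> \<longrightarrow> (\<exists>U\<in>C. x \<in> U \<and> y \<in> U)"
  proof eventually_elim
    case (elim \<eta>)
    show ?case
    proof (intro ballI impI)
      fix x y assume x: "x \<in> chart_ball \<kappa> (chart_map \<kappa> p) (R / 2) \<inter> K" and y: "y \<in> chart_dom \<kappa>"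
        and xy: "dist (chart_map \<kappa> x) (chart_map \<kappa> y) < \<eta>"
      have dx: "dist (chart_map \<kappa> p) (chart_map \<kappa> x) < R / 2" using x by (simp add: chart_ball_def)
      then have "dist (chart_map \<kappa> p) (chart_map \<kappa> y) \<le> R"
        using dist_triangle[of "chart_map \<kappa> p" "chart_map \<kappa> y" "chart_map \<kappa> x"] xy elim by linarith
      then have "y \<in> U" using inU[OF y] by simp
      moreover have "x \<in> U" using inU[of x] x dx R(1) by (simp add: chart_ball_def)
      ultimately show "\<exists>U\<in>C. x \<in> U \<and> y \<in> U" using U(1) by blast
    qed
  qed
  then show "\<exists>V. open V \<and> p \<in> V \<and> (\<forall>\<^sub>F \<eta> in at_right 0. \<forall>x\<in>V \<inter> K. \<forall>y\<in>chart_dom \<kappa>.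
      dist (chart_map \<kappa> x) (chart_map \<kappa> y) < \<eta> \<longrightarrow> (\<exists>U\<in>C. x \<in> U \<and> y \<in> U))"
  proof (intro exI[of _ "chart_ball \<kappa> (chart_map \<kappa> p) (R / 2)"] conjI)
    show "open (chart_ball \<kappa> (chart_map \<kappa> p) (R / 2))" using open_chart_ball[OF assms(1)] .
    show "p \<in> chart_ball \<kappa> (chart_map \<kappa> p) (R / 2)"
      using p assms(3) R(1) by (auto simp: chart_ball_def)
  qed
qed

text \<open>
  The images are compared in every chart whose compact part contains \<open>f x\<close>, so that the estimate can
  be iterated along an orbit, whichever charts are chosen on the way.
\<close>

definition lipschitz_in_charts :: "(('a, 'b) chart \<times> 'a set) set \<Rightarrow> ('a \<Rightarrow> 'a) \<Rightarrow> real \<Rightarrow> 'a set \<Rightarrow> bool" where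
  "lipschitz_in_charts I f L U \<longleftrightarrow> (\<forall>i\<in>I. \<forall>j\<in>I. \<forall>x\<in>U \<inter> snd i. \<forall>y\<in>U.
    f x \<in> snd j \<longrightarrow> f y \<in> chart_dom (fst j) \<and>
    dist (chart_map (fst j) (f x)) (chart_map (fst j) (f y)) \<le>
      L * dist (chart_map (fst i) x) (chart_map (fst i) y))"

text \<open>
  Each chart comes with a compact part of its domain. A point of \<open>\<Lambda>\<close> is located in a compact part,
  while nearby points only have to lie in the chart domain.
\<close>

definition compact_chart_cover :: "(('a, 'b) chart \<times> 'a set) set \<Rightarrow> 'a set \<Rightarrow> bool" where
  "compact_chart_cover I \<Lambda> \<longleftrightarrow> finite I \<and>
    (\<forall>i\<in>I. fst i \<in> A \<and> compact (snd i) \<and> snd i \<subseteq> chart_dom (fst i)) \<and> \<Lambda> \<subseteq> \<Union>(snd ` I)"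

text \<open>
  If \<open>p\<close> or its image lies outside the compact part of the first or second chart of a pair, the
  condition holds vacuously near \<open>p\<close>, as the compact parts are closed. Otherwise it is the local
  Lipschitz estimate. One constant serves all points, by compactness of \<open>\<Lambda>\<close>, and all pairs, by
  finiteness.
\<close>

lemma uniformly_lipschitz_in_charts:
  assumes flow: "Ck_flow l A \<phi>" "1 \<le> l" and "compact \<Lambda>" and cover: "compact_chart_cover I \<Lambda>"
  shows "\<exists>L\<ge>1. \<forall>p\<in>\<Lambda>. \<exists>U. open U \<and> p \<in> U \<and> lipschitz_in_charts I (\<phi> t) L U"
proof -
  have "finite I" and I: "\<And>i. i \<in> I \<Longrightarrow> fst i \<in> A \<and> compact (snd i) \<and> snd i \<subseteq> chart_dom (fst i)"
    using cover by (simp_all add: compact_chart_cover_def)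
  define good where "good i j L U \<longleftrightarrow> (\<forall>x\<in>U \<inter> snd i. \<forall>y\<in>U.
    \<phi> t x \<in> snd j \<longrightarrow> \<phi> t y \<in> chart_dom (fst j) \<and>
    dist (chart_map (fst j) (\<phi> t x)) (chart_map (fst j) (\<phi> t y)) \<le>
      L * dist (chart_map (fst i) x) (chart_map (fst i) y))"
    for i j :: "('a, 'b) chart \<times> 'a set" and L :: real and U
  have good_mono: "good i j L' V" if "good i j L U" "L \<le> L'" "V \<subseteq> U" for i j L L' U V
    unfolding good_def
  proof (intro ballI impI conjI)
    fix x y assume "x \<in> V \<inter> snd i" "y \<in> V" "\<phi> t x \<in> snd j"
    then have *: "\<phi> t y \<in> chart_dom (fst j) \<and>
      dist (chart_map (fst j) (\<phi> t x)) (chart_map (fst j) (\<phi> t y)) \<le>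
        L * dist (chart_map (fst i) x) (chart_map (fst i) y)"
      using that(1,3) unfolding good_def by blast
    then show "\<phi> t y \<in> chart_dom (fst j)" ..
    have "L * dist (chart_map (fst i) x) (chart_map (fst i) y) \<le>
        L' * dist (chart_map (fst i) x) (chart_map (fst i) y)"
      using that(2) by (rule mult_right_mono) simp
    then show "dist (chart_map (fst j) (\<phi> t x)) (chart_map (fst j) (\<phi> t y)) \<le>
        L' * dist (chart_map (fst i) x) (chart_map (fst i) y)"
      using * by linarith
  qed
  have cont: "continuous_on UNIV (\<phi> t)"
  proof -
    have "continuous_on UNIV (\<lambda>(t, x). \<phi> t x)" using flow(1) by (simp add: Ck_flow_def)
    then have "continuous_on UNIV (\<lambda>x. (\<lambda>(t, x). \<phi> t x) (t, x))"
      by (rule continuous_on_compose2) (auto intro!: continuous_intros)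
    then show ?thesis by simp
  qed
  have local: "\<exists>U L. open U \<and> p \<in> U \<and> good i j L U" if ij: "i \<in> I" "j \<in> I" for p i j
  proof (cases "p \<in> snd i \<and> \<phi> t p \<in> snd j")
    case True
    have "p \<in> chart_dom (fst i)" "\<phi> t p \<in> chart_dom (fst j)" "fst i \<in> A" "fst j \<in> A"
      using True I[OF ij(1)] I[OF ij(2)] by auto
    from local_lipschitz_in_charts[OF flow this(3,4,1,2)] show ?thesis unfolding good_def by blast
  next
    case False
    let ?U = "- (snd i \<inter> \<phi> t -` snd j)"
    have "closed (snd i)" "closed (snd j)" using I[OF ij(1)] I[OF ij(2)] compact_imp_closed by blast+
    then have "closed (snd i \<inter> \<phi> t -` snd j)"
      using cont by (intro closed_Int closed_vimage) auto
    then have "open ?U" by (rule open_Compl)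
    moreover have "good i j 1 ?U" unfolding good_def by blast
    ultimately show ?thesis using False by blast
  qed
  have pair: "\<forall>\<^sub>F L in at_top. \<forall>p\<in>\<Lambda>. \<exists>U. open U \<and> p \<in> U \<and> good i j L U" if ij: "i \<in> I" "j \<in> I" for i j
  proof (rule compact_eventually_uniform[OF assms(3)])
    fix p
    obtain U L where U: "open U" "p \<in> U" "good i j L U" using local[OF ij] by blast
    have "\<forall>\<^sub>F L' in at_top. L \<le> L'" by (rule eventually_ge_at_top)
    then have "\<forall>\<^sub>F L' in at_top. \<forall>x\<in>U \<inter> \<Lambda>. \<exists>U. open U \<and> x \<in> U \<and> good i j L' U"
      by eventually_elim (use U(1) good_mono[OF U(3) _ order_refl] in blast)
    then show "\<exists>V. open V \<and> p \<in> V \<and>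
        (\<forall>\<^sub>F L' in at_top. \<forall>x\<in>V \<inter> \<Lambda>. \<exists>U. open U \<and> x \<in> U \<and> good i j L' U)"
      using U by blast
  qed
  have "\<forall>\<^sub>F L in at_top. \<forall>i\<in>I. \<forall>j\<in>I. \<forall>p\<in>\<Lambda>. \<exists>U. open U \<and> p \<in> U \<and> good i j L U"
    by (intro eventually_ball_finite ballI pair \<open>finite I\<close>)
  from eventually_happens'[OF _ eventually_conj[OF eventually_ge_at_top[of 1] this]]
  obtain L where L: "L \<ge> 1" "\<forall>i\<in>I. \<forall>j\<in>I. \<forall>p\<in>\<Lambda>. \<exists>U. open U \<and> p \<in> U \<and> good i j L U"
    by (auto simp only: trivial_limit_at_top_linorder)
  have "\<exists>U. open U \<and> p \<in> U \<and> (\<forall>i\<in>I. \<forall>j\<in>I. good i j L U)" if p: "p \<in> \<Lambda>" for p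
  proof -
    have "\<forall>q\<in>I \<times> I. \<exists>U. open U \<and> p \<in> U \<and> good (fst q) (snd q) L U" using L(2) p by (metis mem_Times_iff)
    from bchoice[OF this] obtain U where
      U: "\<forall>q\<in>I \<times> I. open (U q) \<and> p \<in> U q \<and> good (fst q) (snd q) L (U q)" ..
    let ?V = "\<Inter>q\<in>I \<times> I. U q"
    have "open ?V"
    proof (rule open_INT)
      show "finite (I \<times> I)" using \<open>finite I\<close> by simp
      show "\<forall>q\<in>I \<times> I. open (U q)" using U by simp
    qed
    moreover have "p \<in> ?V" using U by simp
    moreover have "good i j L ?V" if ij: "i \<in> I" "j \<in> I" for i j
    proof (rule good_mono)
      show "good i j L (U (i, j))" using bspec[OF U, of "(i, j)"] ij by simp
      show "?V \<subseteq> U (i, j)" using ij by blast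
    qed simp
    ultimately show ?thesis by blast
  qed
  then show ?thesis using L(1) unfolding good_def lipschitz_in_charts_def by blast
qed

text \<open>
  What is needed to follow two orbits for one unit of time: in between their distance is at most \<open>e\<close>,
  and at the end their coordinate distance has grown by at most the factor \<open>L\<close>.
\<close>

definition orbit_tracking_scale ::
  "('a \<Rightarrow> 'a \<Rightarrow> ennreal) \<Rightarrow> 'a set \<Rightarrow> (real \<Rightarrow> 'a \<Rightarrow> 'a) \<Rightarrow> (('a, 'b) chart \<times> 'a set) set \<Rightarrow>
    real \<Rightarrow> real \<Rightarrow> real \<Rightarrow> bool" where
  "orbit_tracking_scale \<rho> \<Lambda> \<phi> I L e \<eta> \<longleftrightarrow>
    (\<forall>i\<in>I. \<forall>x\<in>snd i \<inter> \<Lambda>. \<forall>y\<in>chart_dom (fst i).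
      dist (chart_map (fst i) x) (chart_map (fst i) y) < \<eta> \<longrightarrow>
      (\<exists>U. lipschitz_in_charts I (\<phi> 1) L U \<and> x \<in> U \<and> y \<in> U) \<and>
      (\<forall>s\<in>{0..1}. \<rho> (\<phi> s x) (\<phi> s y) \<le> ennreal e))"

lemma exists_orbit_tracking_scale:
  assumes "compact_flow \<rho> \<Lambda> \<phi>" "compact_chart_cover I \<Lambda>" "e > 0"
    and lip: "\<forall>p\<in>\<Lambda>. \<exists>U. open U \<and> p \<in> U \<and> lipschitz_in_charts I (\<phi> 1) L U"
  shows "\<exists>\<eta>>0. orbit_tracking_scale \<rho> \<Lambda> \<phi> I L e \<eta>"
proof -
  interpret compact_flow \<rho> \<Lambda> \<phi> by fact
  have I: "finite I" "\<And>i. i \<in> I \<Longrightarrow> fst i \<in> A" "\<And>i. i \<in> I \<Longrightarrow> compact (snd i)"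
    "\<And>i. i \<in> I \<Longrightarrow> snd i \<subseteq> chart_dom (fst i)"
    using assms(2) by (simp_all add: compact_chart_cover_def)
  define C where "C = {U. open U \<and> lipschitz_in_charts I (\<phi> 1) L U \<and>
    (\<forall>x\<in>U. \<forall>y\<in>U. \<forall>s\<in>{0..1}. \<rho> (\<phi> s x) (\<phi> s y) \<le> ennreal e)}"
  have cover: "\<Lambda> \<subseteq> \<Union>C"
  proof
    fix p assume p: "p \<in> \<Lambda>"
    obtain U where U: "open U" "p \<in> U" "lipschitz_in_charts I (\<phi> 1) L U" using lip p by blast
    obtain V where V: "open V" "p \<in> V"
      "\<And>x y s. x \<in> V \<Longrightarrow> y \<in> V \<Longrightarrow> s \<in> {0..1} \<Longrightarrow> \<rho> (\<phi> s x) (\<phi> s y) \<le> ennreal e"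
      using unit_time_locally_small[OF p assms(3)] by blast
    have "lipschitz_in_charts I (\<phi> 1) L (U \<inter> V)" using U(3) unfolding lipschitz_in_charts_def by blast
    then have "U \<inter> V \<in> C" using open_Int[OF U(1) V(1)] V(3) unfolding C_def by simp
    then show "p \<in> \<Union>C" using U(2) V(2) by blast
  qed
  have "\<forall>\<^sub>F \<eta> in at_right 0. \<forall>i\<in>I. \<forall>x\<in>snd i \<inter> \<Lambda>. \<forall>y\<in>chart_dom (fst i).
      dist (chart_map (fst i) x) (chart_map (fst i) y) < \<eta> \<longrightarrow> (\<exists>U\<in>C. x \<in> U \<and> y \<in> U)"
  proof (intro eventually_ball_finite[OF I(1)] ballI)
    fix i assume i: "i \<in> I"
    show "\<forall>\<^sub>F \<eta> in at_right 0. \<forall>x\<in>snd i \<inter> \<Lambda>. \<forall>y\<in>chart_dom (fst i).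
      dist (chart_map (fst i) x) (chart_map (fst i) y) < \<eta> \<longrightarrow> (\<exists>U\<in>C. x \<in> U \<and> y \<in> U)"
    proof (rule close_in_chart_imp_in_cover[OF I(2)[OF i]])
      show "compact (snd i \<inter> \<Lambda>)"
        using I(3)[OF i] compact_imp_closed[OF compact] by (rule compact_Int_closed)
      show "snd i \<inter> \<Lambda> \<subseteq> chart_dom (fst i)" using I(4)[OF i] by blast
      show "snd i \<inter> \<Lambda> \<subseteq> \<Union>C" using cover by blast
      show "open U" if "U \<in> C" for U using that by (simp add: C_def)
    qed
  qed
  then obtain b :: real where "b > 0" and b: "\<forall>\<eta>>0. \<eta> < b \<longrightarrow>
      (\<forall>i\<in>I. \<forall>x\<in>snd i \<inter> \<Lambda>. \<forall>y\<in>chart_dom (fst i).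
      dist (chart_map (fst i) x) (chart_map (fst i) y) < \<eta> \<longrightarrow> (\<exists>U\<in>C. x \<in> U \<and> y \<in> U))"
    unfolding eventually_at_right_field by blast
  have "orbit_tracking_scale \<rho> \<Lambda> \<phi> I L e (b / 2)"
    unfolding orbit_tracking_scale_def
  proof (intro ballI impI)
    fix i x y assume *: "i \<in> I" "x \<in> snd i \<inter> \<Lambda>" "y \<in> chart_dom (fst i)"
      "dist (chart_map (fst i) x) (chart_map (fst i) y) < b / 2"
    have "\<exists>U\<in>C. x \<in> U \<and> y \<in> U"
      using b[rule_format, of "b / 2", OF _ _ *] \<open>b > 0\<close> by simp
    then show "(\<exists>U. lipschitz_in_charts I (\<phi> 1) L U \<and> x \<in> U \<and> y \<in> U) \<and>
        (\<forall>s\<in>{0..1}. \<rho> (\<phi> s x) (\<phi> s y) \<le> ennreal e)"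
      unfolding C_def by blast
  qed
  then show ?thesis using \<open>b > 0\<close> half_gt_zero by blast
qed

text \<open>
  The coordinate distance grows by at most the factor \<open>L\<close> per unit of time, so it is below \<open>\<eta>\<close> at all
  integer times up to \<open>n\<close>; within a unit of time the scale \<open>\<eta>\<close> controls the distance.
\<close>

lemma orbit_tracking:
  assumes "compact_flow \<rho> \<Lambda> \<phi>" "compact_chart_cover I \<Lambda>" "L \<ge> 1" "\<eta> > 0"
    and scale: "orbit_tracking_scale \<rho> \<Lambda> \<phi> I L e \<eta>"
    and "i \<in> I" "x \<in> snd i" "x \<in> \<Lambda>" "y \<in> \<Lambda>" "y \<in> chart_dom (fst i)" "s \<in> {0..real n}"
    and "dist (chart_map (fst i) x) (chart_map (fst i) y) < \<eta> / L ^ n"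
  shows "\<rho> (\<phi> s x) (\<phi> s y) \<le> ennreal e"
proof -
  interpret compact_flow \<rho> \<Lambda> \<phi> by fact
  show ?thesis
    using assms(6-)
  proof (induction n arbitrary: i x y s)
    case 0
    then have "\<forall>s\<in>{0..1}. \<rho> (\<phi> s x) (\<phi> s y) \<le> ennreal e"
      using scale unfolding orbit_tracking_scale_def by simp
    then have "\<rho> (\<phi> 0 x) (\<phi> 0 y) \<le> ennreal e" by (rule bspec) simp
    then show ?case using 0 by simp
  next
    case (Suc n)
    have "L ^ Suc n \<ge> 1" using assms(3) by (rule one_le_power)
    then have "\<eta> / L ^ Suc n \<le> \<eta> / 1" using assms(4) by (intro divide_left_mono) auto
    then have "dist (chart_map (fst i) x) (chart_map (fst i) y) < \<eta>" using Suc.prems(7) by simp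
    then have "(\<exists>U. lipschitz_in_charts I (\<phi> 1) L U \<and> x \<in> U \<and> y \<in> U) \<and>
        (\<forall>s\<in>{0..1}. \<rho> (\<phi> s x) (\<phi> s y) \<le> ennreal e)"
      using scale Suc.prems(1-3,5) unfolding orbit_tracking_scale_def by simp
    then obtain U where U: "lipschitz_in_charts I (\<phi> 1) L U" "x \<in> U" "y \<in> U"
      and unit: "\<forall>s\<in>{0..1}. \<rho> (\<phi> s x) (\<phi> s y) \<le> ennreal e" by blast
    show ?case
    proof (cases "s \<le> 1")
      case True
      then show ?thesis using unit Suc.prems(6) by simp
    next
      case False
      obtain j where j: "j \<in> I" "\<phi> 1 x \<in> snd j"
        using assms(2) invariant[OF Suc.prems(3), of 1] unfolding compact_chart_cover_def by blast
      have lip: "\<phi> 1 y \<in> chart_dom (fst j) \<and>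
        dist (chart_map (fst j) (\<phi> 1 x)) (chart_map (fst j) (\<phi> 1 y)) \<le>
          L * dist (chart_map (fst i) x) (chart_map (fst i) y)"
        using U(1)[unfolded lipschitz_in_charts_def, rule_format, OF Suc.prems(1) j(1) _ U(3) j(2)]
          U(2) Suc.prems(2) by simp
      have "L * dist (chart_map (fst i) x) (chart_map (fst i) y) < L * (\<eta> / L ^ Suc n)"
        using Suc.prems(7) assms(3) by (intro mult_strict_left_mono) auto
      also have "\<dots> = \<eta> / L ^ n" using assms(3) by simp
      finally have "dist (chart_map (fst j) (\<phi> 1 x)) (chart_map (fst j) (\<phi> 1 y)) < \<eta> / L ^ n"
        using lip by linarith
      then have "\<rho> (\<phi> (s - 1) (\<phi> 1 x)) (\<phi> (s - 1) (\<phi> 1 y)) \<le> ennreal e"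
        using lip False Suc.prems(6)
        by (intro Suc.IH[OF j invariant[OF Suc.prems(3)] invariant[OF Suc.prems(4)]]) auto
      then show ?thesis by (simp flip: flow_add)
    qed
  qed
qed

lemma card_separated_in_chart:
  assumes "compact_flow \<rho> \<Lambda> \<phi>" and cover: "compact_chart_cover I \<Lambda>" and "L \<ge> 1" "\<eta> > 0"
    and scale: "orbit_tracking_scale \<rho> \<Lambda> \<phi> I L e \<eta>"
    and i: "i \<in> I" and B: "B \<ge> 0" "\<And>x. x \<in> snd i \<Longrightarrow> norm (chart_map (fst i) x) \<le> B"
    and E: "finite E" "separated \<rho> \<Lambda> \<phi> (real n) e E"
  shows "real (card (E \<inter> snd i)) \<le> (2 * B * DIM('b) / \<eta> + 5) ^ DIM('b) * (L ^ DIM('b)) ^ n"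
proof -
  have E\<Lambda>: "E \<subseteq> \<Lambda>" using E(2) by (simp add: separated_def)
  have iA: "fst i \<in> A" and dom: "snd i \<subseteq> chart_dom (fst i)"
    using cover i by (simp_all add: compact_chart_cover_def)
  have "L ^ n \<ge> 1" using assms(3) by (rule one_le_power)
  have inj: "inj_on (chart_map (fst i)) (E \<inter> snd i)"
  proof (rule inj_on_inverseI)
    fix x assume "x \<in> E \<inter> snd i"
    then show "chart_inv (fst i) (chart_map (fst i) x) = x" using chart_inv_map[OF iA] dom by blast
  qed
  have "real (card (chart_map (fst i) ` (E \<inter> snd i))) \<le> (2 * B * DIM('b) / (\<eta> / L ^ n) + 5) ^ DIM('b)"
  proof (rule card_le_of_separated_in_ball)
    show "0 < \<eta> / L ^ n" using \<open>\<eta> > 0\<close> \<open>L ^ n \<ge> 1\<close> by simp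
    show "norm u \<le> B" if "u \<in> chart_map (fst i) ` (E \<inter> snd i)" for u using that B(2) by blast
    fix u v assume "u \<in> chart_map (fst i) ` (E \<inter> snd i)" "v \<in> chart_map (fst i) ` (E \<inter> snd i)" "u \<noteq> v"
    then obtain x y where xy: "x \<in> E" "x \<in> snd i" "u = chart_map (fst i) x" "y \<in> E" "y \<in> snd i"
      "v = chart_map (fst i) y" "x \<noteq> y" by blast
    then obtain s where s: "s \<in> {0..real n}" "ennreal e < \<rho> (\<phi> s x) (\<phi> s y)"
      using E(2) unfolding separated_def by blast
    have in_\<Lambda>: "x \<in> \<Lambda>" "y \<in> \<Lambda>" "y \<in> chart_dom (fst i)" using xy E\<Lambda> dom by auto
    show "\<eta> / L ^ n \<le> dist u v"
    proof (rule ccontr)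
      assume "\<not> \<eta> / L ^ n \<le> dist u v"
      then have "dist (chart_map (fst i) x) (chart_map (fst i) y) < \<eta> / L ^ n" using xy by simp
      from orbit_tracking[OF assms(1) cover assms(3,4) scale i xy(2) in_\<Lambda> s(1) this]
      show False using s(2) by simp
    qed
  qed (use E(1) B(1) in auto)
  also have "\<dots> \<le> ((2 * B * DIM('b) / \<eta> + 5) * L ^ n) ^ DIM('b)"
  proof (rule power_mono)
    have "2 * B * DIM('b) / (\<eta> / L ^ n) + 5 \<le> 2 * B * DIM('b) / \<eta> * L ^ n + 5 * L ^ n"
      using \<open>L ^ n \<ge> 1\<close> by simp
    then show "2 * B * DIM('b) / (\<eta> / L ^ n) + 5 \<le> (2 * B * DIM('b) / \<eta> + 5) * L ^ n"
      by (simp add: distrib_right)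
    have "0 \<le> 2 * B * DIM('b) / (\<eta> / L ^ n)"
      using B(1) \<open>\<eta> > 0\<close> \<open>L ^ n \<ge> 1\<close> by (intro divide_nonneg_pos mult_nonneg_nonneg) auto
    then show "0 \<le> 2 * B * DIM('b) / (\<eta> / L ^ n) + 5" by linarith
  qed
  also have "\<dots> = (2 * B * DIM('b) / \<eta> + 5) ^ DIM('b) * (L ^ DIM('b)) ^ n"
    by (simp only: power_mult_distrib mult.commute[of n] flip: power_mult)
  finally show ?thesis using card_image[OF inj] by simp
qed

text \<open>
  By \<open>orbit_tracking\<close>, points that are separated up to time \<open>n\<close> and lie in the same compact part have
  coordinate distance at least \<open>\<eta> / L ^ n\<close>. A bounded region contains \<open>O(L ^ (n * DIM('b)))\<close> such points.
  The scale \<open>e\<close> enters the constant \<open>C\<close> through \<open>\<eta>\<close>, but not the rate.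
\<close>

lemma card_separated_exponential:
  assumes cf: "compact_flow \<rho> \<Lambda> \<phi>" and Ckflow: "Ck_flow l A \<phi>" "1 \<le> l"
  shows "\<exists>K\<ge>1. \<forall>e>0. \<exists>C. \<forall>n E. finite E \<longrightarrow> separated \<rho> \<Lambda> \<phi> (real n) e E \<longrightarrow> real (card E) \<le> C * K ^ n"
proof -
  have compact: "compact \<Lambda>" using cf by (simp add: compact_flow_def compact_gauge_def)
  obtain I where cover: "compact_chart_cover I \<Lambda>"
    using finite_compact_chart_cover[OF compact] unfolding compact_chart_cover_def by blast
  then have I: "finite I" "\<Lambda> \<subseteq> \<Union>(snd ` I)" by (simp_all add: compact_chart_cover_def)
  obtain L where L: "L \<ge> 1" "\<forall>p\<in>\<Lambda>. \<exists>U. open U \<and> p \<in> U \<and> lipschitz_in_charts I (\<phi> 1) L U"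
    using uniformly_lipschitz_in_charts[OF Ckflow compact cover, where t = 1] by blast
  have "bounded (\<Union>i\<in>I. chart_map (fst i) ` snd i)"
  proof (rule bounded_UN[OF I(1)], rule ballI)
    fix i assume "i \<in> I"
    then have i: "fst i \<in> A" "compact (snd i)" "snd i \<subseteq> chart_dom (fst i)"
      using cover by (simp_all add: compact_chart_cover_def)
    from compact_continuous_image[OF continuous_on_subset[OF continuous_on_chart_map[OF i(1)] i(3)] i(2)]
    show "bounded (chart_map (fst i) ` snd i)" by (rule compact_imp_bounded)
  qed
  then obtain B where B: "B > 0" "\<forall>u\<in>(\<Union>i\<in>I. chart_map (fst i) ` snd i). norm u \<le> B"
    unfolding bounded_pos by blast
  have "\<exists>C. \<forall>n E. finite E \<longrightarrow> separated \<rho> \<Lambda> \<phi> (real n) e E \<longrightarrow> real (card E) \<le> C * (L ^ DIM('b)) ^ n"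
    if "e > 0" for e
  proof -
    obtain \<eta> where \<eta>: "\<eta> > 0" "orbit_tracking_scale \<rho> \<Lambda> \<phi> I L e \<eta>"
      using exists_orbit_tracking_scale[OF cf cover \<open>e > 0\<close> L(2)] by blast
    show ?thesis
    proof (intro exI[of _ "card I * (2 * B * DIM('b) / \<eta> + 5) ^ DIM('b)"] allI impI)
      fix n E assume E: "finite E" "separated \<rho> \<Lambda> \<phi> (real n) e E"
      have "E \<subseteq> \<Lambda>" using E(2) by (simp add: separated_def)
      then have "E = (\<Union>i\<in>I. E \<inter> snd i)" using I(2) by blast
      then have "card E \<le> (\<Sum>i\<in>I. card (E \<inter> snd i))"
        using card_UN_le[OF I(1), of "\<lambda>i. E \<inter> snd i"] by simp
      then have "real (card E) \<le> (\<Sum>i\<in>I. real (card (E \<inter> snd i)))"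
        by (simp only: of_nat_le_iff flip: of_nat_sum)
      also have "\<dots> \<le> (\<Sum>i\<in>I. (2 * B * DIM('b) / \<eta> + 5) ^ DIM('b) * (L ^ DIM('b)) ^ n)"
      proof (rule sum_mono)
        fix i assume i: "i \<in> I"
        have "norm (chart_map (fst i) x) \<le> B" if "x \<in> snd i" for x using B(2) i that by blast
        from card_separated_in_chart[OF cf cover L(1) \<eta> i less_imp_le[OF B(1)] this E]
        show "real (card (E \<inter> snd i)) \<le> (2 * B * DIM('b) / \<eta> + 5) ^ DIM('b) * (L ^ DIM('b)) ^ n" .
      qed
      finally show "real (card E) \<le> card I * (2 * B * DIM('b) / \<eta> + 5) ^ DIM('b) * (L ^ DIM('b)) ^ n"
        by (simp add: mult.assoc)
    qed
  qed
  moreover have "1 \<le> L ^ DIM('b)" using L(1) by (rule one_le_power)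
  ultimately show ?thesis by blast
qed

end

section \<open>The reparametrized flow has pressure zero\<close>

text \<open>
  The bound does not involve the scale, hence survives the limit of small scales.
\<close>

lemma (in compact_flow) top_pressure_upper_bound:
  assumes h: "continuous_on \<Lambda> h" "\<And>x. x \<in> \<Lambda> \<Longrightarrow> \<bar>h x\<bar> \<le> M" and "K \<ge> 1"
    and growth: "\<forall>e>0. \<exists>C. \<forall>n E. finite E \<longrightarrow> separated \<rho> \<Lambda> \<phi> (real n) e E \<longrightarrow> real (card E) \<le> C * K ^ n"
  shows "top_pressure \<rho> \<Lambda> \<phi> h \<le> ereal (ln K + M)"
  unfolding top_pressure_le_iff
proof (intro allI impI)
  fix \<epsilon> b :: real assume "\<epsilon> > 0" "b > ln K + M"
  obtain C where C: "\<And>n E. finite E \<Longrightarrow> separated \<rho> \<Lambda> \<phi> (real n) \<epsilon> E \<Longrightarrow> real (card E) \<le> C * K ^ n"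
    using growth \<open>\<epsilon> > 0\<close> by blast
  have "b - (ln K + M) > 0" using \<open>b > ln K + M\<close> by simp
  then have "\<forall>\<^sub>F t in at_top. \<bar>C\<bar> * K \<le> exp ((b - (ln K + M)) * t)" by real_asymp
  then show "\<forall>\<^sub>F t in at_top. partition_sum \<rho> \<Lambda> \<phi> h \<epsilon> t \<le> ennreal (exp (b * t))"
    using eventually_ge_at_top[of 0]
  proof eventually_elim
    case (elim t)
    define n where "n = nat \<lceil>t\<rceil>"
    have n: "t \<le> real n" "real n \<le> t + 1" using elim(2) unfolding n_def by linarith+
    have "K ^ n = exp (real n * ln K)" using \<open>K \<ge> 1\<close> by (simp add: exp_of_nat_mult)
    also have "\<dots> \<le> exp ((t + 1) * ln K)" using n(2) \<open>K \<ge> 1\<close> by (simp add: mult_right_mono)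
    also have "\<dots> = K * exp (t * ln K)" using \<open>K \<ge> 1\<close> by (simp add: distrib_right exp_add)
    finally have Kn: "K ^ n \<le> K * exp (t * ln K)" .
    show ?case
    proof (rule partition_sum_leI)
      fix E assume E: "separated \<rho> \<Lambda> \<phi> t \<epsilon> E" "finite E"
      have "exp (LBINT s=0..t. h (\<phi> s x)) \<le> exp (M * t)" if "x \<in> E" for x
      proof -
        have x: "x \<in> \<Lambda>" using E(1) that by (auto simp: separated_def)
        show ?thesis
          using orbit_integral_bound[OF h(1) x elim(2) h(2)] interval_integral_eq_orbit_integral[OF h(1) x elim(2)]
          by simp
      qed
      then have "(\<Sum>x\<in>E. exp (LBINT s=0..t. h (\<phi> s x))) \<le> card E * exp (M * t)"
        by (rule sum_bounded_above)
      also have "\<dots> \<le> (C * K ^ n) * exp (M * t)"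
        using C[OF E(2) separated_antimono[OF E(1) order_refl n(1)]] by (rule mult_right_mono) simp
      also have "\<dots> \<le> (\<bar>C\<bar> * (K * exp (t * ln K))) * exp (M * t)"
        using Kn \<open>K \<ge> 1\<close> by (intro mult_right_mono mult_mono) auto
      also have "\<dots> = (\<bar>C\<bar> * K) * exp ((ln K + M) * t)" by (simp add: exp_add algebra_simps)
      also have "\<dots> \<le> exp ((b - (ln K + M)) * t) * exp ((ln K + M) * t)"
        using elim(1) by (rule mult_right_mono) simp
      also have "\<dots> = exp (b * t)" by (simp add: algebra_simps flip: exp_add)
      finally show "(\<Sum>x\<in>E. exp (LBINT s=0..t. h (\<phi> s x))) \<le> exp (b * t)" .
    qed
  qed
qed

lemma (in Riemannian_manifold) compact_flow_riemannian_dist: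
  assumes "compact \<Lambda>" "Ck_flow l A \<phi>" "\<And>x t. x \<in> \<Lambda> \<Longrightarrow> \<phi> t x \<in> \<Lambda>"
  shows "compact_flow (riemannian_dist A g) \<Lambda> \<phi>"
proof
  show "compact \<Lambda>" "\<And>x t. x \<in> \<Lambda> \<Longrightarrow> \<phi> t x \<in> \<Lambda>" by fact+
  show "is_flow \<phi>" "continuous_on UNIV (\<lambda>(t, x). \<phi> t x)" using assms(2) by (simp_all add: Ck_flow_def)
  show "\<exists>U. open U \<and> p \<in> U \<and> (\<forall>x\<in>U. \<forall>y\<in>U. riemannian_dist A g x y \<le> ennreal e)" if "e > 0" for p e
    by (rule riemannian_dist_locally_small[OF that, of p]) blast
  show "\<exists>V d. open V \<and> p \<in> V \<and> d > 0 \<and> (\<forall>x\<in>V. \<forall>y. y \<notin> W \<longrightarrow> ennreal d < riemannian_dist A g x y)"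
    if "open W" "p \<in> W" for p W
    by (rule riemannian_dist_separates_locally[OF that]) blast
qed

theorem theorem2:
  fixes A :: "('a::{t2_space,second_countable_topology}, 'b::euclidean_space) chart set"
    and g :: "('a, 'b) chart \<Rightarrow> 'a \<Rightarrow> 'b \<Rightarrow> 'b \<Rightarrow> real"
    and f :: "('a, 'b) chart \<Rightarrow> 'a \<Rightarrow> 'b"
    and \<phi> \<psi> :: "real \<Rightarrow> 'a \<Rightarrow> 'a"
    and r \<xi> :: "'a \<Rightarrow> real"
    and \<Lambda> :: "'a set"
    and m l :: nat
  assumes "2 \<le> m" "1 \<le> l" "l < m"
    and "Ck_atlas m A"
    and "Ck_riemannian_metric (m - 1) A g"
    and "Ck_vector_field l A f"
    and "Ck_flow l A \<phi>" "generates_flow A f \<phi>"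
    and "compact \<Lambda>" "\<Lambda> \<noteq> {}" "flow_invariant \<phi> \<Lambda>"
    and "Ck_flow l A \<psi>" "time_reparam_on \<Lambda> A f \<phi> \<psi> r"
    and "continuous_on \<Lambda> r" "\<forall>x\<in>\<Lambda>. 0 < r x"
    and "continuous_on \<Lambda> \<xi>"
  shows "\<exists>P::real. top_pressure (riemannian_dist A g) \<Lambda> \<phi> \<xi> = ereal P \<and>
           top_pressure (riemannian_dist A g) \<Lambda> \<psi> (\<lambda>x. (\<xi> x - P) / r x) = 0"
proof -
  interpret Riemannian_manifold A m "m - 1" g
    by unfold_locales (use assms(1,4,5) in auto)
  let ?\<rho> = "riemannian_dist A g"
  have \<phi>_inv: "\<phi> t x \<in> \<Lambda>" if "x \<in> \<Lambda>" for t x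
    using assms(11) that unfolding flow_invariant_def by blast
  have \<psi>_inv: "\<psi> t x \<in> \<Lambda>" if x: "x \<in> \<Lambda>" for t x
  proof -
    have "\<psi> t x \<in> range (\<lambda>t. \<phi> t x)" using assms(13) x unfolding time_reparam_on_def by blast
    then show ?thesis using \<phi>_inv[OF x] by auto
  qed
  have \<phi>: "compact_flow ?\<rho> \<Lambda> \<phi>" using assms(9,7) \<phi>_inv by (rule compact_flow_riemannian_dist)
  have \<psi>: "compact_flow ?\<rho> \<Lambda> \<psi>" using assms(9,12) \<psi>_inv by (rule compact_flow_riemannian_dist)
  interpret P: compact_flow ?\<rho> \<Lambda> \<phi> by (rule \<phi>)
  interpret S: compact_flow ?\<rho> \<Lambda> \<psi> by (rule \<psi>)
  interpret time_change ?\<rho> \<Lambda> \<phi> \<psi> r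
  proof
    show "continuous_on \<Lambda> r" by fact
    fix x assume x: "x \<in> \<Lambda>"
    show "0 < r x" using assms(15) x by blast
    fix t :: real assume t: "0 \<le> t"
    have "\<psi> (reparam_time \<phi> r x t) x = \<phi> t x" using assms(13) x by (simp add: time_reparam_on_def)
    then show "\<psi> (P.orbit_integral r t x) x = \<phi> t x"
      unfolding reparam_time_def P.interval_integral_eq_orbit_integral[OF assms(14) x t] .
  qed
  obtain M where M: "\<And>x. x \<in> \<Lambda> \<Longrightarrow> \<bar>\<xi> x\<bar> \<le> M" using P.obtain_bound[OF assms(16)] by blast
  obtain K where K: "K \<ge> 1" "\<forall>e>0. \<exists>C. \<forall>n E. finite E \<longrightarrow> separated ?\<rho> \<Lambda> \<phi> (real n) e E \<longrightarrow>
      real (card E) \<le> C * K ^ n"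
    using card_separated_exponential[OF \<phi> assms(7,2)] by blast
  have "top_pressure ?\<rho> \<Lambda> \<phi> \<xi> \<le> ereal (ln K + M)"
    by (rule P.top_pressure_upper_bound[OF assms(16) M K])
  moreover have "\<not> top_pressure ?\<rho> \<Lambda> \<phi> \<xi> \<le> ereal (- M - 1)"
    by (rule P.top_pressure_lower_bound[OF assms(16,10) M]) auto
  ultimately obtain P where P: "top_pressure ?\<rho> \<Lambda> \<phi> \<xi> = ereal P"
    by (cases "top_pressure ?\<rho> \<Lambda> \<phi> \<xi>") auto
  then show ?thesis using pressure_time_change[OF assms(16) P] by blast
qed

end
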